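(* Let $\alpha_j,\beta_j\in\mathbb{C}$, not both zero, with $\Re\alpha_j>-1/2$ and $\alpha_j\pm\beta_j\neq-1,-2,\dots$. Then a solution to the Riemann-Hilbert problem (a)-(c) for $\Psi_j(\zeta)$ described in the context, $0<\arg\zeta<2\pi$, is given by the following function in the sector $I$: $$\Psi_j(\zeta)=\Psi_j^{(I)}(\zeta)=\begin{pmatrix}\Psi_{11}&\Psi_{12}\\ \Psi_{21}&\Psi_{22}\end{pmatrix},$$ $$\Psi_{11}=\zeta^{\alpha_j}\psi(\alpha_j+\beta_j,1+2\alpha_j,\zeta)e^{i\pi(2\beta_j+\alpha_j)}e^{-\zeta/2},$$ $$\Psi_{12}=-\zeta^{\alpha_j}\psi(1+\alpha_j-\beta_j,1+2\alpha_j,e^{-i\pi}\zeta)e^{i\pi(\beta_j+\alpha_j)}e^{\zeta/2}\frac{\Gamma(1+\alpha_j-\beta_j)}{\Gamma(\alpha_j+\beta_j)},$$ $$\Psi_{21}=-\zeta^{-\alpha_j}\psi(1-\alpha_j+\beta_j,1-2\alpha_j,\zeta)e^{i\pi(\beta_j-3\alpha_j)}e^{-\zeta/2}\frac{\Gamma(1+\alpha_j+\beta_j)}{\Gamma(\alpha_j-\beta_j)},$$ $$\Psi_{22}=\zeta^{-\alpha_j}\psi(-\alpha_j-\beta_j,1-2\alpha_j,e^{-i\pi}\zeta)e^{-i\pi\alpha_j}e^{\zeta/2},$$ where $\psi(a,b,x)$ is the confluent hypergeometric function of the second kind. The solution in the other sectors is given by successive application of the jump conditions to $\Psi_j^{(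I)}$.
   Context: Contour: $\Gamma_1,\dots,\Gamma_8$ are eight rays from the origin in the $\zeta$-plane, numbered counterclockwise: $\Gamma_1$ is the positive imaginary half-axis, $\Gamma_3$ the negative real half-axis, $\Gamma_5$ the negative imaginary half-axis, $\Gamma_7$ the positive real half-axis, and $\Gamma_2,\Gamma_4,\Gamma_6,\Gamma_8$ are rays inside the open quadrants between $\Gamma_1,\Gamma_3$; $\Gamma_3,\Gamma_5$; $\Gamma_5,\Gamma_7$; $\Gamma_7,\Gamma_1$ respectively. The sectors are numbered counterclockwise: $I$ lies between $\Gamma_1$ and $\Gamma_2$, $II$ between $\Gamma_2,\Gamma_3$, $III$ between $\Gamma_3,\Gamma_4$, $IV$ between $\Gamma_4,\Gamma_5$, $V$ between $\Gamma_5,\Gamma_6$, $VI$ between $\Gamma_6,\Gamma_7$, $VII$ between $\Gamma_7,\Gamma_8$, $VIII$ between $\Gamma_8,\Gamma_1$. The sectors outside the lenses are $II,III,VI,VII$. Riemann-Hilbert problem for a $2\times2$ matrix function $\Psi_j(\zeta)$: (a) $\Psi_j$ is analytic for $\zeta\in\mathbb{C}\setminus\bigcup_{k=1}^8\Gamma_k$. (b) Jump conditions $\Psi_{j,+}=\Psi_{j,-}J_k$ on $\Gamma_k$ (continuous boundary values away from $0$), with $J_1=\begin{pmatrix}0&e^{-i\pi\beta_j}\\ -e^{i\pi\beta_j}&0\end{pmatrix}$, $J_5=\begin{pmatrix}0&e^{i\pi\beta_j}\\ -e^{-i\pi\beta_j}&0\end{pmatrix}$, $J_3=J_7=e^{i\pi\alpha_j\sigma_3}=\mathrm{diag}(e^{i\pi\alpha_j},e^{-i\pi\alpha_j})$,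 $J_2=\begin{pmatrix}1&0\\ e^{i\pi(\beta_j-2\alpha_j)}&1\end{pmatrix}$, $J_4=\begin{pmatrix}1&0\\ e^{-i\pi(\beta_j-2\alpha_j)}&1\end{pmatrix}$, $J_8=\begin{pmatrix}1&0\\ e^{i\pi(\beta_j+2\alpha_j)}&1\end{pmatrix}$, $J_6=\begin{pmatrix}1&0\\ e^{-i\pi(\beta_j+2\alpha_j)}&1\end{pmatrix}$. The $(+,-)$ sides are: on $\Gamma_1$: $(I,VIII)$; on $\Gamma_2$: $(II,I)$; on $\Gamma_3$: $(III,II)$; on $\Gamma_4$: $(III,IV)$; on $\Gamma_5$: $(IV,V)$; on $\Gamma_6$: $(V,VI)$; on $\Gamma_7$: $(VII,VI)$; on $\Gamma_8$: $(VIII,VII)$. (c) As $\zeta\to0$, $\zeta\in\mathbb{C}\setminus\bigcup_{k=1}^8\Gamma_k$ outside the lenses, $\Psi_j(\zeta)=\begin{pmatrix}O(\zeta^{\alpha_j})&O(\zeta^{\alpha_j})+O(\zeta^{-\alpha_j})\\ O(\zeta^{\alpha_j})&O(\zeta^{\alpha_j})+O(\zeta^{-\alpha_j})\end{pmatrix}$ if $\alpha_j\neq 0$, and $\Psi_j(\zeta)=\begin{pmatrix}O(1)&O(\ln|\zeta|)\\ O(1)&O(\ln|\zeta|)\end{pmatrix}$ if $\alpha_j=0$, $\beta_j\neq0$; the behavior in the other sectors is the one obtained from these expressions by applying the appropriate jump conditions. Here $O(a)$ stands for $O(|a|)$. The functions $\zeta^{\pm\alpha_j}$, $\psi(a,b,\zeta)$,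 $\psi(a,b,e^{-i\pi}\zeta)$ are defined on the universal covering of $\mathbb{C}\setminus\{0\}$, with branches fixed by $0<\arg\zeta<2\pi$; $\psi(a,c,x)$ is normalized by $\psi(a,c,x)=x^{-a}(1+O(x^{-1}))$ as $|x|\to\infty$, $-3\pi/2<\arg x<3\pi/2$. $1/\Gamma$ is interpreted as an entire function. *)

theory Defs
  imports "HOL-Complex_Analysis.Complex_Analysis" "HOL-Library.Landau_Symbols"
begin

section \<open>The confluent hypergeometric function of the second kind\<close>

text \<open>
  Multivalued functions of \<open>x\<close> are functions on the universal covering of the punctured plane,
  which is parametrised by \<open>w\<close> with \<open>x = exp w\<close>, so that \<open>Re w = ln \<bar>x\<bar>\<close> and \<open>Im w = arg x\<close>.

  If \<open>g w = y (exp w)\<close> then \<open>x y' = g'\<close> and \<open>x\<^sup>2 y'' = g'' - g'\<close>, hence Kummer's equation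
  \<open>x y'' + (c - x) y' - a y = 0\<close>, multiplied by \<open>x\<close>, is the equation below.
\<close>

definition kummer_solution :: "complex \<Rightarrow> complex \<Rightarrow> (complex \<Rightarrow> complex) \<Rightarrow> bool" where
  "kummer_solution a c g \<longleftrightarrow>
     g holomorphic_on UNIV \<and>
     (\<forall>w. deriv (deriv g) w + (c - 1 - exp w) * deriv g w - a * exp w * g w = 0)"

text \<open>
  The normalisation \<open>x\<^sup>a \<psi>(a, c, x) = 1 + O(1 / x)\<close> for \<open>-3\<pi>/2 < arg x < 3\<pi>/2\<close> is understood
  as usual: uniformly in every closed subsector.
\<close>

definition second_kind_normalized :: "complex \<Rightarrow> (complex \<Rightarrow> complex) \<Rightarrow> bool" where
  "second_kind_normalized a g \<longleftrightarrow>
     (\<forall>\<delta>>0. \<exists>C R. \<forall>w. Re w \<ge> R \<and> \<bar>Im w\<bar> \<le> 3 * pi / 2 - \<delta> \<longrightarrow>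
        norm (exp (a * w) * g w - 1) \<le> C / norm (exp w))"

text \<open>\<open>conf_hyp_U a c w\<close> is \<open>\<psi>(a, c, x)\<close> at the point \<open>x = exp w\<close> with argument \<open>Im w\<close>.\<close>

definition conf_hyp_U :: "complex \<Rightarrow> complex \<Rightarrow> complex \<Rightarrow> complex" where
  "conf_hyp_U a c = (THE g. kummer_solution a c g \<and> second_kind_normalized a g)"

section \<open>Contour, sectors and jump matrices\<close>

text \<open>
  The ray with index \<open>k\<close> is at angle \<open>\<theta> k\<close>; the angles increase counterclockwise from \<open>\<pi>/2\<close>, and
  \<open>\<theta> 9\<close> is the first ray again, after a full turn. Thus sector \<open>k\<close> (for \<open>k = 1, \<dots>, 8\<close>, written
  \<open>I, \<dots>, VIII\<close>) lies between the angles \<open>\<theta> k\<close> and \<open>\<theta> (k + 1)\<close>.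
\<close>

definition contour_angles :: "(nat \<Rightarrow> real) \<Rightarrow> bool" where
  "contour_angles \<theta> \<longleftrightarrow>
     \<theta> 1 = pi / 2 \<and> \<theta> 3 = pi \<and> \<theta> 5 = 3 * pi / 2 \<and> \<theta> 7 = 2 * pi \<and> \<theta> 9 = 5 * pi / 2 \<and>
     \<theta> 1 < \<theta> 2 \<and> \<theta> 2 < \<theta> 3 \<and> \<theta> 3 < \<theta> 4 \<and> \<theta> 4 < \<theta> 5 \<and>
     \<theta> 5 < \<theta> 6 \<and> \<theta> 6 < \<theta> 7 \<and> \<theta> 7 < \<theta> 8 \<and> \<theta> 8 < \<theta> 9"

definition ray :: "(nat \<Rightarrow> real) \<Rightarrow> nat \<Rightarrow> complex set" where
  "ray \<theta> k = {rcis r (\<theta> k) | r. r \<ge> 0}"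

definition contour :: "(nat \<Rightarrow> real) \<Rightarrow> complex set" where
  "contour \<theta> = (\<Union>k\<in>{1..8}. ray \<theta> k)"

definition sector :: "(nat \<Rightarrow> real) \<Rightarrow> nat \<Rightarrow> complex set" where
  "sector \<theta> k = {rcis r t | r t. r > 0 \<and> \<theta> k < t \<and> t < \<theta> (k + 1)}"

definition plus_side :: "nat \<Rightarrow> nat" where
  "plus_side k = (if k = 4 then 3 else if k = 5 then 4 else if k = 6 then 5 else k)"

definition minus_side :: "nat \<Rightarrow> nat" where
  "minus_side k = (if k = 1 then 8 else if k \<in> {4, 5, 6} then k else k - 1)"

definition mat2 :: "complex \<Rightarrow> complex \<Rightarrow> complex \<Rightarrow> complex \<Rightarrow> complex^2^2" where
  "mat2 a b c d = vector [vector [a, b], vector [c, d]]"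

definition jump :: "complex \<Rightarrow> complex \<Rightarrow> nat \<Rightarrow> complex^2^2" where
  "jump \<alpha> \<beta> k =
    (let e = (\<lambda>x. exp (\<i> * of_real pi * x)) in
     if k = 1 then mat2 0 (e (- \<beta>)) (- e \<beta>) 0
     else if k = 2 then mat2 1 0 (e (\<beta> - 2 * \<alpha>)) 1
     else if k = 4 then mat2 1 0 (e (- (\<beta> - 2 * \<alpha>))) 1
     else if k = 5 then mat2 0 (e \<beta>) (- e (- \<beta>)) 0
     else if k = 6 then mat2 1 0 (e (- (\<beta> + 2 * \<alpha>))) 1
     else if k = 8 then mat2 1 0 (e (\<beta> + 2 * \<alpha>)) 1
     else mat2 (e \<alpha>) 0 0 (e (- \<alpha>)))"

section \<open>The Riemann-Hilbert problem\<close>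

text \<open>The point over \<open>\<zeta>\<close> on the universal covering, with the branch \<open>0 < arg \<zeta> < 2\<pi>\<close>.\<close>

definition lift :: "complex \<Rightarrow> complex" where
  "lift \<zeta> = Complex (ln (norm \<zeta>)) (Arg2pi \<zeta>)"

definition branch_powr :: "complex \<Rightarrow> complex \<Rightarrow> complex" where
  "branch_powr \<zeta> \<alpha> = exp (\<alpha> * lift \<zeta>)"

definition rhp_analytic :: "(nat \<Rightarrow> real) \<Rightarrow> (complex \<Rightarrow> complex^2^2) \<Rightarrow> bool" where
  "rhp_analytic \<theta> \<Psi> \<longleftrightarrow> (\<forall>i j. (\<lambda>\<zeta>. \<Psi> \<zeta> $ i $ j) analytic_on (- contour \<theta>))"

definition rhp_jumps ::
  "(nat \<Rightarrow> real) \<Rightarrow> complex \<Rightarrow> complex \<Rightarrow> (complex \<Rightarrow> complex^2^2) \<Rightarrow> bool" where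
  "rhp_jumps \<theta> \<alpha> \<beta> \<Psi> \<longleftrightarrow>
     (\<forall>k\<in>{1..8}. \<exists>\<Psi>p \<Psi>m.
        continuous_on (ray \<theta> k - {0}) \<Psi>p \<and> continuous_on (ray \<theta> k - {0}) \<Psi>m \<and>
        (\<forall>s\<in>ray \<theta> k - {0}.
           (\<Psi> \<longlongrightarrow> \<Psi>p s) (at s within sector \<theta> (plus_side k)) \<and>
           (\<Psi> \<longlongrightarrow> \<Psi>m s) (at s within sector \<theta> (minus_side k)) \<and>
           \<Psi>p s = \<Psi>m s ** jump \<alpha> \<beta> k))"

text \<open>
  The behaviour at the origin, for \<open>\<zeta>\<close> in \<open>S\<close>, that is prescribed outside the lenses.
  The second column for \<open>\<alpha> \<noteq> 0\<close> spells out \<open>O(\<zeta>\<^sup>\<alpha>) + O(\<zeta>\<^sup>-\<^sup>\<alpha>)\<close>.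
\<close>

definition outer_behaviour ::
  "complex \<Rightarrow> complex set \<Rightarrow> (complex \<Rightarrow> complex^2^2) \<Rightarrow> bool" where
  "outer_behaviour \<alpha> S \<Psi> \<longleftrightarrow>
     (if \<alpha> \<noteq> 0 then
        (\<forall>i. (\<lambda>\<zeta>. \<Psi> \<zeta> $ i $ 1) \<in> O[at 0 within S](\<lambda>\<zeta>. branch_powr \<zeta> \<alpha>) \<and>
           (\<exists>f \<in> O[at 0 within S](\<lambda>\<zeta>. branch_powr \<zeta> \<alpha>).
            \<exists>g \<in> O[at 0 within S](\<lambda>\<zeta>. branch_powr \<zeta> (- \<alpha>)).
              \<forall>\<zeta>\<in>S. \<Psi> \<zeta> $ i $ 2 = f \<zeta> + g \<zeta>))
      else
        (\<forall>i. (\<lambda>\<zeta>. \<Psi> \<zeta> $ i $ 1) \<in> O[at 0 within S](\<lambda>\<zeta>. 1) \<and>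
             (\<lambda>\<zeta>. \<Psi> \<zeta> $ i $ 2) \<in> O[at 0 within S](\<lambda>\<zeta>. of_real (ln (norm \<zeta>)))))"

text \<open>
  Inside the lenses, the behaviour is the one transported across the lens boundary from the adjacent
  outer sector: \<open>\<Psi>\<^sub>I = \<Psi>\<^sub>I\<^sub>I J\<^sub>2\<^sup>-\<^sup>1\<close>, \<open>\<Psi>\<^sub>I\<^sub>V = \<Psi>\<^sub>I\<^sub>I\<^sub>I J\<^sub>4\<^sup>-\<^sup>1\<close>, \<open>\<Psi>\<^sub>V = \<Psi>\<^sub>V\<^sub>I J\<^sub>6\<close>, \<open>\<Psi>\<^sub>V\<^sub>I\<^sub>I\<^sub>I = \<Psi>\<^sub>V\<^sub>I\<^sub>I J\<^sub>8\<close>, where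
  the outer expression is the one of \<^const>\<open>outer_behaviour\<close>.
\<close>

definition rhp_origin ::
  "(nat \<Rightarrow> real) \<Rightarrow> complex \<Rightarrow> complex \<Rightarrow> (complex \<Rightarrow> complex^2^2) \<Rightarrow> bool" where
  "rhp_origin \<theta> \<alpha> \<beta> \<Psi> \<longleftrightarrow>
     outer_behaviour \<alpha> (\<Union>k\<in>{2, 3, 6, 7}. sector \<theta> k) \<Psi> \<and>
     outer_behaviour \<alpha> (sector \<theta> 1) (\<lambda>\<zeta>. \<Psi> \<zeta> ** jump \<alpha> \<beta> 2) \<and>
     outer_behaviour \<alpha> (sector \<theta> 4) (\<lambda>\<zeta>. \<Psi> \<zeta> ** jump \<alpha> \<beta> 4) \<and>
     outer_behaviour \<alpha> (sector \<theta> 5) (\<lambda>\<zeta>. \<Psi> \<zeta> ** matrix_inv (jump \<alpha> \<beta> 6)) \<and>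
     outer_behaviour \<alpha> (sector \<theta> 8) (\<lambda>\<zeta>. \<Psi> \<zeta> ** matrix_inv (jump \<alpha> \<beta> 8))"

definition rhp_solution ::
  "(nat \<Rightarrow> real) \<Rightarrow> complex \<Rightarrow> complex \<Rightarrow> (complex \<Rightarrow> complex^2^2) \<Rightarrow> bool" where
  "rhp_solution \<theta> \<alpha> \<beta> \<Psi> \<longleftrightarrow>
     rhp_analytic \<theta> \<Psi> \<and> rhp_jumps \<theta> \<alpha> \<beta> \<Psi> \<and> rhp_origin \<theta> \<alpha> \<beta> \<Psi>"

section \<open>The explicit solution\<close>

text \<open>
  On the covering, multiplication of \<open>\<zeta>\<close> by \<open>e\<^sup>-\<^sup>i\<^sup>\<pi>\<close> is the translation by \<open>- i\<pi>\<close>. Quotients by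
  \<open>\<Gamma>(z)\<close> are products with the entire function \<^const>\<open>rGamma\<close>.
\<close>

definition Psi_I :: "complex \<Rightarrow> complex \<Rightarrow> complex \<Rightarrow> complex^2^2" where
  "Psi_I \<alpha> \<beta> \<zeta> =
    (let e = (\<lambda>x. exp (\<i> * of_real pi * x));
         w = lift \<zeta>; w' = lift \<zeta> - \<i> * of_real pi in
     mat2
       (branch_powr \<zeta> \<alpha> * conf_hyp_U (\<alpha> + \<beta>) (1 + 2 * \<alpha>) w * e (2 * \<beta> + \<alpha>) * exp (- \<zeta> / 2))
       (- branch_powr \<zeta> \<alpha> * conf_hyp_U (1 + \<alpha> - \<beta>) (1 + 2 * \<alpha>) w' * e (\<beta> + \<alpha>) * exp (\<zeta> / 2)
          * (Gamma (1 + \<alpha> - \<beta>) * rGamma (\<alpha> + \<beta>)))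
       (- branch_powr \<zeta> (- \<alpha>) * conf_hyp_U (1 - \<alpha> + \<beta>) (1 - 2 * \<alpha>) w * e (\<beta> - 3 * \<alpha>)
          * exp (- \<zeta> / 2) * (Gamma (1 + \<alpha> + \<beta>) * rGamma (\<alpha> - \<beta>)))
       (branch_powr \<zeta> (- \<alpha>) * conf_hyp_U (- \<alpha> - \<beta>) (1 - 2 * \<alpha>) w' * e (- \<alpha>) * exp (\<zeta> / 2)))"

text \<open>
  The formula for sector \<open>I\<close>, which makes sense for all \<open>0 < arg \<zeta> < 2\<pi>\<close>, followed by the jumps met
  on the way from sector \<open>I\<close>: counterclockwise up to sector \<open>VI\<close>, clockwise to \<open>VIII\<close> and \<open>VII\<close>.
  A jump matrix is inverted when its ray is crossed from the \<open>+\<close> to the \<open>-\<close> side. The positive real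
  ray, where \<open>arg \<zeta>\<close> is cut, is never crossed, so that its jump is not built in.
\<close>

definition sector_factor :: "complex \<Rightarrow> complex \<Rightarrow> nat \<Rightarrow> complex^2^2" where
  "sector_factor \<alpha> \<beta> k =
    (let J = jump \<alpha> \<beta>; J' = (\<lambda>l. matrix_inv (jump \<alpha> \<beta> l)) in
     if k = 2 then J 2
     else if k = 3 then J 2 ** J 3
     else if k = 4 then J 2 ** J 3 ** J' 4
     else if k = 5 then J 2 ** J 3 ** J' 4 ** J' 5
     else if k = 6 then J 2 ** J 3 ** J' 4 ** J' 5 ** J' 6
     else if k = 8 then J' 1
     else if k = 7 then J' 1 ** J' 8
     else mat 1)"

text \<open>The value on the contour is immaterial.\<close>

definition Psi :: "(nat \<Rightarrow> real) \<Rightarrow> complex \<Rightarrow> complex \<Rightarrow> complex \<Rightarrow> complex^2^2" where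
  "Psi \<theta> \<alpha> \<beta> \<zeta> =
     Psi_I \<alpha> \<beta> \<zeta> ** sector_factor \<alpha> \<beta> (THE k. k \<in> {1..8} \<and> \<zeta> \<in> sector \<theta> k)"

end

theory Submission
  imports Defs
begin

text \<open>
  In the variable \<open>w = log \<zeta>\<close>, both rows of \<open>\<Psi>\<close> are, up to \<open>\<zeta>\<^sup>\<alpha> e\<^sup>-\<^sup>\<zeta>\<^sup>/\<^sup>2\<close>, pairs of solutions of one
  Kummer equation with \<open>c = 1 + 2\<alpha>\<close>: \<open>U(w) = \<psi>(a, c, x)\<close> and \<open>E(w) = e\<^sup>x \<psi>(c - a, c, e\<^sup>-\<^sup>i\<^sup>\<pi> x)\<close>, with
  \<open>a = \<alpha> + \<beta>\<close> in the first row and \<open>a = \<alpha> + \<beta> + 1\<close> in the second. All jumps but the one on the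
  positive real ray hold by construction. That jump and the first column at the origin both follow
  from the two connection formulas that express the entire function \<open>M(a, c, x) / \<Gamma>(c)\<close> through
  \<open>U(w), E(w)\<close> and through \<open>U(w), E(w + 2\<pi>i)\<close>; the second column at the origin is bounded by
  integrating the Wronskian.

  To cover integral \<open>c\<close> and the poles of \<open>\<Gamma>\<close>, \<open>\<psi>\<close> is constructed and the connection formulas are
  proved from Laplace integrals for large \<open>Re a\<close> and \<open>Re (c - a)\<close>, and carried to all parameters by
  the first-order operators that lower \<open>(a, c)\<close> to \<open>(a - 1, c - 1)\<close> and to \<open>(a, c - 1)\<close>. The
  coefficients in the connection formulas are read off from the limits along the two real half-axes.
\<close>

section \<open>Kummer's equation on the logarithmic covering\<close>

text \<open>The textbook expression of psi through M(a, c, x) and x^(1-c) M(a - c + 1, 2 - c, x)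
  degenerates for integral c, that is when 2 \<alpha> is an integer. The pair \<open>U\<close>,
  \<open>E\<close> stays a basis for all parameters, as one member is algebraic at infinity and the
  other carries e^x; with 1 / Gamma in the coefficients nothing has to be excluded or obtained by a
  limit. The variable w makes every solution entire, turns a change of sheet into a translation by 2
  pi i, and lets a solution known on part of the plane be continued by linear algebra. Two lowering
  operators suffice, since one fixes c - a and the other fixes a; neither requires a division. In
  each outer sector the first column is a multiple of the one combination of \<open>U\<close> and
  \<open>E\<close> that is single-valued in x; the jump on the positive ray compares that
  combination on two sheets. The conditions on \<alpha> + \<beta> and \<alpha> - \<beta> keep two
  Gamma values finite, and Re \<alpha> > -1/2 gives Re c > 0, so that H(0) is nonzero and division
  by H near 0 is possible.\<close>

definition kummer_on :: "complex \<Rightarrow> complex \<Rightarrow> complex set \<Rightarrow> (complex \<Rightarrow> complex) \<Rightarrow> bool" where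
  "kummer_on a c S g \<longleftrightarrow> g holomorphic_on S \<and>
     (\<forall>w\<in>S. deriv (deriv g) w + (c - 1 - exp w) * deriv g w - a * exp w * g w = 0)"

lemma kummer_solution_iff: "kummer_solution a c g \<longleftrightarrow> kummer_on a c UNIV g"
  by (simp add: kummer_solution_def kummer_on_def)

lemma kummer_on_subset: "kummer_on a c S g \<Longrightarrow> T \<subseteq> S \<Longrightarrow> kummer_on a c T g"
  unfolding kummer_on_def using holomorphic_on_subset by blast

lemma kummer_onD:
  assumes "kummer_on a c S g" "open S" "w \<in> S"
  shows "(g has_field_derivative deriv g w) (at w)"
    and "(deriv g has_field_derivative deriv (deriv g) w) (at w)"
    and "deriv (deriv g) w = (exp w + 1 - c) * deriv g w + a * exp w * g w"
proof -
  have h: "g holomorphic_on S" using assms by (simp add: kummer_on_def)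
  show "(g has_field_derivative deriv g w) (at w)"
    using holomorphic_derivI[OF h assms(2,3)] .
  show "(deriv g has_field_derivative deriv (deriv g) w) (at w)"
    using holomorphic_derivI[OF holomorphic_deriv[OF h assms(2)] assms(2,3)] .
  have "deriv (deriv g) w + (c - 1 - exp w) * deriv g w - a * exp w * g w = 0"
    using assms by (auto simp: kummer_on_def)
  then show "deriv (deriv g) w = (exp w + 1 - c) * deriv g w + a * exp w * g w"
    by (simp add: algebra_simps)
qed

lemma kummer_onI:
  assumes "open S"
    and g: "\<And>w. w \<in> S \<Longrightarrow> (g has_field_derivative g' w) (at w)"
    and g': "\<And>w. w \<in> S \<Longrightarrow> (g' has_field_derivative g'' w) (at w)"
    and eq: "\<And>w. w \<in> S \<Longrightarrow> g'' w = (exp w + 1 - c) * g' w + a * exp w * g w"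
  shows "kummer_on a c S g"
proof -
  have 1: "deriv g w = g' w" if "w \<in> S" for w
    using g[OF that] by (rule DERIV_imp_deriv)
  have 2: "deriv (deriv g) w = g'' w" if "w \<in> S" for w
    by (rule DERIV_imp_deriv, rule has_field_derivative_transform_within_open[OF g'[OF that] \<open>open S\<close> that])
       (simp add: 1)
  show ?thesis
    unfolding kummer_on_def using \<open>open S\<close> g
    by (auto simp: holomorphic_on_open 1 2 eq algebra_simps)
qed

lemma kummer_on_lincomb:
  assumes "open S" "kummer_on a c S g" "kummer_on a c S h"
  shows "kummer_on a c S (\<lambda>w. p * g w + q * h w)"
proof (rule kummer_onI[OF \<open>open S\<close>])
  fix w assume w: "w \<in> S"
  note D = kummer_onD[OF assms(2,1) w] kummer_onD[OF assms(3,1) w]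
  show "((\<lambda>w. p * g w + q * h w) has_field_derivative (p * deriv g w + q * deriv h w)) (at w)"
    by (rule derivative_eq_intros D refl)+ simp
  show "((\<lambda>w. p * deriv g w + q * deriv h w) has_field_derivative
      (p * deriv (deriv g) w + q * deriv (deriv h) w)) (at w)"
    by (rule derivative_eq_intros D refl)+ simp
  show "p * deriv (deriv g) w + q * deriv (deriv h) w =
    (exp w + 1 - c) * (p * deriv g w + q * deriv h w) + a * exp w * (p * g w + q * h w)"
    by (simp add: D algebra_simps)
qed

lemma kummer_on_scale:
  assumes "open S" "kummer_on a c S g"
  shows "kummer_on a c S (\<lambda>w. p * g w)"
  using kummer_on_lincomb[OF assms assms(2), of p 0] by simp

lemma kummer_on_cong:
  assumes "open S" "kummer_on a c S g" "\<And>w. w \<in> S \<Longrightarrow> g w = h w"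
  shows "kummer_on a c S h"
proof (rule kummer_onI[OF \<open>open S\<close>])
  fix w assume w: "w \<in> S"
  note D = kummer_onD[OF assms(2,1) w]
  show "(h has_field_derivative deriv g w) (at w)"
    by (rule has_field_derivative_transform_within_open[OF D(1) assms(1) w assms(3)])
  show "(deriv g has_field_derivative deriv (deriv g) w) (at w)" by (rule D)
  show "deriv (deriv g) w = (exp w + 1 - c) * deriv g w + a * exp w * h w"
    using D assms(3)[OF w] by simp
qed

text \<open>In the variable x the new function y satisfies y' = - a g, so this inverts the relation
  psi'(a, c) = - a psi(a + 1, c + 1). No division by a occurs, hence a = 0 is covered.\<close>

lemma kummer_on_lower_a_c:
  assumes "open S" "kummer_on (a + 1) (c + 1) S g"
  shows "kummer_on a c S (\<lambda>w. (exp w - c) * g w - deriv g w)"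
proof -
  have 1: "((\<lambda>w. (exp w - c) * g w - deriv g w) has_field_derivative (- a * exp w * g w)) (at w)"
    if w: "w \<in> S" for w
  proof -
    note D = kummer_onD[OF assms(2,1) w]
    show ?thesis
      by (rule derivative_eq_intros D refl)+ (simp add: D algebra_simps)
  qed
  show "kummer_on a c S (\<lambda>w. (exp w - c) * g w - deriv g w)"
  proof (rule kummer_onI[OF \<open>open S\<close> 1])
    fix w assume w: "w \<in> S"
    note D = kummer_onD[OF assms(2,1) w]
    show "((\<lambda>w. - a * exp w * g w) has_field_derivative - a * exp w * (g w + deriv g w)) (at w)"
      by (rule derivative_eq_intros D refl)+ (simp add: algebra_simps)
    show "- a * exp w * (g w + deriv g w) = (exp w + 1 - c) * (- a * exp w * g w) +
         a * exp w * ((exp w - c) * g w - deriv g w)"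
      by (simp add: algebra_simps)
  qed
qed

text \<open>This is the operator x d/dx + c. It multiplies x^m by m + c and so cancels the last
  factor of the denominator in the series of M(a, c + 1, x).\<close>

lemma kummer_on_lower_c:
  assumes "open S" "kummer_on a (c + 1) S g"
  shows "kummer_on a c S (\<lambda>w. c * g w + deriv g w)"
proof (rule kummer_onI[OF \<open>open S\<close>])
  fix w assume w: "w \<in> S"
  note D = kummer_onD[OF assms(2,1) w]
  show "((\<lambda>w. c * g w + deriv g w) has_field_derivative (exp w * (deriv g w + a * g w))) (at w)"
    by (rule derivative_eq_intros D refl)+ (simp add: D algebra_simps)
  show "((\<lambda>w. exp w * (deriv g w + a * g w)) has_field_derivative
      (exp w * (deriv g w + a * g w + deriv (deriv g) w + a * deriv g w))) (at w)"
    by (rule derivative_eq_intros D refl)+ (simp add: algebra_simps)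
  show "exp w * (deriv g w + a * g w + deriv (deriv g) w + a * deriv g w) =
      (exp w + 1 - c) * (exp w * (deriv g w + a * g w)) + a * exp w * (c * g w + deriv g w)"
    by (simp add: D algebra_simps)
qed

section \<open>Wronskians and the two-dimensional solution space\<close>

definition wronskian :: "(complex \<Rightarrow> complex) \<Rightarrow> (complex \<Rightarrow> complex) \<Rightarrow> complex \<Rightarrow> complex" where
  "wronskian g h w = g w * deriv h w - deriv g w * h w"

text \<open>Abel's formula: the Wronskian satisfies W' = (e^w + 1 - c) W, and the exponential solves
  this first-order equation.\<close>

lemma kummer_wronskian:
  assumes "open S" "connected S" "kummer_on a c S g" "kummer_on a c S h"
  obtains C where "\<And>w. w \<in> S \<Longrightarrow> wronskian g h w = C * exp (exp w - (c - 1) * w)"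
proof -
  define F where "F = (\<lambda>w. wronskian g h w * exp (- (exp w - (c - 1) * w)))"
  have "(F has_field_derivative 0) (at w)" if w: "w \<in> S" for w
  proof -
    note D = kummer_onD[OF assms(3,1) w] kummer_onD[OF assms(4,1) w]
    show ?thesis unfolding F_def wronskian_def
      by (rule derivative_eq_intros D refl)+ (simp add: D algebra_simps)
  qed
  then obtain C where C: "\<And>w. w \<in> S \<Longrightarrow> F w = C"
    using DERIV_zero_connected_constant[OF assms(2,1) finite.emptyI, of F]
    by (metis (no_types, lifting) DERIV_isCont Diff_iff assms(1) continuous_on_eq_continuous_at)
  show ?thesis
  proof (rule that)
    fix w assume "w \<in> S"
    have "wronskian g h w = F w * exp (exp w - (c - 1) * w)"
      unfolding F_def by (simp add: mult.assoc flip: exp_add)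
    with C[OF \<open>w \<in> S\<close>] show "wronskian g h w = C * exp (exp w - (c - 1) * w)" by simp
  qed
qed

text \<open>The three Wronskians W satisfy k W(g, h) + g W(h, k) + h W(k, g) = 0. All of them are
  constant multiples of the same zero-free exponential, so dividing by it leaves a linear relation
  with constant coefficients.\<close>

lemma kummer_span:
  assumes "open S" "connected S" "kummer_on a c S g" "kummer_on a c S h" "kummer_on a c S k"
    and "w0 \<in> S" "wronskian g h w0 \<noteq> 0"
  obtains p q where "\<And>w. w \<in> S \<Longrightarrow> k w = p * g w + q * h w"
proof -
  obtain C1 where C1: "\<And>w. w \<in> S \<Longrightarrow> wronskian g h w = C1 * exp (exp w - (c - 1) * w)"
    using kummer_wronskian[OF assms(1,2,3,4)] by blast
  obtain C2 where C2: "\<And>w. w \<in> S \<Longrightarrow> wronskian h k w = C2 * exp (exp w - (c - 1) * w)"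
    using kummer_wronskian[OF assms(1,2,4,5)] by blast
  obtain C3 where C3: "\<And>w. w \<in> S \<Longrightarrow> wronskian k g w = C3 * exp (exp w - (c - 1) * w)"
    using kummer_wronskian[OF assms(1,2,5,3)] by blast
  have "C1 \<noteq> 0" using C1[OF assms(6)] assms(7) by auto
  show ?thesis
  proof (rule that)
    fix w assume w: "w \<in> S"
    have "k w * wronskian g h w + g w * wronskian h k w + h w * wronskian k g w = 0"
      by (simp add: wronskian_def algebra_simps)
    then have "(k w * C1 + g w * C2 + h w * C3) * exp (exp w - (c - 1) * w) = 0"
      unfolding C1[OF w] C2[OF w] C3[OF w] by (simp add: algebra_simps)
    then have "k w * C1 + g w * C2 + h w * C3 = 0" by simp
    then have "k w * C1 = - (g w * C2 + h w * C3)"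
      by (simp only: eq_neg_iff_add_eq_0 add.assoc)
    then show "k w = (- C2 / C1) * g w + (- C3 / C1) * h w"
      using \<open>C1 \<noteq> 0\<close> by (simp add: field_simps)
  qed
qed

section \<open>Entire solutions by power series\<close>

fun ode_coeff :: "(nat \<Rightarrow> complex) \<Rightarrow> (nat \<Rightarrow> complex) \<Rightarrow> complex \<Rightarrow> complex \<Rightarrow> nat \<Rightarrow> complex" where
  "ode_coeff p q y0 y1 0 = y0"
| "ode_coeff p q y0 y1 (Suc 0) = y1"
| "ode_coeff p q y0 y1 (Suc (Suc n)) =
     (\<Sum>k\<le>n. p k * of_nat (Suc (n - k)) * ode_coeff p q y0 y1 (Suc (n - k))
          + q k * ode_coeff p q y0 y1 (n - k)) / (of_nat (Suc n) * of_nat (Suc (Suc n)))"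

text \<open>In the recursion the weight of the first-derivative term cancels one of the two factors
  in the denominator; the other factor exceeds \<open>R * A + R\<^sup>2 * B\<close> from some index
  \<open>N\<close> on. From there the scaled coefficients cannot rise above \<open>K\<close>, the
  sum of the initial ones.\<close>

lemma ode_coeff_bound:
  assumes "R > 0" and p: "summable (\<lambda>k. norm (p k) * R ^ k)" and q: "summable (\<lambda>k. norm (q k) * R ^ k)"
  shows "\<exists>K. \<forall>n. norm (ode_coeff p q y0 y1 n) * R ^ n \<le> K"
proof -
  define A where "A = (\<Sum>k. norm (p k) * R ^ k)"
  define B where "B = (\<Sum>k. norm (q k) * R ^ k)"
  define g where "g = ode_coeff p q y0 y1"
  have A: "(\<Sum>k\<le>n. norm (p k) * R ^ k) \<le> A" for n
    unfolding A_def using \<open>R > 0\<close> by (intro sum_le_suminf p) auto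
  have B: "(\<Sum>k\<le>n. norm (q k) * R ^ k) \<le> B" for n
    unfolding B_def using \<open>R > 0\<close> by (intro sum_le_suminf q) auto
  obtain N :: nat where N: "R * A + R\<^sup>2 * B \<le> real N"
    using real_arch_simple by blast
  define K where "K = (\<Sum>m\<le>Suc N. norm (g m) * R ^ m)"
  have "K \<ge> 0" unfolding K_def using \<open>R > 0\<close> by (intro sum_nonneg) auto
  have A0: "A \<ge> 0" "B \<ge> 0"
    using A[of 0] B[of 0] by (auto intro: order_trans[OF norm_ge_zero])
  have "norm (g n) * R ^ n \<le> K" for n
  proof (induction n rule: less_induct)
    case (less n)
    show ?case
    proof (cases "n \<le> Suc N")
      case True
      then show ?thesis unfolding K_def using \<open>R > 0\<close>
        by (intro member_le_sum[where f = "\<lambda>m. norm (g m) * R ^ m"]) auto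
    next
      case False
      then obtain m where m: "n = Suc (Suc m)" "N \<le> m"
        by (metis Suc_le_D less_eq_Suc_le not_less_eq_eq nat_le_linear)
      have "norm (\<Sum>k\<le>m. p k * of_nat (Suc (m - k)) * g (Suc (m - k)) + q k * g (m - k)) * R ^ n
          \<le> (\<Sum>k\<le>m. norm (p k) * real (Suc m) * norm (g (Suc (m - k))) + norm (q k) * norm (g (m - k))) * R ^ n"
        using \<open>R > 0\<close>
        by (intro mult_right_mono order_trans[OF norm_sum] sum_mono order_trans[OF norm_triangle_ineq] add_mono)
           (auto simp: norm_mult simp del: of_nat_Suc intro!: mult_mono mult_nonneg_nonneg)
      also have "\<dots> = (\<Sum>k\<le>m. (norm (p k) * R ^ k) * (R * real (Suc m)) * (norm (g (Suc (m - k))) * R ^ (Suc (m - k)))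
           + (norm (q k) * R ^ k) * R\<^sup>2 * (norm (g (m - k)) * R ^ (m - k)))"
        unfolding sum_distrib_right
      proof (intro sum.cong refl)
        fix k assume "k \<in> {..m}"
        then have "n = k + 1 + Suc (m - k)" "n = k + 2 + (m - k)"
          by (auto simp: m)
        then have R: "R ^ n = R ^ k * R * R ^ Suc (m - k)" "R ^ n = R ^ k * R\<^sup>2 * R ^ (m - k)"
          by (metis power_add power_one_right)+
        have "norm (p k) * real (Suc m) * norm (g (Suc (m - k))) * R ^ n =
            (norm (p k) * R ^ k) * (R * real (Suc m)) * (norm (g (Suc (m - k))) * R ^ (Suc (m - k)))"
          unfolding R(1) by (simp only: mult_ac)
        moreover have "norm (q k) * norm (g (m - k)) * R ^ n =
            (norm (q k) * R ^ k) * R\<^sup>2 * (norm (g (m - k)) * R ^ (m - k))"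
          unfolding R(2) by (simp only: mult_ac)
        ultimately show "(norm (p k) * real (Suc m) * norm (g (Suc (m - k))) + norm (q k) * norm (g (m - k))) * R ^ n =
            (norm (p k) * R ^ k) * (R * real (Suc m)) * (norm (g (Suc (m - k))) * R ^ (Suc (m - k)))
           + (norm (q k) * R ^ k) * R\<^sup>2 * (norm (g (m - k)) * R ^ (m - k))"
          by (simp only: distrib_right)
      qed
      also have "\<dots> \<le> (\<Sum>k\<le>m. (norm (p k) * R ^ k) * (R * real (Suc m)) * K
           + (norm (q k) * R ^ k) * R\<^sup>2 * K)"
        using \<open>R > 0\<close> by (intro sum_mono add_mono mult_left_mono less) (auto simp: m)
      also have "\<dots> = (\<Sum>k\<le>m. norm (p k) * R ^ k) * (R * real (Suc m) * K) + (\<Sum>k\<le>m. norm (q k) * R ^ k) * (R\<^sup>2 * K)"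
        by (simp add: sum.distrib sum_distrib_right mult.assoc)
      also have "\<dots> \<le> A * (R * real (Suc m) * K) + B * (R\<^sup>2 * K)"
        using \<open>R > 0\<close> \<open>K \<ge> 0\<close> by (intro add_mono mult_right_mono A B) auto
      also have "\<dots> \<le> A * (R * real (Suc m) * K) + B * (R\<^sup>2 * K) * real (Suc m)"
        using A0 \<open>K \<ge> 0\<close> by (intro add_left_mono) (simp add: mult_le_cancel_left1 algebra_simps)
      also have "\<dots> = (R * A + R\<^sup>2 * B) * (real (Suc m) * K)"
        by (simp add: algebra_simps)
      also have "\<dots> \<le> real (Suc (Suc m)) * (real (Suc m) * K)"
        using N m(2) \<open>K \<ge> 0\<close> by (intro mult_right_mono) auto
      finally have *: "norm (\<Sum>k\<le>m. p k * of_nat (Suc (m - k)) * g (Suc (m - k)) + q k * g (m - k)) * R ^ n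
          \<le> real (Suc (Suc m)) * (real (Suc m) * K)" .
      have "norm (g n) = norm (\<Sum>k\<le>m. p k * of_nat (Suc (m - k)) * g (Suc (m - k)) + q k * g (m - k))
          / (real (Suc m) * real (Suc (Suc m)))"
        by (simp add: g_def m norm_divide norm_mult del: of_nat_Suc)
      then have "norm (g n) * R ^ n = norm (\<Sum>k\<le>m. p k * of_nat (Suc (m - k)) * g (Suc (m - k)) + q k * g (m - k)) * R ^ n
          / (real (Suc m) * real (Suc (Suc m)))"
        by simp
      also have "\<dots> \<le> real (Suc (Suc m)) * (real (Suc m) * K) / (real (Suc m) * real (Suc (Suc m)))"
        by (intro divide_right_mono *) simp
      also have "\<dots> = K" by simp
      finally show ?thesis .
    qed
  qed
  then show ?thesis unfolding g_def by blast
qed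

text \<open>Boundedness of the scaled coefficients at radius 2 r gives geometric convergence at
  radius r, and r is arbitrary because P and Q are entire.\<close>

lemma fps_linear_ode_entire:
  fixes P Q :: "complex fps"
  assumes P: "fps_conv_radius P = \<infinity>" and Q: "fps_conv_radius Q = \<infinity>"
  obtains G where "fps_conv_radius G = \<infinity>" "fps_nth G 0 = y0" "fps_nth G 1 = y1"
    "fps_deriv (fps_deriv G) = P * fps_deriv G + Q * G"
proof -
  define g where "g = ode_coeff (fps_nth P) (fps_nth Q) y0 y1"
  define G where "G = Abs_fps g"
  have "conv_radius g \<ge> \<infinity>"
  proof (rule conv_radius_geI_ex)
    fix r :: real assume r: "0 < r"
    have "summable (\<lambda>k. norm (fps_nth P k) * (2 * r) ^ k)"
      using norm_summable_fps[of "of_real (2 * r)" P] r P by (simp add: norm_mult norm_power)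
    moreover have "summable (\<lambda>k. norm (fps_nth Q k) * (2 * r) ^ k)"
      using norm_summable_fps[of "of_real (2 * r)" Q] r Q by (simp add: norm_mult norm_power)
    ultimately obtain K where K: "\<And>n. norm (g n) * (2 * r) ^ n \<le> K"
      using ode_coeff_bound[of "2 * r" "fps_nth P" "fps_nth Q" y0 y1] r unfolding g_def by auto
    have "summable (\<lambda>n. g n * complex_of_real r ^ n)"
    proof (rule summable_comparison_test')
      show "summable (\<lambda>n. K * (1 / 2) ^ n)" by (intro summable_mult summable_geometric) auto
      show "norm (g n * complex_of_real r ^ n) \<le> K * (1 / 2) ^ n" for n
        using K[of n] r by (simp add: norm_mult norm_power power_mult_distrib field_simps)
    qed
    then show "\<exists>z. norm z = r \<and> summable (\<lambda>n. g n * z ^ n)"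
      using r by (intro exI[of _ "complex_of_real r"]) auto
  qed
  then have 1: "fps_conv_radius G = \<infinity>"
    by (simp add: G_def fps_conv_radius_def)
  have "fps_deriv (fps_deriv G) = P * fps_deriv G + Q * G"
  proof (rule fps_ext)
    fix n
    have "fps_nth (fps_deriv (fps_deriv G)) n = of_nat (Suc n) * of_nat (Suc (Suc n)) * g (Suc (Suc n))"
      by (simp add: G_def mult.assoc)
    also have "\<dots> = (\<Sum>k\<le>n. fps_nth P k * of_nat (Suc (n - k)) * g (Suc (n - k)) + fps_nth Q k * g (n - k))"
      by (simp add: g_def del: of_nat_Suc)
    also have "\<dots> = fps_nth (P * fps_deriv G + Q * G) n"
      by (simp add: G_def fps_mult_nth sum.distrib atLeast0AtMost mult.assoc)
    finally show "fps_nth (fps_deriv (fps_deriv G)) n = fps_nth (P * fps_deriv G + Q * G) n" .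
  qed
  then show ?thesis
    using that[of G] 1 by (simp add: G_def g_def)
qed

lemma kummer_initial_value:
  obtains g where "kummer_solution a c g" "g 0 = y0" "deriv g 0 = y1"
proof -
  define P where "P = fps_exp 1 + fps_const (1 - c)"
  define Q where "Q = fps_const a * fps_exp (1::complex)"
  have P: "fps_conv_radius P = \<infinity>"
    using fps_conv_radius_add[of "fps_exp 1" "fps_const (1 - c)"] by (simp add: P_def)
  have Q: "fps_conv_radius Q = \<infinity>"
    using fps_conv_radius_mult[of "fps_const a" "fps_exp 1"] by (simp add: Q_def)
  obtain G where G: "fps_conv_radius G = \<infinity>" "fps_nth G 0 = y0" "fps_nth G 1 = y1"
    "fps_deriv (fps_deriv G) = P * fps_deriv G + Q * G"
    using fps_linear_ode_entire[OF P Q] .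
  have G1: "fps_conv_radius (fps_deriv G) = \<infinity>"
    using fps_conv_radius_deriv[of G] G(1) by simp
  have d: "(eval_fps G has_field_derivative eval_fps (fps_deriv G) w) (at w)" for w
    by (rule has_field_derivative_eval_fps) (simp add: G(1))
  have d2: "(eval_fps (fps_deriv G) has_field_derivative eval_fps (fps_deriv (fps_deriv G)) w) (at w)" for w
    by (rule has_field_derivative_eval_fps) (simp add: G1)
  have "kummer_on a c UNIV (eval_fps G)"
  proof (rule kummer_onI[OF open_UNIV d d2])
    fix w
    have "eval_fps (P * fps_deriv G + Q * G) w = eval_fps P w * eval_fps (fps_deriv G) w + eval_fps Q w * eval_fps G w"
    proof -
      have "fps_conv_radius (P * fps_deriv G) = \<infinity>" "fps_conv_radius (Q * G) = \<infinity>"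
        using fps_conv_radius_mult[of P "fps_deriv G"] fps_conv_radius_mult[of Q G] P Q G(1) G1 by auto
      then show ?thesis using P Q G(1) G1 by (simp add: eval_fps_add eval_fps_mult)
    qed
    moreover have "eval_fps P w = exp w + 1 - c" "eval_fps Q w = a * exp w"
      by (simp_all add: P_def Q_def eval_fps_add eval_fps_mult)
    ultimately show "eval_fps (fps_deriv (fps_deriv G)) w =
      (exp w + 1 - c) * eval_fps (fps_deriv G) w + a * exp w * eval_fps G w"
      by (simp add: G(4))
  qed
  moreover have "deriv (eval_fps G) 0 = y1"
    using DERIV_imp_deriv[OF d[of 0]] G(3) by (simp add: eval_fps_at_0)
  ultimately show ?thesis
    using that[of "eval_fps G"] G(2) by (simp add: kummer_solution_iff eval_fps_at_0)
qed

text \<open>The solutions with initial data (1, 0) and (0, 1) at the point 0 are entire and span the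
  solutions on S, so a solution given only on S extends through its two coefficients. This continues
  Laplace integrals beyond their half plane of convergence.\<close>

lemma kummer_extend:
  assumes "open S" "connected S" "kummer_on a c S g"
  obtains h where "kummer_solution a c h" "\<And>w. w \<in> S \<Longrightarrow> h w = g w"
proof (cases "S = {}")
  case True
  then show ?thesis using kummer_initial_value[of a c] that by (metis empty_iff)
next
  case False
  then obtain w0 where w0: "w0 \<in> S" by blast
  obtain g1 where g1: "kummer_solution a c g1" "g1 0 = 1" "deriv g1 0 = 0"
    using kummer_initial_value .
  obtain g2 where g2: "kummer_solution a c g2" "g2 0 = 0" "deriv g2 0 = 1"
    using kummer_initial_value .
  obtain C where C: "\<And>w. wronskian g1 g2 w = C * exp (exp w - (c - 1) * w)"
    using kummer_wronskian[of UNIV a c g1 g2] g1(1) g2(1) by (auto simp: kummer_solution_iff)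
  have "C \<noteq> 0" using C[of 0] g1 g2 by (auto simp: wronskian_def)
  then have "wronskian g1 g2 w0 \<noteq> 0" using C by simp
  moreover have k: "kummer_on a c S g1" "kummer_on a c S g2"
    using g1(1) g2(1) kummer_on_subset[of a c UNIV] by (auto simp: kummer_solution_iff)
  ultimately obtain p q where "\<And>w. w \<in> S \<Longrightarrow> g w = p * g1 w + q * g2 w"
    using kummer_span[OF assms(1,2) k assms(3) w0] by blast
  moreover have "kummer_solution a c (\<lambda>w. p * g1 w + q * g2 w)"
    using kummer_on_lincomb[OF open_UNIV] g1(1) g2(1) by (auto simp: kummer_solution_iff)
  ultimately show ?thesis
    by (intro that[of "\<lambda>w. p * g1 w + q * g2 w"]) auto
qed

section \<open>Algebraic asymptotics and uniqueness\<close>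

text \<open>The leading coefficient is general, and may be 0, because lowering c multiplies it by c
  - a.\<close>

definition kummer_asymp :: "complex \<Rightarrow> complex \<Rightarrow> (complex \<Rightarrow> complex) \<Rightarrow> bool" where
  "kummer_asymp a \<kappa> g \<longleftrightarrow>
     (\<forall>\<delta>>0. \<exists>C R. \<forall>w. Re w \<ge> R \<and> \<bar>Im w\<bar> \<le> 3 * pi / 2 - \<delta> \<longrightarrow>
        norm (exp (a * w) * g w - \<kappa>) \<le> C / norm (exp w))"

lemma second_kind_normalized_iff: "second_kind_normalized a g \<longleftrightarrow> kummer_asymp a 1 g"
  by (simp add: second_kind_normalized_def kummer_asymp_def)

lemma exp_minus_inverse_norm: "C / norm (exp w) = C * exp (- Re w)"
  by (simp only: norm_exp_eq_Re exp_minus divide_inverse)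

lemma kummer_asympE:
  assumes "kummer_asymp a \<kappa> g" "\<delta> > 0"
  obtains C R where "C \<ge> 0" "\<And>w. Re w \<ge> R \<Longrightarrow> \<bar>Im w\<bar> \<le> 3 * pi / 2 - \<delta> \<Longrightarrow>
        norm (exp (a * w) * g w - \<kappa>) \<le> C * exp (- Re w)"
proof -
  obtain C R where "\<forall>w. Re w \<ge> R \<and> \<bar>Im w\<bar> \<le> 3 * pi / 2 - \<delta> \<longrightarrow>
        norm (exp (a * w) * g w - \<kappa>) \<le> C / norm (exp w)"
    using assms unfolding kummer_asymp_def by blast
  then have *: "norm (exp (a * w) * g w - \<kappa>) \<le> C * exp (- Re w)"
    if "Re w \<ge> R" "\<bar>Im w\<bar> \<le> 3 * pi / 2 - \<delta>" for w
    using that unfolding exp_minus_inverse_norm by blast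
  show ?thesis
  proof (rule that[of "max C 0" R])
    fix w assume "Re w \<ge> R" "\<bar>Im w\<bar> \<le> 3 * pi / 2 - \<delta>"
    then have "norm (exp (a * w) * g w - \<kappa>) \<le> C * exp (- Re w)" by (rule *)
    also have "\<dots> \<le> max C 0 * exp (- Re w)" by (intro mult_right_mono) auto
    finally show "norm (exp (a * w) * g w - \<kappa>) \<le> max C 0 * exp (- Re w)" .
  qed auto
qed

lemma kummer_asympI:
  assumes "\<And>\<delta>. \<delta> > 0 \<Longrightarrow> \<exists>C R. \<forall>w. Re w \<ge> R \<longrightarrow> \<bar>Im w\<bar> \<le> 3 * pi / 2 - \<delta> \<longrightarrow>
        norm (exp (a * w) * g w - \<kappa>) \<le> C * exp (- Re w)"
  shows "kummer_asymp a \<kappa> g"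
  using assms unfolding kummer_asymp_def exp_minus_inverse_norm imp_conjL by blast

text \<open>Cauchy's inequality on discs of radius r, at the price of a narrower strip. With n =
  e^(a w) g - \<kappa> one has n' = e^(a w) g' + a \<kappa> + a n, so the error of the derivative is
  n' - a n.\<close>

lemma strip_asymp_deriv:
  assumes g: "g holomorphic_on UNIV" and "r > 0" "C \<ge> 0"
    and C: "\<And>w. Re w \<ge> R \<Longrightarrow> \<bar>Im w - y\<bar> \<le> \<rho> + r \<Longrightarrow>
        norm (exp (a * w) * g w - \<kappa>) \<le> C * exp (- Re w)"
  obtains C' where "C' \<ge> C" "\<And>w. Re w \<ge> R + r \<Longrightarrow> \<bar>Im w - y\<bar> \<le> \<rho> \<Longrightarrow>
        norm (exp (a * w) * deriv g w + a * \<kappa>) \<le> C' * exp (- Re w)"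
proof -
  define n where "n = (\<lambda>w. exp (a * w) * g w - \<kappa>)"
  have dg: "(g has_field_derivative deriv g w) (at w)" for w
    using holomorphic_derivI[OF g open_UNIV] by simp
  have hn: "n holomorphic_on A" for A
    unfolding n_def by (intro holomorphic_intros holomorphic_on_subset[OF g]) auto
  have dn: "deriv n w = exp (a * w) * deriv g w + a * \<kappa> + a * n w" for w
    unfolding n_def by (rule DERIV_imp_deriv) (rule derivative_eq_intros dg refl | simp add: algebra_simps)+
  have bound: "norm (exp (a * w) * deriv g w + a * \<kappa>) \<le> (C * exp r / r + norm a * C) * exp (- Re w)"
    if w: "Re w \<ge> R + r" "\<bar>Im w - y\<bar> \<le> \<rho>" for w
  proof -
    have "norm ((deriv ^^ 1) n w) \<le> fact 1 * (C * exp (r - Re w)) / r ^ 1"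
    proof (rule Cauchy_inequality[OF hn holomorphic_on_imp_continuous_on[OF hn] \<open>r > 0\<close>])
      fix z assume z: "norm (w - z) = r"
      then have z': "\<bar>Re w - Re z\<bar> \<le> r" "\<bar>Im w - Im z\<bar> \<le> r"
        using abs_Re_le_cmod[of "w - z"] abs_Im_le_cmod[of "w - z"] by auto
      then have "norm (n z) \<le> C * exp (- Re z)"
        unfolding n_def using w by (intro C) (unfold abs_le_iff, linarith+)
      also have "\<dots> \<le> C * exp (r - Re w)"
        using z' \<open>C \<ge> 0\<close> by (intro mult_left_mono) auto
      finally show "norm (n z) \<le> C * exp (r - Re w)" .
    qed
    then have 1: "norm (deriv n w) \<le> C * exp r / r * exp (- Re w)"
      by (simp add: exp_diff exp_minus divide_inverse mult_ac)
    have 2: "norm (n w) \<le> C * exp (- Re w)"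
      unfolding n_def using w \<open>r > 0\<close> by (intro C) auto
    have "exp (a * w) * deriv g w + a * \<kappa> = deriv n w - a * n w" by (simp add: dn)
    also have "norm \<dots> \<le> norm (deriv n w) + norm a * norm (n w)"
      by (metis norm_triangle_ineq4 norm_mult)
    also have "\<dots> \<le> C * exp r / r * exp (- Re w) + norm a * (C * exp (- Re w))"
      using 1 2 by (intro add_mono mult_left_mono) auto
    finally show ?thesis by (simp add: algebra_simps)
  qed
  show ?thesis
  proof (rule that[of "C + (C * exp r / r + norm a * C)"])
    show "C + (C * exp r / r + norm a * C) \<ge> C" using \<open>C \<ge> 0\<close> \<open>r > 0\<close> by simp
    fix w assume w: "Re w \<ge> R + r" "\<bar>Im w - y\<bar> \<le> \<rho>"
    note bound[OF this]
    also have "(C * exp r / r + norm a * C) * exp (- Re w) \<le> (C + (C * exp r / r + norm a * C)) * exp (- Re w)"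
      using \<open>C \<ge> 0\<close> by (intro mult_right_mono) auto
    finally show "norm (exp (a * w) * deriv g w + a * \<kappa>) \<le> (C + (C * exp r / r + norm a * C)) * exp (- Re w)" .
  qed
qed

text \<open>Half of the angular margin \<delta> is spent on the discs of Cauchy's
  inequality.\<close>

lemma kummer_asymp_deriv:
  assumes g: "g holomorphic_on UNIV" and "kummer_asymp a \<kappa> g" "\<delta> > 0"
  obtains C R where "C \<ge> 0" "\<And>w. Re w \<ge> R \<Longrightarrow> \<bar>Im w\<bar> \<le> 3 * pi / 2 - \<delta> \<Longrightarrow>
        norm (exp (a * w) * g w - \<kappa>) \<le> C * exp (- Re w)"
    "\<And>w. Re w \<ge> R \<Longrightarrow> \<bar>Im w\<bar> \<le> 3 * pi / 2 - \<delta> \<Longrightarrow>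
        norm (exp (a * w) * deriv g w + a * \<kappa>) \<le> C * exp (- Re w)"
proof -
  have r: "\<delta> / 2 > 0" using \<open>\<delta> > 0\<close> by simp
  obtain C R where C: "C \<ge> 0" "\<And>w. Re w \<ge> R \<Longrightarrow> \<bar>Im w\<bar> \<le> 3 * pi / 2 - \<delta> / 2 \<Longrightarrow>
        norm (exp (a * w) * g w - \<kappa>) \<le> C * exp (- Re w)"
    using kummer_asympE[OF assms(2) r] by blast
  obtain C' where C': "C' \<ge> C" "\<And>w. Re w \<ge> R + \<delta> / 2 \<Longrightarrow> \<bar>Im w - 0\<bar> \<le> 3 * pi / 2 - \<delta> \<Longrightarrow>
        norm (exp (a * w) * deriv g w + a * \<kappa>) \<le> C' * exp (- Re w)"
    by (rule strip_asymp_deriv[OF g r C(1), of R 0 "3 * pi / 2 - \<delta>"]) (use C(2) in auto)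
  show ?thesis
  proof (rule that[of C' "R + \<delta> / 2"])
    show "C' \<ge> 0" using C C' by linarith
  next
    fix w assume w: "Re w \<ge> R + \<delta> / 2" "\<bar>Im w\<bar> \<le> 3 * pi / 2 - \<delta>"
    have "norm (exp (a * w) * g w - \<kappa>) \<le> C * exp (- Re w)"
      using w \<open>\<delta> > 0\<close> by (intro C(2)) auto
    also have "\<dots> \<le> C' * exp (- Re w)"
      using C'(1) by (intro mult_right_mono) auto
    finally show "norm (exp (a * w) * g w - \<kappa>) \<le> C' * exp (- Re w)" .
  next
    fix w assume w: "Re w \<ge> R + \<delta> / 2" "\<bar>Im w\<bar> \<le> 3 * pi / 2 - \<delta>"
    then show "norm (exp (a * w) * deriv g w + a * \<kappa>) \<le> C' * exp (- Re w)"
      by (intro C'(2)) auto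
  qed
qed

text \<open>Only the term e^w g contributes to leading order: the factor e^w turns the exponent a +
  1 into a, and all other terms are smaller by a factor e^(-w).\<close>

lemma kummer_asymp_lower_a_c:
  assumes g: "g holomorphic_on UNIV" and "kummer_asymp (a + 1) \<kappa> g"
  shows "kummer_asymp a \<kappa> (\<lambda>w. (exp w - c) * g w - deriv g w)"
proof (rule kummer_asympI)
  fix \<delta> :: real assume "\<delta> > 0"
  obtain C R where C: "C \<ge> 0" "\<And>w. Re w \<ge> R \<Longrightarrow> \<bar>Im w\<bar> \<le> 3 * pi / 2 - \<delta> \<Longrightarrow>
        norm (exp ((a + 1) * w) * g w - \<kappa>) \<le> C * exp (- Re w)"
    "\<And>w. Re w \<ge> R \<Longrightarrow> \<bar>Im w\<bar> \<le> 3 * pi / 2 - \<delta> \<Longrightarrow>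
        norm (exp ((a + 1) * w) * deriv g w + (a + 1) * \<kappa>) \<le> C * exp (- Re w)"
    using kummer_asymp_deriv[OF assms \<open>\<delta> > 0\<close>] by blast
  define D where "D = C + (norm c * C + C + norm ((c - (a + 1)) * \<kappa>))"
  have "norm (exp (a * w) * ((exp w - c) * g w - deriv g w) - \<kappa>) \<le> D * exp (- Re w)"
    if w: "Re w \<ge> max R 0" "\<bar>Im w\<bar> \<le> 3 * pi / 2 - \<delta>" for w
  proof -
    define n where "n = exp ((a + 1) * w) * g w - \<kappa>"
    define m where "m = exp ((a + 1) * w) * deriv g w + (a + 1) * \<kappa>"
    have n: "norm n \<le> C * exp (- Re w)" and m: "norm m \<le> C * exp (- Re w)"
      using C w by (auto simp: n_def m_def)
    have "C * exp (- Re w) \<le> C * 1" using w C(1) by (intro mult_left_mono) auto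
    then have n': "norm n \<le> C" and m': "norm m \<le> C" using n m by auto
    have e: "exp (a * w) = exp (- w) * exp ((a + 1) * w)"
      by (simp add: algebra_simps flip: exp_add)
    have "exp (a * w) * ((exp w - c) * g w - deriv g w) - \<kappa> =
       exp (- w) * (exp w * (exp ((a + 1) * w) * g w) - c * (exp ((a + 1) * w) * g w)
           - exp ((a + 1) * w) * deriv g w) - \<kappa>"
      unfolding e by (simp add: algebra_simps)
    also have "\<dots> = exp (- w) * (exp w * (n + \<kappa>) - c * (n + \<kappa>) - (m - (a + 1) * \<kappa>)) - \<kappa>"
      by (simp add: n_def m_def)
    also have "\<dots> = (exp (- w) * exp w) * (n + \<kappa>) - \<kappa> - exp (- w) * (c * n + m + (c - (a + 1)) * \<kappa>)"
      by (simp only: algebra_simps)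
    also have "\<dots> = n - exp (- w) * (c * n + m + (c - (a + 1)) * \<kappa>)"
      by (simp flip: exp_add)
    also have "norm \<dots> \<le> norm n + exp (- Re w) * (norm c * norm n + norm m + norm ((c - (a + 1)) * \<kappa>))"
      by (intro order_trans[OF norm_triangle_ineq4] add_left_mono)
         (auto simp: norm_mult intro!: mult_left_mono order_trans[OF norm_triangle_ineq] add_mono)
    also have "\<dots> \<le> C * exp (- Re w) + exp (- Re w) * (norm c * C + C + norm ((c - (a + 1)) * \<kappa>))"
      using n n' m' by (intro add_mono mult_left_mono) auto
    finally show ?thesis by (simp add: D_def algebra_simps)
  qed
  then show "\<exists>C R. \<forall>w. Re w \<ge> R \<longrightarrow> \<bar>Im w\<bar> \<le> 3 * pi / 2 - \<delta> \<longrightarrow>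
      norm (exp (a * w) * ((exp w - c) * g w - deriv g w) - \<kappa>) \<le> C * exp (- Re w)"
    by blast
qed

text \<open>The leading coefficient of g is \<kappa> and that of its derivative is - a \<kappa>,
  which together give c \<kappa> - a \<kappa>.\<close>

lemma kummer_asymp_lower_c:
  assumes g: "g holomorphic_on UNIV" and "kummer_asymp a \<kappa> g"
  shows "kummer_asymp a ((c - a) * \<kappa>) (\<lambda>w. c * g w + deriv g w)"
proof (rule kummer_asympI)
  fix \<delta> :: real assume "\<delta> > 0"
  obtain C R where C: "C \<ge> 0" "\<And>w. Re w \<ge> R \<Longrightarrow> \<bar>Im w\<bar> \<le> 3 * pi / 2 - \<delta> \<Longrightarrow>
        norm (exp (a * w) * g w - \<kappa>) \<le> C * exp (- Re w)"
    "\<And>w. Re w \<ge> R \<Longrightarrow> \<bar>Im w\<bar> \<le> 3 * pi / 2 - \<delta> \<Longrightarrow>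
        norm (exp (a * w) * deriv g w + a * \<kappa>) \<le> C * exp (- Re w)"
    using kummer_asymp_deriv[OF assms \<open>\<delta> > 0\<close>] by blast
  have "norm (exp (a * w) * (c * g w + deriv g w) - (c - a) * \<kappa>) \<le> (norm c * C + C) * exp (- Re w)"
    if w: "Re w \<ge> R" "\<bar>Im w\<bar> \<le> 3 * pi / 2 - \<delta>" for w
  proof -
    have "exp (a * w) * (c * g w + deriv g w) - (c - a) * \<kappa> =
        c * (exp (a * w) * g w - \<kappa>) + (exp (a * w) * deriv g w + a * \<kappa>)"
      by (simp add: algebra_simps)
    also have "norm \<dots> \<le> norm c * (C * exp (- Re w)) + C * exp (- Re w)"
      by (rule order_trans[OF norm_triangle_ineq], rule add_mono[OF _ C(3)[OF w]],
          unfold norm_mult[of c], rule mult_left_mono[OF C(2)[OF w] norm_ge_zero])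
    finally show ?thesis by (simp add: algebra_simps)
  qed
  then show "\<exists>C R. \<forall>w. Re w \<ge> R \<longrightarrow> \<bar>Im w\<bar> \<le> 3 * pi / 2 - \<delta> \<longrightarrow>
      norm (exp (a * w) * (c * g w + deriv g w) - (c - a) * \<kappa>) \<le> C * exp (- Re w)"
    by blast
qed

lemma tendsto_of_exp_bound:
  fixes f :: "real \<Rightarrow> complex"
  assumes "\<And>t. t \<ge> R \<Longrightarrow> norm (f t - l) \<le> C * exp (- t)"
  shows "(f \<longlongrightarrow> l) at_top"
proof -
  have "((\<lambda>t. C * exp (- t)) \<longlongrightarrow> C * 0) at_top"
    by (intro tendsto_mult tendsto_const filterlim_compose[OF exp_at_bot filterlim_uminus_at_bot_at_top])
  then have "((\<lambda>t. f t - l) \<longlongrightarrow> 0) at_top"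
    using assms by (auto intro!: Lim_null_comparison[where g = "\<lambda>t. C * exp (- t)"] eventually_at_top_linorderI[of R])
  then show ?thesis by (simp add: LIM_zero_iff)
qed

text \<open>These are limits along the ray arg x = y. The bound is assumed on a whole strip around
  it because the limit of the derivative is obtained from Cauchy's inequality.\<close>

lemma strip_asymp_tendsto:
  assumes g: "g holomorphic_on UNIV" and "\<rho> > 0"
    and C: "\<And>w. Re w \<ge> R \<Longrightarrow> \<bar>Im w - y\<bar> \<le> \<rho> \<Longrightarrow>
        norm (exp (a * w) * g w - \<kappa>) \<le> C * exp (- Re w)"
  defines "w \<equiv> \<lambda>t. of_real t + \<i> * of_real y"
  shows "((\<lambda>t. exp (a * w t) * g (w t)) \<longlongrightarrow> \<kappa>) at_top"
    and "((\<lambda>t. exp (a * w t) * deriv g (w t)) \<longlongrightarrow> - a * \<kappa>) at_top"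
proof -
  show "((\<lambda>t. exp (a * w t) * g (w t)) \<longlongrightarrow> \<kappa>) at_top"
    by (rule tendsto_of_exp_bound[of R _ _ C]) (use C[of "w _"] \<open>\<rho> > 0\<close> in \<open>simp add: w_def\<close>)
  have "norm (exp (a * (of_real R + \<i> * of_real y)) * g (of_real R + \<i> * of_real y) - \<kappa>) \<le> C * exp (- R)"
    using C[of "of_real R + \<i> * of_real y"] \<open>\<rho> > 0\<close> by simp
  from order_trans[OF norm_ge_zero this] have "C \<ge> 0"
    by (simp add: zero_le_mult_iff)
  obtain C' where C': "C' \<ge> C" "\<And>w. Re w \<ge> R + \<rho> \<Longrightarrow> \<bar>Im w - y\<bar> \<le> 0 \<Longrightarrow>
        norm (exp (a * w) * deriv g w + a * \<kappa>) \<le> C' * exp (- Re w)"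
    by (rule strip_asymp_deriv[OF g \<open>\<rho> > 0\<close> \<open>C \<ge> 0\<close>, of R y 0]) (use C in auto)
  show "((\<lambda>t. exp (a * w t) * deriv g (w t)) \<longlongrightarrow> - a * \<kappa>) at_top"
    by (rule tendsto_of_exp_bound[of "R + \<rho>" _ _ C']) (use C'(2)[of "w _"] in \<open>simp add: w_def\<close>)
qed

lemma kummer_asymp_tendsto:
  assumes g: "g holomorphic_on UNIV" and "kummer_asymp a \<kappa> g" "\<bar>y\<bar> < 3 * pi / 2"
  defines "w \<equiv> \<lambda>t. of_real t + \<i> * of_real y"
  shows "((\<lambda>t. exp (a * w t) * g (w t)) \<longlongrightarrow> \<kappa>) at_top"
    and "((\<lambda>t. exp (a * w t) * deriv g (w t)) \<longlongrightarrow> - a * \<kappa>) at_top"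
proof -
  define \<rho> where "\<rho> = (3 * pi / 2 - \<bar>y\<bar>) / 2"
  have \<rho>: "\<rho> > 0" using assms by (simp add: \<rho>_def)
  obtain C R where C: "C \<ge> 0" "\<And>w. Re w \<ge> R \<Longrightarrow> \<bar>Im w\<bar> \<le> 3 * pi / 2 - \<rho> \<Longrightarrow>
        norm (exp (a * w) * g w - \<kappa>) \<le> C * exp (- Re w)"
    using kummer_asympE[OF assms(2) \<rho>] by blast
  have "norm (exp (a * w) * g w - \<kappa>) \<le> C * exp (- Re w)" if "Re w \<ge> R" "\<bar>Im w - y\<bar> \<le> \<rho>" for w
  proof (rule C(2)[OF that(1)])
    have "\<bar>Im w\<bar> \<le> \<bar>Im w - y\<bar> + \<bar>y\<bar>" using abs_triangle_ineq[of "Im w - y" y] by simp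
    also have "\<dots> \<le> 3 * pi / 2 - \<rho>" using that(2) unfolding \<rho>_def by argo
    finally show "\<bar>Im w\<bar> \<le> 3 * pi / 2 - \<rho>" .
  qed
  note * = strip_asymp_tendsto[OF g \<rho>, of R y a \<kappa> C, OF this]
  show "((\<lambda>t. exp (a * w t) * g (w t)) \<longlongrightarrow> \<kappa>) at_top"
    "((\<lambda>t. exp (a * w t) * deriv g (w t)) \<longlongrightarrow> - a * \<kappa>) at_top"
    unfolding w_def by (rule *; assumption)+
qed

lemma filterlim_exp_exp:
  assumes "\<sigma> > 0"
  shows "filterlim (\<lambda>t::real. exp (\<sigma> * exp t + \<rho> * t)) at_top at_top"
proof -
  have "filterlim (\<lambda>t::real. \<sigma> * exp t + \<rho> * t) at_top at_top"
  proof (rule filterlim_at_top_mono[OF filterlim_ident])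
    show "\<forall>\<^sub>F t in at_top. t \<le> \<sigma> * exp t + \<rho> * t"
    proof (rule eventually_at_top_linorderI)
      \<comment> \<open>Beyond this threshold \<sigma> t^2 / 2, a lower bound of \<sigma> e^t,
        dominates (1 + |\<rho>|) t.\<close>
      fix t :: real assume t: "t \<ge> 2 * ((1 + \<bar>\<rho>\<bar>) / \<sigma>)"
      have "0 \<le> 2 * ((1 + \<bar>\<rho>\<bar>) / \<sigma>)" using assms by simp
      then have t0: "0 \<le> t" using t by (rule order_trans)
      have s: "1 + \<bar>\<rho>\<bar> \<le> \<sigma> * (t / 2)" using t assms by (simp add: field_simps)
      have "t * (1 - \<rho>) \<le> t * (1 + \<bar>\<rho>\<bar>)" using t0 by (intro mult_left_mono) auto
      also have "\<dots> \<le> t * (\<sigma> * (t / 2))" using t0 s by (intro mult_left_mono) auto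
      also have "\<dots> = \<sigma> * (t\<^sup>2 / 2)" by (simp add: power2_eq_square)
      also have "\<dots> \<le> \<sigma> * exp t"
        using exp_lower_Taylor_quadratic[of t] t0 assms by (intro mult_left_mono) auto
      finally show "t \<le> \<sigma> * exp t + \<rho> * t" by (simp add: algebra_simps)
    qed
  qed
  then show ?thesis by (rule filterlim_compose[OF exp_at_top])
qed

text \<open>
  In the right half plane the Wronskian of two solutions is either zero or exponentially large,
  so that solutions of algebraic growth are determined by their leading coefficient.
\<close>

lemma kummer_strip_unique:
  assumes g: "kummer_solution a c g" and h: "kummer_solution a c h" and y: "\<bar>y\<bar> < pi / 2" and "\<rho> > 0"
    and Cg: "\<And>w. Re w \<ge> R \<Longrightarrow> \<bar>Im w - y\<bar> \<le> \<rho> \<Longrightarrow>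
        norm (exp (a * w) * g w - \<kappa>) \<le> C * exp (- Re w)"
    and Ch: "\<And>w. Re w \<ge> R \<Longrightarrow> \<bar>Im w - y\<bar> \<le> \<rho> \<Longrightarrow>
        norm (exp (a * w) * h w - 1) \<le> C * exp (- Re w)"
  shows "g w = \<kappa> * h w"
proof -
  have hg: "kummer_on a c UNIV g" using g by (simp add: kummer_solution_iff)
  have hh: "kummer_on a c UNIV h" using h by (simp add: kummer_solution_iff)
  have hol: "g holomorphic_on UNIV" "h holomorphic_on UNIV"
    using hg hh by (auto simp: kummer_on_def)
  define v where "v = (\<lambda>t::real. of_real t + \<i> * of_real y)"
  obtain D where "\<And>w. w \<in> UNIV \<Longrightarrow> wronskian g h w = D * exp (exp w - (c - 1) * w)"
    using kummer_wronskian[OF open_UNIV connected_UNIV hg hh] by blast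
  note D = this[OF UNIV_I]
  have lim: "((\<lambda>t. exp (a * v t) * g (v t)) \<longlongrightarrow> \<kappa>) at_top"
      "((\<lambda>t. exp (a * v t) * deriv g (v t)) \<longlongrightarrow> - a * \<kappa>) at_top"
      "((\<lambda>t. exp (a * v t) * h (v t)) \<longlongrightarrow> 1) at_top"
      "((\<lambda>t. exp (a * v t) * deriv h (v t)) \<longlongrightarrow> - a * 1) at_top"
    unfolding v_def using strip_asymp_tendsto[OF hol(1) \<open>\<rho> > 0\<close> Cg]
      strip_asymp_tendsto[OF hol(2) \<open>\<rho> > 0\<close> Ch] by blast+
  have cos: "cos y > 0" using y by (intro cos_gt_zero_pi) auto
  have "D = 0"
  proof (rule ccontr)
    assume "D \<noteq> 0"
    \<comment> \<open>The leading terms of the scaled Wronskian cancel, so it tends to 0, whereas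
      Abel's formula makes it grow doubly exponentially because cos y > 0.\<close>
    have "((\<lambda>t. exp (a * v t) * g (v t) * (exp (a * v t) * deriv h (v t))
        - exp (a * v t) * deriv g (v t) * (exp (a * v t) * h (v t))) \<longlongrightarrow> \<kappa> * (- a * 1) - (- a * \<kappa>) * 1) at_top"
      by (rule tendsto_diff[OF tendsto_mult[OF lim(1) lim(4)] tendsto_mult[OF lim(2) lim(3)]])
    also have "(\<lambda>t. exp (a * v t) * g (v t) * (exp (a * v t) * deriv h (v t))
        - exp (a * v t) * deriv g (v t) * (exp (a * v t) * h (v t))) =
        (\<lambda>t. D * exp (exp (v t) - (c - 1) * v t + 2 * a * v t))"
    proof
      fix t :: real
      have "exp (a * v t) * g (v t) * (exp (a * v t) * deriv h (v t))
        - exp (a * v t) * deriv g (v t) * (exp (a * v t) * h (v t)) =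
        exp (2 * a * v t) * wronskian g h (v t)"
        by (simp add: wronskian_def algebra_simps flip: exp_add mult_2)
      then show "exp (a * v t) * g (v t) * (exp (a * v t) * deriv h (v t))
        - exp (a * v t) * deriv g (v t) * (exp (a * v t) * h (v t)) =
        D * exp (exp (v t) - (c - 1) * v t + 2 * a * v t)"
        by (simp add: D exp_add mult_ac)
    qed
    finally have "((\<lambda>t. norm (D * exp (exp (v t) - (c - 1) * v t + 2 * a * v t))) \<longlongrightarrow> norm (0::complex)) at_top"
      by (intro tendsto_norm) simp
    moreover have "norm (D * exp (exp (v t) - (c - 1) * v t + 2 * a * v t)) =
        (norm D * exp (Im c * y - 2 * Im a * y)) * exp (cos y * exp t + (1 - Re c + 2 * Re a) * t)" for t
      by (simp add: norm_mult v_def Re_exp algebra_simps flip: exp_add)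
    ultimately have "((\<lambda>t. (norm D * exp (Im c * y - 2 * Im a * y)) * exp (cos y * exp t + (1 - Re c + 2 * Re a) * t)) \<longlongrightarrow> 0) at_top"
      by simp
    moreover have "filterlim (\<lambda>t. (norm D * exp (Im c * y - 2 * Im a * y)) * exp (cos y * exp t + (1 - Re c + 2 * Re a) * t)) at_top at_top"
      using \<open>D \<noteq> 0\<close>
      by (intro filterlim_tendsto_pos_mult_at_top[OF tendsto_const _ filterlim_exp_exp[OF cos]]) auto
    ultimately show False
      by (rule not_tendsto_and_filterlim_at_infinity[OF trivial_limit_at_top_linorder _ filterlim_at_top_imp_at_infinity])
  qed
  \<comment> \<open>On this half strip C < Re w < exp (Re w), so the error bound for
    \<open>h\<close> is below 1; hence \<open>h\<close> has no zeros there and the quotient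
    \<open>g / h\<close> is defined.\<close>
  define T where "T = {w. Re w > max R C} \<inter> ({w. Im w < y + \<rho>} \<inter> {w. Im w > y - \<rho>})"
  have T_strip: "Re w \<ge> R" "\<bar>Im w - y\<bar> \<le> \<rho>" "C < Re w" if "w \<in> T" for w
    using that by (auto simp: T_def)
  have hT: "h w \<noteq> 0" if "w \<in> T" for w
  proof
    assume "h w = 0"
    moreover have "norm (exp (a * w) * h w - 1) \<le> C * exp (- Re w)"
      by (rule Ch[OF T_strip(1,2)[OF that]])
    ultimately have "1 \<le> C * exp (- Re w)" by simp
    then have "exp (Re w) \<le> C" by (simp add: exp_minus field_simps)
    then show False using T_strip(3)[OF that] exp_ge_add_one_self[of "Re w"] by linarith
  qed
  have oT: "open T" unfolding T_def
    by (intro open_Int open_Collect_less continuous_intros)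
  have "convex T" unfolding T_def
    by (intro convex_Int convex_halfspace_Re_gt convex_halfspace_Im_gt convex_halfspace_Im_lt)
  have T_mem: "v t \<in> T" if "t > max R C" for t using that \<open>\<rho> > 0\<close> by (simp add: T_def v_def)
  have "((\<lambda>w. g w / h w) has_field_derivative 0) (at w within T)" if w: "w \<in> T" for w
  proof -
    note D' = kummer_onD(1)[OF hg open_UNIV UNIV_I, of w] kummer_onD(1)[OF hh open_UNIV UNIV_I, of w]
    have "deriv g w * h w - g w * deriv h w = 0"
      using D[of w] \<open>D = 0\<close> by (simp add: wronskian_def)
    then show ?thesis
      using has_field_derivative_at_within[OF DERIV_divide[OF D' hT[OF w]], of T] by simp
  qed
  then obtain k where k: "\<And>w. w \<in> T \<Longrightarrow> g w / h w = k"
    using has_field_derivative_zero_constant[OF \<open>convex T\<close>, of "\<lambda>w. g w / h w"] by blast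
  have gk: "g w = k * h w" if "w \<in> T" for w
    using k[OF that] hT[OF that] by (simp add: field_simps)
  have "((\<lambda>t. k * (exp (a * v t) * h (v t))) \<longlongrightarrow> k * 1) at_top"
    by (intro tendsto_intros lim)
  moreover have "\<forall>\<^sub>F t in at_top. k * (exp (a * v t) * h (v t)) = exp (a * v t) * g (v t)"
    using eventually_gt_at_top[of "max R C"]
    by eventually_elim (simp add: gk[OF T_mem])
  ultimately have "((\<lambda>t. exp (a * v t) * g (v t)) \<longlongrightarrow> k * 1) at_top"
    by (rule Lim_transform_eventually)
  from tendsto_unique[OF trivial_limit_at_top_linorder this lim(1)] have "k = \<kappa>" by simp
  show ?thesis
  proof (rule analytic_continuation_open[OF oT open_UNIV _ connected_UNIV _ hol(1) _ _ UNIV_I])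
    show "T \<noteq> {}" using T_mem[of "max R C + 1"] by auto
    show "z \<in> T \<Longrightarrow> g z = \<kappa> * h z" for z using gk \<open>k = \<kappa>\<close> by simp
    show "(\<lambda>w. \<kappa> * h w) holomorphic_on UNIV" by (intro holomorphic_intros hol)
  qed auto
qed

lemma kummer_asymp_unique:
  assumes g: "kummer_solution a c g" "kummer_asymp a \<kappa> g"
    and h: "kummer_solution a c h" "kummer_asymp a 1 h"
  shows "g w = \<kappa> * h w"
proof -
  obtain C R where C: "C \<ge> 0" "\<And>w. Re w \<ge> R \<Longrightarrow> \<bar>Im w\<bar> \<le> 3 * pi / 2 - pi / 2 \<Longrightarrow>
        norm (exp (a * w) * g w - \<kappa>) \<le> C * exp (- Re w)"
    using kummer_asympE[OF g(2), of "pi / 2"] by auto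
  obtain C' R' where C': "C' \<ge> 0" "\<And>w. Re w \<ge> R' \<Longrightarrow> \<bar>Im w\<bar> \<le> 3 * pi / 2 - pi / 2 \<Longrightarrow>
        norm (exp (a * w) * h w - 1) \<le> C' * exp (- Re w)"
    using kummer_asympE[OF h(2), of "pi / 2"] by auto
  have m: "C * exp (- Re w) \<le> max C C' * exp (- Re w)" "C' * exp (- Re w) \<le> max C C' * exp (- Re w)" for w
    by (auto intro: mult_right_mono)
  show ?thesis
  proof (rule kummer_strip_unique[OF g(1) h(1), of 0 1 "max R R'" \<kappa> "max C C'"])
    fix w assume w: "Re w \<ge> max R R'" "\<bar>Im w - 0\<bar> \<le> 1"
    show "norm (exp (a * w) * g w - \<kappa>) \<le> max C C' * exp (- Re w)"
      by (rule order_trans[OF C(2) m(1)]) (use w pi_gt3 in auto)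
    show "norm (exp (a * w) * h w - 1) \<le> max C C' * exp (- Re w)"
      by (rule order_trans[OF C'(2) m(2)]) (use w pi_gt3 in auto)
  qed auto
qed

text \<open>Uniqueness of the normalised solution resolves the definite description behind
  \<open>conf_hyp_U\<close>.\<close>

lemma conf_hyp_U_eqI:
  assumes "kummer_solution a c g" "kummer_asymp a 1 g"
  shows "conf_hyp_U a c = g"
  unfolding conf_hyp_U_def
proof (rule the_equality)
  show "kummer_solution a c g \<and> second_kind_normalized a g"
    using assms by (simp add: second_kind_normalized_iff)
  show "h = g" if "kummer_solution a c h \<and> second_kind_normalized a h" for h
    using kummer_asymp_unique[of a c h 1 g] that assms by (auto simp: second_kind_normalized_iff)
qed

section \<open>The Laplace transform\<close>

text \<open>The bound is required for every rate above \<sigma>, so the class is closed under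
  multiplication by r. Vanishing for r \<le> 0 makes an integral over the whole line one-sided.
  Boundedness near 0 is part of the notion, which is why kernels like r^(a-1) appear with Re a \<ge>
  1.\<close>

definition exp_order :: "real \<Rightarrow> (real \<Rightarrow> complex) \<Rightarrow> bool" where
  "exp_order \<sigma> k \<longleftrightarrow> k \<in> borel_measurable borel \<and> (\<forall>r\<le>0. k r = 0) \<and>
     (\<forall>\<tau>>\<sigma>. \<exists>M. \<forall>r>0. norm (k r) \<le> M * exp (\<tau> * r))"

definition laplace :: "(real \<Rightarrow> complex) \<Rightarrow> complex \<Rightarrow> complex" where
  "laplace k X = (LBINT r. exp (- X * of_real r) * k r)"

lemma exp_orderE:
  assumes "exp_order \<sigma> k" "\<tau> > \<sigma>"
  obtains M where "M \<ge> 0" "\<And>r. norm (k r) \<le> M * exp (\<tau> * r)"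
proof -
  obtain M where M: "\<And>r. r > 0 \<Longrightarrow> norm (k r) \<le> M * exp (\<tau> * r)"
    using assms unfolding exp_order_def by blast
  show ?thesis
  proof (rule that[of "max M 0"])
    fix r :: real
    show "norm (k r) \<le> max M 0 * exp (\<tau> * r)"
    proof (cases "r > 0")
      case True
      note M[OF True]
      also have "M * exp (\<tau> * r) \<le> max M 0 * exp (\<tau> * r)" by (intro mult_right_mono) auto
      finally show ?thesis .
    next
      case False
      then show ?thesis using assms by (simp add: exp_order_def)
    qed
  qed auto
qed

text \<open>Half of the gap between \<sigma> and the rate \<tau> pays for the factor r.\<close>

lemma exp_order_mult_id:
  assumes "exp_order \<sigma> k"
  shows "exp_order \<sigma> (\<lambda>r. of_real r * k r)"
  unfolding exp_order_def
proof (intro conjI allI impI)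
  show "(\<lambda>r. complex_of_real r * k r) \<in> borel_measurable borel"
    using assms by (auto simp: exp_order_def)
  show "complex_of_real r * k r = 0" if "r \<le> 0" for r
    using assms that by (auto simp: exp_order_def)
  fix \<tau> assume "\<tau> > \<sigma>"
  define e where "e = (\<tau> - \<sigma>) / 2"
  have e: "e > 0" "\<sigma> + e > \<sigma>" "\<tau> = e + (\<sigma> + e)"
    using \<open>\<tau> > \<sigma>\<close> by (simp_all add: e_def field_simps)
  obtain M where M: "M \<ge> 0" "\<And>r. norm (k r) \<le> M * exp ((\<sigma> + e) * r)"
    using exp_orderE[OF assms e(2)] by blast
  have "norm (complex_of_real r * k r) \<le> (M / e) * exp (\<tau> * r)" if "r > 0" for r
  proof -
    have "e * r \<le> exp (e * r)" using exp_ge_add_one_self[of "e * r"] by linarith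
    then have "r \<le> exp (e * r) / e" using e(1) by (simp add: field_simps)
    then have "r * norm (k r) \<le> (exp (e * r) / e) * (M * exp ((\<sigma> + e) * r))"
      using that M by (intro mult_mono) auto
    also have "\<dots> = (M / e) * (exp (e * r) * exp ((\<sigma> + e) * r))" by simp
    also have "exp (e * r) * exp ((\<sigma> + e) * r) = exp (\<tau> * r)"
      unfolding exp_add[symmetric] distrib_right[symmetric] using e(3) by simp
    finally show ?thesis using that by (simp add: norm_mult)
  qed
  then show "\<exists>M. \<forall>r>0. norm (complex_of_real r * k r) \<le> M * exp (\<tau> * r)" by blast
qed

lemma integrable_exp_half_line:
  assumes "s > 0"
  shows "integrable lborel (\<lambda>r::real. indicator {0<..} r * exp (- s * r))"
proof -
  have "set_integrable lborel (einterval 0 \<infinity>) (\<lambda>r. exp (- s * r))"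
  proof (rule interval_integral_FTC_nonneg(1))
    show "((\<lambda>r. - exp (- s * r) / s) has_real_derivative exp (- s * x)) (at x)" for x
      using assms by (auto intro!: derivative_eq_intros)
    have "((\<lambda>r. - exp (- s * r) / s) \<longlongrightarrow> - exp (- s * 0) / s) (at_right 0)"
      by (intro tendsto_intros) (use assms in auto)
    then show "(((\<lambda>r. - exp (- s * r) / s) \<circ> real_of_ereal) \<longlongrightarrow> - exp (- s * 0) / s) (at_right 0)"
      unfolding zero_ereal_def ereal_tendsto_simps by simp
    have "filterlim (\<lambda>r. (- s) * r) at_bot at_top"
      using assms by (intro filterlim_tendsto_neg_mult_at_bot[OF tendsto_const _ filterlim_ident]) auto
    then have "((\<lambda>r. - exp (- s * r) / s) \<longlongrightarrow> - 0 / s) at_top"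
      by (intro tendsto_divide tendsto_minus tendsto_const filterlim_compose[OF exp_at_bot])
         (use assms in auto)
    then show "(((\<lambda>r. - exp (- s * r) / s) \<circ> real_of_ereal) \<longlongrightarrow> - 0 / s) (at_left \<infinity>)"
      unfolding ereal_tendsto_simps .
  qed (auto simp: zero_ereal_def)
  then show ?thesis
    by (simp add: set_integrable_def einterval_def zero_ereal_def greaterThan_def)
qed

lemma laplace_integrable:
  assumes "exp_order \<sigma> k" "Re X > \<sigma>"
  shows "integrable lborel (\<lambda>r. exp (- X * of_real r) * k r)"
proof -
  define s where "s = (Re X - \<sigma>) / 2"
  have s: "s > 0" "\<sigma> + s > \<sigma>" "\<sigma> + s - Re X = - s"
    using assms(2) by (simp_all add: s_def field_simps)
  obtain M where M: "M \<ge> 0" "\<And>r. norm (k r) \<le> M * exp ((\<sigma> + s) * r)"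
    using exp_orderE[OF assms(1) s(2)] by blast
  show ?thesis
  proof (rule Bochner_Integration.integrable_bound[OF _ _ AE_I2])
    show "integrable lborel (\<lambda>r::real. M * (indicator {0<..} r * exp (- s * r)))"
      by (intro integrable_mult_right integrable_exp_half_line s)
    show "(\<lambda>r. exp (- X * of_real r) * k r) \<in> borel_measurable lborel"
      using assms(1) by (auto simp: exp_order_def)
    fix r :: real
    show "norm (exp (- X * of_real r) * k r) \<le> norm (M * (indicator {0<..} r * exp (- s * r)))"
    proof (cases "r > 0")
      case True
      have "norm (exp (- X * of_real r) * k r) \<le> exp (- Re X * r) * (M * exp ((\<sigma> + s) * r))"
        unfolding norm_mult norm_exp_eq_Re by (intro mult_mono M) auto
      also have "\<dots> = M * exp ((\<sigma> + s - Re X) * r)"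
        by (simp add: algebra_simps flip: exp_add)
      finally show ?thesis using True M(1) s(3) by simp
    next
      case False
      then show ?thesis using assms(1) by (auto simp: exp_order_def)
    qed
  qed
qed

text \<open>By a second-order Taylor estimate of the exponential, the error of the difference
  quotient is at most |h| times one fixed integral of r^2 |k| at the abscissa Re X - e. This
  integral converges because the class of kernels admits multiplication by r twice.\<close>

lemma laplace_has_derivative:
  assumes k: "exp_order \<sigma> k" and X: "Re X > \<sigma>"
  shows "(laplace k has_field_derivative laplace (\<lambda>r. - of_real r * k r) X) (at X)"
proof -
  define e where "e = (Re X - \<sigma>) / 2"
  have e: "e > 0" "Re X - e > \<sigma>" using X by (simp_all add: e_def field_simps)
  have k1: "exp_order \<sigma> (\<lambda>r. of_real r * k r)"
    by (rule exp_order_mult_id[OF k])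
  have k2: "exp_order \<sigma> (\<lambda>r. of_real r * (of_real r * k r))"
    by (rule exp_order_mult_id[OF k1])
  define K where "K = (LBINT r. norm (exp (- (X - of_real e) * of_real r) * (of_real r * (of_real r * k r))))"
  have intK: "integrable lborel (\<lambda>r. norm (exp (- (X - of_real e) * of_real r) * (of_real r * (of_real r * k r))))"
    by (intro integrable_norm laplace_integrable[OF k2]) (use e in simp)
  have "((\<lambda>h. (laplace k (X + h) - laplace k X) / h) \<longlongrightarrow> laplace (\<lambda>r. - of_real r * k r) X) (at 0)"
  proof (rule LIM_zero_cancel, rule Lim_null_comparison)
    show "((\<lambda>h. norm h * K) \<longlongrightarrow> 0) (at (0::complex))"
      by (auto intro!: tendsto_eq_intros)
    have "norm ((laplace k (X + h) - laplace k X) / h - laplace (\<lambda>r. - of_real r * k r) X) \<le> norm h * K"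
      if h: "h \<noteq> 0" "norm h < e" for h
    proof -
      have "Re (X + h) > \<sigma>"
        using abs_Re_le_cmod[of h] h e by simp
      note i = laplace_integrable[OF k this] laplace_integrable[OF k X] laplace_integrable[OF k1 X]
      have i3: "integrable lborel (\<lambda>r. exp (- X * of_real r) * (- of_real r * k r))"
        using i(3) by simp
      have i12: "integrable lborel (\<lambda>r. (exp (- (X + h) * of_real r) * k r - exp (- X * of_real r) * k r) / h)"
        using i(1,2) by (intro integrable_divide Bochner_Integration.integrable_diff) auto
      have eq: "(laplace k (X + h) - laplace k X) / h - laplace (\<lambda>r. - of_real r * k r) X =
         (LBINT r. (exp (- (X + h) * of_real r) * k r - exp (- X * of_real r) * k r) / h
             - exp (- X * of_real r) * (- of_real r * k r))"
        unfolding laplace_def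
        by (subst Bochner_Integration.integral_diff[OF i12 i3])
           (simp only: integral_divide_zero Bochner_Integration.integral_diff[OF i(1,2)])
      have "norm (LBINT r. (exp (- (X + h) * of_real r) * k r - exp (- X * of_real r) * k r) / h
             - exp (- X * of_real r) * (- of_real r * k r)) \<le> (LBINT r. norm h * norm (exp (- (X - of_real e) * of_real r) * (of_real r * (of_real r * k r))))"
      proof (rule Bochner_Integration.integral_norm_bound_integral)
        show "integrable lborel (\<lambda>r. (exp (- (X + h) * of_real r) * k r - exp (- X * of_real r) * k r) / h
             - exp (- X * of_real r) * (- of_real r * k r))"
          by (rule Bochner_Integration.integrable_diff[OF i12 i3])
        show "integrable lborel (\<lambda>r. norm h * norm (exp (- (X - of_real e) * of_real r) * (of_real r * (of_real r * k r))))"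
          using intK by simp
        fix r :: real
        show "norm ((exp (- (X + h) * of_real r) * k r - exp (- X * of_real r) * k r) / h
             - exp (- X * of_real r) * (- of_real r * k r)) \<le>
             norm h * norm (exp (- (X - of_real e) * of_real r) * (of_real r * (of_real r * k r)))"
        proof (cases "r > 0")
          case False
          then show ?thesis using k by (auto simp: exp_order_def)
        next
          case True
          define u where "u = - h * of_real r"
          have "norm (exp u - (1 + u)) \<le> exp \<bar>Re u\<bar> * norm u ^ 2"
            using Taylor_exp[of u 1] by (simp add: power2_eq_square)
          also have "\<dots> \<le> exp (e * r) * (norm h * r) ^ 2"
          proof (intro mult_mono)
            have "\<bar>Re u\<bar> \<le> norm u" by (rule abs_Re_le_cmod)
            also have "\<dots> \<le> e * r" using h True by (simp add: u_def norm_mult)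
            finally show "exp \<bar>Re u\<bar> \<le> exp (e * r)" by simp
          qed (use True in \<open>auto simp: u_def norm_mult\<close>)
          finally have u: "norm (exp u - (1 + u)) \<le> exp (e * r) * (norm h * r) ^ 2" .
          have "exp (- (X + h) * of_real r) = exp (- X * of_real r) * exp u"
            by (simp add: u_def algebra_simps flip: exp_add)
          then have eq: "(exp (- (X + h) * of_real r) * k r - exp (- X * of_real r) * k r) / h
             - exp (- X * of_real r) * (- of_real r * k r) =
             exp (- X * of_real r) * k r * ((exp u - (1 + u)) / h)"
            using h by (simp add: u_def field_simps)
          have "norm (exp (- X * of_real r) * k r * ((exp u - (1 + u)) / h)) =
              exp (- Re X * r) * norm (k r) * (norm (exp u - (1 + u)) / norm h)"
            by (simp add: norm_mult norm_divide)
          moreover have "exp (- Re X * r) * norm (k r) * (norm (exp u - (1 + u)) / norm h) \<le>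
              exp (- Re X * r) * norm (k r) * (exp (e * r) * (norm h * r) ^ 2 / norm h)"
            by (intro mult_left_mono divide_right_mono u) auto
          moreover have "exp (- Re X * r) * norm (k r) * (exp (e * r) * (norm h * r) ^ 2 / norm h) =
              norm h * ((exp (- Re X * r) * exp (e * r)) * (r * (r * norm (k r))))"
            using h by (simp add: power2_eq_square)
          moreover have "exp (- Re X * r) * exp (e * r) = exp (- (Re X - e) * r)"
            unfolding exp_add[symmetric] by (simp add: algebra_simps)
          moreover have "norm (exp (- (X - of_real e) * of_real r) * (of_real r * (of_real r * k r))) =
              exp (- (Re X - e) * r) * (r * (r * norm (k r)))"
            using True by (simp add: norm_mult)
          ultimately show ?thesis unfolding eq by simp
        qed
      qed
      then show ?thesis unfolding eq by (simp add: K_def)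
    qed
    moreover have "\<forall>\<^sub>F h in at (0::complex). h \<noteq> 0 \<and> norm h < e"
      using e(1) by (auto simp: eventually_at dist_norm)
    ultimately show "\<forall>\<^sub>F h in at 0. norm ((laplace k (X + h) - laplace k X) / h - laplace (\<lambda>r. - of_real r * k r) X) \<le> norm h * K"
      by (auto elim: eventually_mono)
  qed
  then show ?thesis by (simp add: DERIV_def)
qed

lemma laplace_cmult: "laplace (\<lambda>r. p * k r) X = p * laplace k X"
proof -
  have "(LBINT r. exp (- X * of_real r) * (p * k r)) = (LBINT r. p * (exp (- X * of_real r) * k r))"
    by (intro Bochner_Integration.integral_cong) auto
  then show ?thesis by (simp add: laplace_def)
qed

text \<open>An exact derivative with vanishing boundary values integrates to 0. The upper end is an
  \<open>ereal\<close> so that the half line and the unit interval are treated together.\<close>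

lemma LBINT_FTC_zero:
  fixes f F :: "real \<Rightarrow> complex"
  assumes T: "0 < T"
    and F: "\<And>r. 0 < r \<Longrightarrow> ereal r < T \<Longrightarrow> (F has_vector_derivative f r) (at r)"
    and f: "\<And>r. 0 < r \<Longrightarrow> ereal r < T \<Longrightarrow> isCont f r"
    and int: "integrable lborel g" "\<And>r. g r = (if 0 < r \<and> ereal r < T then f r else 0)"
    and lim: "(F \<longlongrightarrow> 0) (at_right 0)" "((F \<circ> real_of_ereal) \<longlongrightarrow> 0) (at_left T)"
  shows "(LBINT r. g r) = 0"
proof -
  have g: "g = (\<lambda>r. indicator (einterval 0 T) r *\<^sub>R f r)"
    by (auto simp: int(2) fun_eq_iff einterval_def zero_ereal_def)
  have "(LBINT r=0..T. f r) = 0 - 0"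
  proof (rule interval_integral_FTC_integrable[OF T])
    show "set_integrable lborel (einterval 0 T) f"
      using int(1) unfolding g set_integrable_def .
    show "((F \<circ> real_of_ereal) \<longlongrightarrow> 0) (at_right 0)"
      using lim(1) unfolding zero_ereal_def ereal_tendsto_simps .
  qed (use F f lim in \<open>auto simp: zero_ereal_def\<close>)
  then show ?thesis
    using less_imp_le[OF T] unfolding g by (simp add: interval_lebesgue_integral_def set_lebesgue_integral_def)
qed

lemma exp_order_tendsto_0:
  assumes "exp_order \<sigma> k" "Re X > \<sigma>"
  shows "((\<lambda>r. exp (- X * of_real r) * k r) \<longlongrightarrow> 0) at_top"
proof -
  define s where "s = (Re X - \<sigma>) / 2"
  have s: "s > 0" "\<sigma> + s > \<sigma>" "\<sigma> + s - Re X = - s"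
    using assms(2) by (simp_all add: s_def field_simps)
  obtain M where M: "M \<ge> 0" "\<And>r. norm (k r) \<le> M * exp ((\<sigma> + s) * r)"
    using exp_orderE[OF assms(1) s(2)] by blast
  have "filterlim (\<lambda>r. (- s) * r) at_bot at_top"
    using s by (intro filterlim_tendsto_neg_mult_at_bot[OF tendsto_const _ filterlim_ident]) auto
  then have lim: "((\<lambda>r. M * exp (- s * r)) \<longlongrightarrow> M * 0) at_top"
    by (intro tendsto_mult tendsto_const filterlim_compose[OF exp_at_bot])
  have le: "norm (exp (- X * of_real r) * k r) \<le> M * exp (- s * r)" for r
  proof -
    have "norm (exp (- X * of_real r) * k r) \<le> exp (- Re X * r) * (M * exp ((\<sigma> + s) * r))"
      unfolding norm_mult norm_exp_eq_Re by (intro mult_mono M) auto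
    also have "\<dots> = M * exp ((\<sigma> + s - Re X) * r)"
      by (simp add: algebra_simps flip: exp_add)
    finally show ?thesis using s(3) by simp
  qed
  show ?thesis
  proof (rule Lim_null_comparison)
    show "\<forall>\<^sub>F r in at_top. norm (exp (- X * of_real r) * k r) \<le> M * exp (- s * r)"
      by (intro always_eventually allI le)
    show "((\<lambda>r. M * exp (- s * r)) \<longlongrightarrow> 0) at_top" using lim by simp
  qed
qed

text \<open>The kernel r^(a-1) (1 + \<omega> r)^(b-1), where b stands for c - a. For \<omega> = 1 on
  the half line its Laplace transform is Gamma(a) psi(a, c, x); another \<omega> of modulus 1 turns
  the ray of integration; \<omega> = -1 on the unit interval gives the Euler integral of M; b = 1
  leaves the pure power used for comparison in Watson's lemma.\<close>

definition euler_kernel :: "complex \<Rightarrow> complex \<Rightarrow> complex \<Rightarrow> ereal \<Rightarrow> real \<Rightarrow> complex" where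
  "euler_kernel a b \<omega> T r = (if 0 < r \<and> ereal r < T
     then exp ((a - 1) * of_real (ln r)) * exp ((b - 1) * Ln (1 + \<omega> * of_real r)) else 0)"

lemma euler_kernel_measurable:
  assumes "\<And>r. 0 < r \<Longrightarrow> ereal r < T \<Longrightarrow> 1 + \<omega> * of_real r \<notin> \<real>\<^sub>\<le>\<^sub>0"
  shows "euler_kernel a b \<omega> T \<in> borel_measurable borel"
proof -
  have "continuous_on (einterval 0 T)
      (\<lambda>r. exp ((a - 1) * of_real (ln r)) * exp ((b - 1) * Ln (1 + \<omega> * of_real r)))"
    by (intro continuous_intros) (use assms in \<open>auto simp: einterval_def zero_ereal_def\<close>)
  then have "(\<lambda>r. indicator (einterval 0 T) r *\<^sub>R (exp ((a - 1) * of_real (ln r)) * exp ((b - 1) * Ln (1 + \<omega> * of_real r))))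
      \<in> borel_measurable borel"
    by (intro borel_measurable_continuous_on_indicator) auto
  also have "(\<lambda>r. indicator (einterval 0 T) r *\<^sub>R (exp ((a - 1) * of_real (ln r)) * exp ((b - 1) * Ln (1 + \<omega> * of_real r))))
      = euler_kernel a b \<omega> T"
    by (auto simp: euler_kernel_def fun_eq_iff einterval_def zero_ereal_def)
  finally show ?thesis .
qed

text \<open>Kummer's operator in the variable X = \<omega> e^w, applied under the integral sign,
  produces a multiple of the derivative of e^(-X r) r^a (1 + \<omega> r)^b. Both boundary values
  vanish, at 0 because Re a > 0 and at T by the assumption \<open>lim\<close>.\<close>

lemma kummer_on_laplace:
  fixes a b \<omega> :: complex and T :: ereal
  defines "k \<equiv> euler_kernel a b \<omega> T"
  assumes k: "exp_order \<sigma> k" and a: "Re a > 0" and \<omega>: "\<omega> \<noteq> 0" and T: "0 < T"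
    and slit: "\<And>r. 0 < r \<Longrightarrow> ereal r < T \<Longrightarrow> 1 + \<omega> * of_real r \<notin> \<real>\<^sub>\<le>\<^sub>0"
    and lim: "\<And>X. Re X > \<sigma> \<Longrightarrow>
      (((\<lambda>r. exp (- X * of_real r) * exp (a * of_real (ln r)) * exp (b * Ln (1 + \<omega> * of_real r))) \<circ> real_of_ereal)
        \<longlongrightarrow> 0) (at_left T)"
    and S: "open S" "\<And>w. w \<in> S \<Longrightarrow> Re (\<omega> * exp w) > \<sigma>"
  shows "kummer_on a (a + b) S (\<lambda>w. laplace k (\<omega> * exp w))"
proof -
  define k1 where "k1 = (\<lambda>r. - of_real r * k r)"
  define k2 where "k2 = (\<lambda>r. - of_real r * k1 r)"
  have e1: "exp_order \<sigma> (\<lambda>r. of_real r * k r)"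
    by (rule exp_order_mult_id[OF k])
  then have o1: "exp_order \<sigma> k1" by (simp add: k1_def exp_order_def)
  have o2: "exp_order \<sigma> k2"
    using exp_order_mult_id[OF e1] by (simp add: k2_def k1_def exp_order_def)
  have d0: "(laplace k has_field_derivative laplace k1 X) (at X)" if "Re X > \<sigma>" for X
    unfolding k1_def by (rule laplace_has_derivative[OF k that])
  have d1: "(laplace k1 has_field_derivative laplace k2 X) (at X)" if "Re X > \<sigma>" for X
    unfolding k2_def by (rule laplace_has_derivative[OF o1 that])
  have ode: "X * laplace k2 X + (a + b - X / \<omega>) * laplace k1 X - a / \<omega> * laplace k X = 0"
    if X: "Re X > \<sigma>" for X
  proof -
    define F where "F = (\<lambda>r. exp (- X * of_real r) * exp (a * of_real (ln r)) * exp (b * Ln (1 + \<omega> * of_real r)))"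
    define f where "f = (\<lambda>r. exp (- X * of_real r) * (exp ((a - 1) * of_real (ln r)) * exp ((b - 1) * Ln (1 + \<omega> * of_real r)))
        * ((- X * of_real r + a) * (1 + \<omega> * of_real r) + b * \<omega> * of_real r))"
    \<comment> \<open>The last factor is r (1 + \<omega> r) times the logarithmic derivative of
      \<open>F\<close>. Expanded in powers of r, it gives - \<omega> times the integrand of Kummer's
      operator.\<close>
    define g where "g = (\<lambda>r. exp (- X * of_real r) * k r * ((- X * of_real r + a) * (1 + \<omega> * of_real r) + b * \<omega> * of_real r))"
    note i = laplace_integrable[OF o2 X] laplace_integrable[OF o1 X] laplace_integrable[OF k X]
    have g_eq: "g = (\<lambda>r. (- \<omega>) * (X * (exp (- X * of_real r) * k2 r) + (a + b - X / \<omega>) * (exp (- X * of_real r) * k1 r)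
        - a / \<omega> * (exp (- X * of_real r) * k r)))"
      using \<omega> by (simp add: g_def k1_def k2_def fun_eq_iff field_simps)
    have "(LBINT r. g r) = 0"
    proof (rule LBINT_FTC_zero[OF T, of F f])
      fix r :: real assume r: "0 < r" "ereal r < T"
      have nz: "1 + \<omega> * of_real r \<noteq> 0" using slit[OF r] by auto
      have e: "exp (a * of_real (ln r)) = of_real r * exp ((a - 1) * of_real (ln r))"
        "exp (b * Ln (1 + \<omega> * of_real r)) = (1 + \<omega> * of_real r) * exp ((b - 1) * Ln (1 + \<omega> * of_real r))"
        using r nz by (simp_all add: left_diff_distrib exp_diff exp_of_real)
      have "((\<lambda>z. exp (- X * z) * exp (a * Ln z) * exp (b * Ln (1 + \<omega> * z))) has_field_derivative f r) (at (of_real r))"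
      proof -
        define x where "x = complex_of_real r"
        have x: "x \<notin> \<real>\<^sub>\<le>\<^sub>0" "x \<noteq> 0" "Ln x = of_real (ln r)"
          using r by (auto simp: x_def Ln_of_real complex_nonpos_Reals_iff)
        have s: "1 + \<omega> * x \<notin> \<real>\<^sub>\<le>\<^sub>0" using slit[OF r] by (simp add: x_def)
        have D1: "((\<lambda>z. exp (- X * z)) has_field_derivative exp (- X * x) * (- X)) (at x)"
          by (auto intro!: derivative_eq_intros)
        have D2: "((\<lambda>z. exp (a * Ln z)) has_field_derivative exp (a * Ln x) * (a * inverse x)) (at x)"
          by (rule DERIV_fun_exp[OF DERIV_cmult[OF has_field_derivative_Ln[OF x(1)]]])
        have D: "((\<lambda>z. 1 + \<omega> * z) has_field_derivative \<omega>) (at x)"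
          by (auto intro!: derivative_eq_intros)
        have D3: "((\<lambda>z. exp (b * Ln (1 + \<omega> * z))) has_field_derivative
            exp (b * Ln (1 + \<omega> * x)) * (b * (inverse (1 + \<omega> * x) * \<omega>))) (at x)"
          by (rule DERIV_fun_exp[OF DERIV_cmult[OF DERIV_chain2[OF has_field_derivative_Ln[OF s] D]]])
        have "((\<lambda>z. exp (- X * z) * exp (a * Ln z) * exp (b * Ln (1 + \<omega> * z))) has_field_derivative
           (exp (- X * x) * (- X) * exp (a * Ln x) + exp (a * Ln x) * (a * inverse x) * exp (- X * x)) * exp (b * Ln (1 + \<omega> * x)) +
           exp (b * Ln (1 + \<omega> * x)) * (b * (inverse (1 + \<omega> * x) * \<omega>)) * (exp (- X * x) * exp (a * Ln x))) (at x)"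
          by (rule DERIV_mult[OF DERIV_mult[OF D1 D2] D3])
        also have "(exp (- X * x) * (- X) * exp (a * Ln x) + exp (a * Ln x) * (a * inverse x) * exp (- X * x)) * exp (b * Ln (1 + \<omega> * x)) +
           exp (b * Ln (1 + \<omega> * x)) * (b * (inverse (1 + \<omega> * x) * \<omega>)) * (exp (- X * x) * exp (a * Ln x)) = f r"
          unfolding f_def x(3) x_def[symmetric] e[folded x_def] using x(2) nz[folded x_def] by (simp add: field_simps)
        finally show ?thesis by (simp only: x_def)
      qed
      then have "((\<lambda>r. exp (- X * of_real r) * exp (a * Ln (of_real r)) * exp (b * Ln (1 + \<omega> * of_real r))) has_vector_derivative f r) (at r)"
        by (rule has_vector_derivative_real_field)
      then show "(F has_vector_derivative f r) (at r)"
      proof (rule has_vector_derivative_transform_within_open[of _ _ _ "{0<..}"])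
        show "x \<in> {0<..} \<Longrightarrow> exp (- X * of_real x) * exp (a * Ln (of_real x)) * exp (b * Ln (1 + \<omega> * of_real x)) = F x" for x
          by (simp add: F_def Ln_of_real)
      qed (use r in auto)
      show "isCont f r"
        unfolding f_def by (intro continuous_intros) (use r slit[OF r] in auto)
    next
      show "integrable lborel g" unfolding g_eq
        by (intro integrable_mult_right Bochner_Integration.integrable_diff Bochner_Integration.integrable_add i)
      show "g r = (if 0 < r \<and> ereal r < T then f r else 0)" for r
        by (simp add: g_def f_def k_def euler_kernel_def)
      show "((F \<circ> real_of_ereal) \<longlongrightarrow> 0) (at_left T)"
        unfolding F_def by (rule lim[OF X])
      have "((\<lambda>r. exp (- X * of_real r) * exp (b * Ln (1 + \<omega> * of_real r))) \<longlongrightarrow> exp (- X * of_real 0) * exp (b * Ln (1 + \<omega> * of_real 0))) (at_right 0)"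
        by (intro tendsto_intros) auto
      moreover have "((\<lambda>r. exp (a * of_real (ln r))) \<longlongrightarrow> 0) (at_right 0)"
      proof (rule tendsto_norm_zero_cancel)
        have "filterlim (\<lambda>r. Re a * ln r) at_bot (at_right 0)"
          by (rule filterlim_tendsto_pos_mult_at_bot[OF tendsto_const a ln_at_0])
        then show "((\<lambda>r. norm (exp (a * complex_of_real (ln r)))) \<longlongrightarrow> 0) (at_right 0)"
          by (simp add: filterlim_compose[OF exp_at_bot])
      qed
      ultimately have "((\<lambda>r. (exp (- X * of_real r) * exp (b * Ln (1 + \<omega> * of_real r))) * exp (a * of_real (ln r))) \<longlongrightarrow>
         (exp (- X * of_real 0) * exp (b * Ln (1 + \<omega> * of_real 0))) * 0) (at_right 0)"
        by (rule tendsto_mult)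
      then show "(F \<longlongrightarrow> 0) (at_right 0)"
        by (simp add: F_def mult_ac)
    qed
    also have "(LBINT r. g r) = (- \<omega>) * (X * laplace k2 X + (a + b - X / \<omega>) * laplace k1 X - a / \<omega> * laplace k X)"
      unfolding g_eq laplace_def
      by (subst integral_mult_right_zero, subst Bochner_Integration.integral_diff, (intro integrable_mult_right Bochner_Integration.integrable_add i)+,
          subst Bochner_Integration.integral_add, (intro integrable_mult_right i)+, simp)
    finally show ?thesis using \<omega> by (auto simp: minus_equation_iff)
  qed
  show ?thesis
  proof (rule kummer_onI[OF S(1)])
    fix w assume w: "w \<in> S"
    define X where "X = \<omega> * exp w"
    note X = S(2)[OF w, folded X_def]
    have e: "((\<lambda>w. \<omega> * exp w) has_field_derivative \<omega> * exp w) (at w)"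
      by (auto intro!: derivative_eq_intros)
    note c0 = DERIV_chain2[OF d0[OF S(2)[OF w]] e]
    note c1 = DERIV_chain2[OF d1[OF S(2)[OF w]] e]
    show "((\<lambda>w. laplace k (\<omega> * exp w)) has_field_derivative laplace k1 (\<omega> * exp w) * (\<omega> * exp w)) (at w)"
      by (rule c0)
    show "((\<lambda>w. laplace k1 (\<omega> * exp w) * (\<omega> * exp w)) has_field_derivative
       (laplace k2 (\<omega> * exp w) * (\<omega> * exp w) * (\<omega> * exp w) + \<omega> * exp w * laplace k1 (\<omega> * exp w))) (at w)"
      by (rule DERIV_mult[OF c1 e])
    have w': "exp w = X / \<omega>" using \<omega> by (simp add: X_def)
    \<comment> \<open>Multiplication by X turns the equation in X into the one in w = log x.\<close>
    have "X * (X * laplace k2 X + (a + b - X / \<omega>) * laplace k1 X - a / \<omega> * laplace k X) = 0"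
      using ode[OF X] by simp
    then show "laplace k2 (\<omega> * exp w) * (\<omega> * exp w) * (\<omega> * exp w) + \<omega> * exp w * laplace k1 (\<omega> * exp w) =
       (exp w + 1 - (a + b)) * (laplace k1 (\<omega> * exp w) * (\<omega> * exp w)) + a * exp w * laplace k (\<omega> * exp w)"
      unfolding X_def[symmetric] w' by (simp add: algebra_simps)
  qed
qed

section \<open>Growth of Euler kernels and the equation for their transforms\<close>

lemma ln_le_linear:
  fixes r \<epsilon> :: real
  assumes "r > 0" "\<epsilon> > 0"
  shows "ln r \<le> \<epsilon> * r + (- 1 - ln \<epsilon>)"
  using ln_le_minus_one[of "\<epsilon> * r"] assms by (simp add: ln_mult)

text \<open>The logarithm lies below each of its tangents; the slope \<epsilon> is chosen so small
  that p \<epsilon> \<le> \<tau>.\<close>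

lemma power_subexponential:
  fixes p \<tau> :: real
  assumes "p \<ge> 0" "\<tau> > 0"
  obtains M where "M \<ge> 0" "\<And>r. r > 0 \<Longrightarrow> exp (p * ln r) \<le> M * exp (\<tau> * r)"
proof -
  define \<epsilon> where "\<epsilon> = \<tau> / (p + 1)"
  have \<epsilon>: "\<epsilon> > 0" "p * \<epsilon> \<le> \<tau>"
    using assms by (simp_all add: \<epsilon>_def field_simps)
  show ?thesis
  proof (rule that[of "exp (p * (- 1 - ln \<epsilon>))"])
    fix r :: real assume r: "r > 0"
    have "p * ln r \<le> p * (\<epsilon> * r + (- 1 - ln \<epsilon>))"
      using ln_le_linear[OF r \<epsilon>(1)] assms(1) by (rule mult_left_mono)
    also have "\<dots> = (p * \<epsilon>) * r + p * (- 1 - ln \<epsilon>)" by (simp add: algebra_simps)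
    also have "\<dots> \<le> \<tau> * r + p * (- 1 - ln \<epsilon>)"
      using \<epsilon>(2) r by (intro add_right_mono mult_right_mono) auto
    finally show "exp (p * ln r) \<le> exp (p * (- 1 - ln \<epsilon>)) * exp (\<tau> * r)"
      by (simp flip: exp_add add: add.commute)
  qed auto
qed

lemma unit_ray_avoids_slit:
  fixes \<omega> :: complex
  assumes "norm \<omega> = 1" "\<omega> \<noteq> - 1" "r \<ge> 0"
  shows "1 + \<omega> * of_real r \<notin> \<real>\<^sub>\<le>\<^sub>0"
proof
  assume "1 + \<omega> * of_real r \<in> \<real>\<^sub>\<le>\<^sub>0"
  then have *: "1 + Re \<omega> * r \<le> 0" "Im \<omega> * r = 0"
    by (auto simp: complex_nonpos_Reals_iff)
  then have "r \<noteq> 0" by auto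
  then have "Im \<omega> = 0" using * by simp
  then have "Re \<omega> = 1 \<or> Re \<omega> = - 1" using assms(1) by (auto simp: norm_complex_def abs_eq_iff)
  then have "Re \<omega> = 1" using assms(2) \<open>Im \<omega> = 0\<close> by (auto simp: complex_eq_iff)
  then show False using * assms(3) by simp
qed

text \<open>The exponent b - 1 may have negative real part, so |1 + \<omega> r| must stay away from
  0. For Re \<omega> < 0, multiplication by the conjugate of \<omega> moves the ray to a horizontal
  line at distance |Im \<omega>| from the real axis.\<close>

lemma unit_ray_distance:
  fixes \<omega> :: complex
  assumes "norm \<omega> = 1" "\<omega> \<noteq> - 1"
  obtains d where "d > 0" "d \<le> 1" "\<And>r. r \<ge> 0 \<Longrightarrow> d \<le> norm (1 + \<omega> * of_real r)"
proof (cases "Re \<omega> \<ge> 0")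
  case True
  show ?thesis
  proof (rule that[of 1])
    fix r :: real assume "r \<ge> 0"
    then have "1 \<le> Re (1 + \<omega> * of_real r)" using True by simp
    also have "\<dots> \<le> norm (1 + \<omega> * of_real r)" by (rule complex_Re_le_cmod)
    finally show "1 \<le> norm (1 + \<omega> * of_real r)" .
  qed auto
next
  case False
  have im: "Im \<omega> \<noteq> 0"
  proof
    assume "Im \<omega> = 0"
    then have "\<bar>Re \<omega>\<bar> = 1" using assms(1) by (simp add: norm_complex_def)
    then show False using False assms(2) \<open>Im \<omega> = 0\<close> by (auto simp: complex_eq_iff)
  qed
  show ?thesis
  proof (rule that[of "\<bar>Im \<omega>\<bar>"])
    show "\<bar>Im \<omega>\<bar> > 0" using im by simp
    show "\<bar>Im \<omega>\<bar> \<le> 1" using abs_Im_le_cmod[of \<omega>] assms(1) by simp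
    fix r :: real assume "r \<ge> 0"
    have "cnj \<omega> * (1 + \<omega> * of_real r) = cnj \<omega> + of_real r"
      using complex_norm_square[of \<omega>] assms(1) by (simp add: algebra_simps)
    then have "norm (1 + \<omega> * of_real r) = norm (cnj \<omega> + of_real r)"
      using assms(1) by (metis complex_mod_cnj mult_1 norm_mult)
    also have "\<dots> \<ge> \<bar>Im (cnj \<omega> + of_real r)\<bar>" by (rule abs_Im_le_cmod)
    finally show "\<bar>Im \<omega>\<bar> \<le> norm (1 + \<omega> * of_real r)" by simp
  qed
qed

text \<open>The modulus of z^s is exp(Re s ln|z| - Im s arg z). The argument is at most pi in
  modulus, and ln|z| lies between ln d and a linear function of r of arbitrarily small
  slope.\<close>

lemma unit_ray_power_subexponential:
  fixes \<omega> s :: complex and \<tau> :: real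
  assumes \<omega>: "norm \<omega> = 1" "\<omega> \<noteq> - 1" and "\<tau> > 0"
  obtains M where "M \<ge> 0" "\<And>r. r \<ge> 0 \<Longrightarrow> norm (exp (s * Ln (1 + \<omega> * of_real r))) \<le> M * exp (\<tau> * r)"
proof -
  obtain d where d: "d > 0" "d \<le> 1" "\<And>r. r \<ge> 0 \<Longrightarrow> d \<le> norm (1 + \<omega> * of_real r)"
    using unit_ray_distance[OF \<omega>] by blast
  define \<epsilon> where "\<epsilon> = \<tau> / (\<bar>Re s\<bar> + 1)"
  have \<epsilon>: "\<epsilon> > 0" "\<bar>Re s\<bar> * \<epsilon> \<le> \<tau>"
    using assms by (simp_all add: \<epsilon>_def field_simps)
  define K where "K = \<bar>Re s\<bar> * (\<epsilon> + (- 1 - ln \<epsilon>) - ln d) + \<bar>Im s\<bar> * pi"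
  show ?thesis
  proof (rule that[of "exp K"])
    fix r :: real assume r: "r \<ge> 0"
    define z where "z = 1 + \<omega> * of_real r"
    have z: "d \<le> norm z" "z \<noteq> 0" using d(1) d(3)[OF r] by (auto simp: z_def)
    have "norm z \<le> 1 + r"
      unfolding z_def by (rule order_trans[OF norm_triangle_ineq]) (use r \<omega> in \<open>simp add: norm_mult\<close>)
    then have "ln (norm z) \<le> ln (1 + r)" using z r by (subst ln_le_cancel_iff) auto
    also have "\<dots> \<le> \<epsilon> * (1 + r) + (- 1 - ln \<epsilon>)" using r by (intro ln_le_linear \<epsilon>) auto
    finally have u: "ln (norm z) \<le> \<epsilon> * (1 + r) + (- 1 - ln \<epsilon>)" .
    have l: "ln d \<le> ln (norm z)" using z d(1) by (subst ln_le_cancel_iff) auto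
    have "0 \<le> ln (1 + r)" using r by simp
    also have "\<dots> \<le> \<epsilon> * (1 + r) + (- 1 - ln \<epsilon>)" using r by (intro ln_le_linear \<epsilon>) auto
    finally have "0 \<le> \<epsilon> * (1 + r) + (- 1 - ln \<epsilon>)" .
    moreover have "ln d \<le> 0" using d by simp
    ultimately have "\<bar>ln (norm z)\<bar> \<le> \<epsilon> * (1 + r) + (- 1 - ln \<epsilon>) - ln d"
      using u l by linarith
    then have 1: "\<bar>Re s\<bar> * \<bar>ln (norm z)\<bar> \<le> \<bar>Re s\<bar> * (\<epsilon> * (1 + r) + (- 1 - ln \<epsilon>) - ln d)"
      by (intro mult_left_mono) auto
    have 2: "\<bar>Im s\<bar> * \<bar>Im (Ln z)\<bar> \<le> \<bar>Im s\<bar> * pi"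
      using mpi_less_Im_Ln[OF z(2)] Im_Ln_le_pi[OF z(2)] by (intro mult_left_mono) auto
    have "Re (s * Ln z) = Re s * ln (norm z) - Im s * Im (Ln z)"
      using z(2) by simp
    also have "\<dots> \<le> \<bar>Re s * ln (norm z)\<bar> + \<bar>Im s * Im (Ln z)\<bar>" by linarith
    also have "\<dots> = \<bar>Re s\<bar> * \<bar>ln (norm z)\<bar> + \<bar>Im s\<bar> * \<bar>Im (Ln z)\<bar>"
      by (simp only: abs_mult)
    also have "\<dots> \<le> \<bar>Re s\<bar> * (\<epsilon> * (1 + r) + (- 1 - ln \<epsilon>) - ln d) + \<bar>Im s\<bar> * pi"
      by (rule add_mono[OF 1 2])
    also have "\<dots> = (\<bar>Re s\<bar> * \<epsilon>) * r + K" by (simp add: K_def algebra_simps)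
    also have "\<dots> \<le> \<tau> * r + K"
      using \<epsilon>(2) r by (intro add_right_mono mult_right_mono) auto
    finally have "exp (Re (s * Ln z)) \<le> exp (\<tau> * r + K)" by simp
    then show "norm (exp (s * Ln (1 + \<omega> * of_real r))) \<le> exp K * exp (\<tau> * r)"
      unfolding norm_exp_eq_Re z_def[symmetric] by (simp add: exp_add mult.commute)
  qed auto
qed

lemma exp_order_euler_kernel_ray:
  fixes a b \<omega> :: complex
  assumes \<omega>: "norm \<omega> = 1" "\<omega> \<noteq> - 1" and a: "Re a \<ge> 1"
  shows "exp_order 0 (euler_kernel a b \<omega> \<infinity>)"
  unfolding exp_order_def
proof (intro conjI allI impI)
  show "euler_kernel a b \<omega> \<infinity> \<in> borel_measurable borel"
    by (intro euler_kernel_measurable unit_ray_avoids_slit \<omega>) auto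
  show "r \<le> 0 \<Longrightarrow> euler_kernel a b \<omega> \<infinity> r = 0" for r
    by (simp add: euler_kernel_def)
  fix \<tau> :: real assume "\<tau> > 0"
  obtain M where M: "M \<ge> 0" "\<And>r. r > 0 \<Longrightarrow> exp ((Re a - 1) * ln r) \<le> M * exp (\<tau> / 2 * r)"
    using power_subexponential[of "Re a - 1" "\<tau> / 2"] a \<open>\<tau> > 0\<close> by auto
  obtain N where N: "N \<ge> 0" "\<And>r. r \<ge> 0 \<Longrightarrow> norm (exp ((b - 1) * Ln (1 + \<omega> * of_real r))) \<le> N * exp (\<tau> / 2 * r)"
    using unit_ray_power_subexponential[OF \<omega>, of "\<tau> / 2" "b - 1"] \<open>\<tau> > 0\<close> by auto
  have "norm (euler_kernel a b \<omega> \<infinity> r) \<le> M * N * exp (\<tau> * r)" if "r > 0" for r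
  proof -
    have "norm (euler_kernel a b \<omega> \<infinity> r) = exp ((Re a - 1) * ln r) * norm (exp ((b - 1) * Ln (1 + \<omega> * of_real r)))"
      using that by (simp add: euler_kernel_def norm_mult)
    also have "\<dots> \<le> (M * exp (\<tau> / 2 * r)) * (N * exp (\<tau> / 2 * r))"
      using that by (intro mult_mono M N mult_nonneg_nonneg) (auto simp: M)
    also have "\<dots> = M * N * exp (\<tau> / 2 * r + \<tau> / 2 * r)" by (simp only: exp_add mult_ac)
    finally show ?thesis by simp
  qed
  then show "\<exists>M. \<forall>r>0. norm (euler_kernel a b \<omega> \<infinity> r) \<le> M * exp (\<tau> * r)" by blast
qed

text \<open>The kernel is bounded by 1 and supported in the unit interval, so it has every
  exponential order; the constant e^|\<tau>| compensates for negative \<tau>.\<close>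

lemma exp_order_euler_kernel_unit_interval:
  assumes a: "Re a \<ge> 1" and b: "Re b \<ge> 1"
  shows "exp_order \<sigma> (euler_kernel a b (- 1) 1)"
  unfolding exp_order_def
proof (intro conjI allI impI)
  show "euler_kernel a b (- 1) 1 \<in> borel_measurable borel"
    by (intro euler_kernel_measurable) (auto simp: complex_nonpos_Reals_iff one_ereal_def)
  show "r \<le> 0 \<Longrightarrow> euler_kernel a b (- 1) 1 r = 0" for r
    by (simp add: euler_kernel_def)
  fix \<tau> :: real
  have "norm (euler_kernel a b (- 1) 1 r) \<le> exp \<bar>\<tau>\<bar> * exp (\<tau> * r)" if "r > 0" for r
  proof (cases "r < 1")
    case True
    have L: "Ln (1 - of_real r) = of_real (ln (1 - r))"
      using Ln_of_real[of "1 - r"] True by simp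
    have "norm (euler_kernel a b (- 1) 1 r) = exp ((Re a - 1) * ln r) * exp ((Re b - 1) * ln (1 - r))"
      using that True by (simp add: euler_kernel_def norm_mult L one_ereal_def)
    also have "\<dots> \<le> exp 0 * exp 0"
      using that True a b by (intro mult_mono exp_le_cancel_iff[THEN iffD2] mult_nonneg_nonpos) auto
    also have "\<dots> \<le> exp (\<bar>\<tau>\<bar> + \<tau> * r)"
    proof -
      have "\<bar>\<tau> * r\<bar> \<le> \<bar>\<tau>\<bar> * 1" unfolding abs_mult using that True by (intro mult_left_mono) auto
      then have "0 \<le> \<bar>\<tau>\<bar> + \<tau> * r" by linarith
      then show ?thesis by simp
    qed
    finally show ?thesis by (simp add: exp_add)
  next
    case False
    then show ?thesis by (simp add: euler_kernel_def one_ereal_def)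
  qed
  then show "\<exists>M. \<forall>r>0. norm (euler_kernel a b (- 1) 1 r) \<le> M * exp (\<tau> * r)" by blast
qed

lemma kummer_on_laplace_ray:
  fixes a b \<omega> :: complex
  assumes \<omega>: "norm \<omega> = 1" "\<omega> \<noteq> - 1" and a: "Re a \<ge> 1"
    and S: "open S" "\<And>w. w \<in> S \<Longrightarrow> Re (\<omega> * exp w) > 0"
  shows "kummer_on a (a + b) S (\<lambda>w. laplace (euler_kernel a b \<omega> \<infinity>) (\<omega> * exp w))"
proof (rule kummer_on_laplace[OF exp_order_euler_kernel_ray[OF \<omega> a] _ _ _ _ _ S])
  let ?k = "euler_kernel a b \<omega> \<infinity>"
  fix X :: complex assume X: "Re X > 0"
  note k = exp_order_euler_kernel_ray[OF \<omega> a, of b]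
  note k1 = exp_order_mult_id[OF k]
  note k2 = exp_order_mult_id[OF k1]
  \<comment> \<open>The boundary term is r (1 + \<omega> r) times the kernel, hence a sum of r k and
    \<omega> r^2 k, and both of these are of exponential order 0.\<close>
  have "((\<lambda>r. exp (- X * of_real r) * (of_real r * ?k r) + \<omega> * (exp (- X * of_real r) * (of_real r * (of_real r * ?k r)))) \<longlongrightarrow> 0 + \<omega> * 0) at_top"
    by (intro tendsto_add tendsto_mult tendsto_const exp_order_tendsto_0[OF k1 X] exp_order_tendsto_0[OF k2 X])
  then have "((\<lambda>r. exp (- X * of_real r) * exp (a * of_real (ln r)) * exp (b * Ln (1 + \<omega> * of_real r))) \<longlongrightarrow> 0 + \<omega> * 0) at_top"
  proof (rule Lim_transform_eventually)
    show "\<forall>\<^sub>F r in at_top. exp (- X * of_real r) * (of_real r * ?k r) + \<omega> * (exp (- X * of_real r) * (of_real r * (of_real r * ?k r))) =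
      exp (- X * of_real r) * exp (a * of_real (ln r)) * exp (b * Ln (1 + \<omega> * of_real r))"
      using eventually_gt_at_top[of 0]
    proof eventually_elim
      case (elim r)
      have nz: "1 + \<omega> * of_real r \<noteq> 0" using unit_ray_avoids_slit[OF \<omega>, of r] elim by auto
      have e: "exp (a * of_real (ln r)) = of_real r * exp ((a - 1) * of_real (ln r))"
        "exp (b * Ln (1 + \<omega> * of_real r)) = (1 + \<omega> * of_real r) * exp ((b - 1) * Ln (1 + \<omega> * of_real r))"
        using elim nz by (simp_all add: left_diff_distrib exp_diff exp_of_real)
      show ?case unfolding e using elim by (simp add: euler_kernel_def algebra_simps)
    qed
  qed
  then show "(((\<lambda>r. exp (- X * of_real r) * exp (a * of_real (ln r)) * exp (b * Ln (1 + \<omega> * of_real r))) \<circ> real_of_ereal)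
        \<longlongrightarrow> 0) (at_left \<infinity>)"
    unfolding ereal_tendsto_simps by simp
qed (use a \<omega> unit_ray_avoids_slit[OF \<omega>] in auto)

text \<open>Since this kernel has every exponential order, the equation is available wherever Re (-
  x) > \<sigma>, and letting \<sigma> vary exhausts the plane.\<close>

lemma kummer_solution_laplace_unit_interval:
  assumes a: "Re a \<ge> 1" and b: "Re b \<ge> 1"
  shows "kummer_solution a (a + b) (\<lambda>w. laplace (euler_kernel a b (- 1) 1) (- exp w))"
proof -
  have loc: "kummer_on a (a + b) {w. Re (- exp w) > \<sigma>} (\<lambda>w. laplace (euler_kernel a b (- 1) 1) (- 1 * exp w))" for \<sigma>
  proof (rule kummer_on_laplace[OF exp_order_euler_kernel_unit_interval[OF a b, of \<sigma>]])
    fix X :: complex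
    have "((\<lambda>r. exp (- X * of_real r) * exp (a * of_real (ln r))) \<longlongrightarrow> exp (- X * of_real 1) * exp (a * of_real (ln 1))) (at_left 1)"
      by (intro tendsto_intros) auto
    moreover have "((\<lambda>r. exp (b * Ln (1 + (- 1) * of_real r))) \<longlongrightarrow> 0) (at_left 1)"
    proof (rule tendsto_norm_zero_cancel)
      have f: "filterlim (\<lambda>r::real. 1 - r) (at_right 0) (at_left 1)"
        by (rule filterlim_at_withinI) (auto intro!: tendsto_eq_intros eventually_at_leftI[of 0])
      have "filterlim (\<lambda>r. Re b * ln (1 - r)) at_bot (at_left 1)"
        using b by (intro filterlim_tendsto_pos_mult_at_bot[OF tendsto_const _ filterlim_compose[OF ln_at_0 f]]) auto
      then have "((\<lambda>r. exp (Re b * ln (1 - r))) \<longlongrightarrow> 0) (at_left 1)"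
        by (rule filterlim_compose[OF exp_at_bot])
      then show "((\<lambda>r. norm (exp (b * Ln (1 + (- 1) * complex_of_real r)))) \<longlongrightarrow> 0) (at_left 1)"
      proof (rule Lim_transform_eventually)
        show "\<forall>\<^sub>F r in at_left 1. exp (Re b * ln (1 - r)) = norm (exp (b * Ln (1 + (- 1) * complex_of_real r)))"
          by (rule eventually_at_leftI[of 0]) (use Ln_of_real[of "1 - _"] in auto)
      qed
    qed
    ultimately have "((\<lambda>r. exp (- X * of_real r) * exp (a * of_real (ln r)) * exp (b * Ln (1 + (- 1) * of_real r))) \<longlongrightarrow>
       exp (- X * of_real 1) * exp (a * of_real (ln 1)) * 0) (at_left 1)"
      by (rule tendsto_mult)
    then show "(((\<lambda>r. exp (- X * of_real r) * exp (a * of_real (ln r)) * exp (b * Ln (1 + (- 1) * of_real r))) \<circ> real_of_ereal)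
        \<longlongrightarrow> 0) (at_left 1)"
      unfolding one_ereal_def ereal_tendsto_simps by simp
  qed (use a in \<open>auto simp: complex_nonpos_Reals_iff one_ereal_def intro!: open_Collect_less continuous_intros\<close>)
  show ?thesis
    unfolding kummer_solution_iff
  proof (rule kummer_onI[OF open_UNIV])
    let ?g = "\<lambda>w. laplace (euler_kernel a b (- 1) 1) (- exp w)"
    fix w :: complex
    have o: "open {w. Re (- exp w) > \<sigma>}" for \<sigma>
      by (intro open_Collect_less continuous_intros)
    have w: "w \<in> {v. Re (- exp v) > Re (- exp w) - 1}" by simp
    note D = kummer_onD[OF loc o w, simplified]
    show "(?g has_field_derivative deriv ?g w) (at w)"
      "(deriv ?g has_field_derivative deriv (deriv ?g) w) (at w)"
      "deriv (deriv ?g) w = (exp w + 1 - (a + b)) * deriv ?g w + a * exp w * ?g w"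
      using D by simp_all
  qed
qed

section \<open>Gamma integrals and Watson's lemma\<close>

lemma strip_exp_Re_pos:
  assumes "\<bar>Im z\<bar> < pi / 2"
  shows "Re (exp z) > 0"
  using assms by (auto simp: Re_exp intro!: mult_pos_pos cos_gt_zero_pi)

text \<open>Integration by parts shows that the product of e^(a z) with the transform at e^z has
  derivative 0, so it is constant on the strip; its value at z = 0 is Euler's integral. Complex
  arguments are thus reached without turning the path of integration.\<close>

lemma laplace_power:
  assumes a: "Re a \<ge> 1" and z: "\<bar>Im z\<bar> < pi / 2"
  shows "laplace (euler_kernel a 1 1 \<infinity>) (exp z) = Gamma a * exp (- a * z)"
proof -
  define k where "k = euler_kernel a 1 1 \<infinity>"
  have k: "exp_order 0 k" unfolding k_def by (rule exp_order_euler_kernel_ray) (use a in auto)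
  note k1 = exp_order_mult_id[OF k]
  have parts: "X * laplace (\<lambda>r. - of_real r * k r) X = - a * laplace k X" if X: "Re X > 0" for X
  proof -
    define f where "f = (\<lambda>r. exp (- X * of_real r) * exp ((a - 1) * of_real (ln r)) * (- X * of_real r + a))"
    define F where "F = (\<lambda>r. exp (- X * of_real r) * exp (a * of_real (ln r)))"
    define g where "g = (\<lambda>r. exp (- X * of_real r) * k r * (- X * of_real r + a))"
    note i = laplace_integrable[OF k1 X] laplace_integrable[OF k X]
    have g_eq: "g = (\<lambda>r. (- X) * (exp (- X * of_real r) * (of_real r * k r)) + a * (exp (- X * of_real r) * k r))"
      by (simp add: g_def fun_eq_iff algebra_simps)
    have "(LBINT r. g r) = 0"
    proof (rule LBINT_FTC_zero[of \<infinity> F f])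
      fix r :: real assume r: "0 < r"
      define x where "x = complex_of_real r"
      have x: "x \<notin> \<real>\<^sub>\<le>\<^sub>0" "x \<noteq> 0" "Ln x = of_real (ln r)"
        using r by (auto simp: x_def Ln_of_real complex_nonpos_Reals_iff)
      have e: "exp (a * of_real (ln r)) = x * exp ((a - 1) * of_real (ln r))"
        using r by (simp add: left_diff_distrib exp_diff exp_of_real x_def)
      have D1: "((\<lambda>z. exp (- X * z)) has_field_derivative exp (- X * x) * (- X)) (at x)"
        by (auto intro!: derivative_eq_intros)
      have D2: "((\<lambda>z. exp (a * Ln z)) has_field_derivative exp (a * Ln x) * (a * inverse x)) (at x)"
        by (rule DERIV_fun_exp[OF DERIV_cmult[OF has_field_derivative_Ln[OF x(1)]]])
      have "((\<lambda>z. exp (- X * z) * exp (a * Ln z)) has_field_derivative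
         exp (- X * x) * (- X) * exp (a * Ln x) + exp (a * Ln x) * (a * inverse x) * exp (- X * x)) (at x)"
        by (rule DERIV_mult[OF D1 D2])
      also have "exp (- X * x) * (- X) * exp (a * Ln x) + exp (a * Ln x) * (a * inverse x) * exp (- X * x) = f r"
        unfolding f_def x(3) x_def[symmetric] e using x(2) by (simp add: field_simps)
      finally have "((\<lambda>r. exp (- X * of_real r) * exp (a * Ln (of_real r))) has_vector_derivative f r) (at r)"
        unfolding x_def by (rule has_vector_derivative_real_field)
      then show "(F has_vector_derivative f r) (at r)"
      proof (rule has_vector_derivative_transform_within_open[of _ _ _ "{0<..}"])
        show "x \<in> {0<..} \<Longrightarrow> exp (- X * of_real x) * exp (a * Ln (of_real x)) = F x" for x
          by (simp add: F_def Ln_of_real)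
      qed (use r in auto)
      show "isCont f r"
        unfolding f_def by (intro continuous_intros) (use r in auto)
    next
      show "integrable lborel g" unfolding g_eq
        by (intro integrable_mult_right Bochner_Integration.integrable_add i)
      show "g r = (if 0 < r \<and> ereal r < \<infinity> then f r else 0)" for r
        by (simp add: g_def f_def k_def euler_kernel_def)
      have "((\<lambda>r. exp (- X * of_real r) * (of_real r * k r)) \<longlongrightarrow> 0) at_top"
        by (rule exp_order_tendsto_0[OF k1 X])
      then have "(F \<longlongrightarrow> 0) at_top"
      proof (rule Lim_transform_eventually)
        show "\<forall>\<^sub>F r in at_top. exp (- X * of_real r) * (of_real r * k r) = F r"
          using eventually_gt_at_top[of 0]
          by eventually_elim
             (simp add: F_def k_def euler_kernel_def left_diff_distrib exp_diff exp_of_real)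
      qed
      then show "((F \<circ> real_of_ereal) \<longlongrightarrow> 0) (at_left \<infinity>)"
        unfolding ereal_tendsto_simps .
      have "((\<lambda>r. exp (- X * of_real r)) \<longlongrightarrow> exp (- X * of_real 0)) (at_right 0)"
        by (intro tendsto_intros)
      moreover have "((\<lambda>r. exp (a * of_real (ln r))) \<longlongrightarrow> 0) (at_right 0)"
      proof (rule tendsto_norm_zero_cancel)
        have "filterlim (\<lambda>r. Re a * ln r) at_bot (at_right 0)"
          using a by (intro filterlim_tendsto_pos_mult_at_bot[OF tendsto_const _ ln_at_0]) auto
        then show "((\<lambda>r. norm (exp (a * complex_of_real (ln r)))) \<longlongrightarrow> 0) (at_right 0)"
          by (simp add: filterlim_compose[OF exp_at_bot])
      qed
      ultimately have "((\<lambda>r. exp (- X * of_real r) * exp (a * of_real (ln r))) \<longlongrightarrow>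
         exp (- X * of_real 0) * 0) (at_right 0)"
        by (rule tendsto_mult)
      then show "(F \<longlongrightarrow> 0) (at_right 0)"
        by (simp add: F_def)
    qed auto
    also have "(LBINT r. g r) = (- X) * laplace (\<lambda>r. of_real r * k r) X + a * laplace k X"
      unfolding g_eq laplace_def
      by (simp only: Bochner_Integration.integral_add[OF integrable_mult_right[OF i(1)] integrable_mult_right[OF i(2)]]
          integral_mult_right_zero)
    finally have "a * laplace k X = X * laplace (\<lambda>r. of_real r * k r) X" by simp
    moreover have "laplace (\<lambda>r. - of_real r * k r) X = - laplace (\<lambda>r. of_real r * k r) X"
      using laplace_cmult[of "-1" "\<lambda>r. of_real r * k r" X] by simp
    ultimately show ?thesis by simp
  qed
  define S where "S = {z. \<bar>Im z\<bar> < pi / 2}"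
  have "convex S"
  proof -
    have "S = {z. Im z < pi / 2} \<inter> {z. Im z > - (pi / 2)}" by (auto simp: S_def)
    then show ?thesis
      by (simp only:) (intro convex_Int convex_halfspace_Im_gt convex_halfspace_Im_lt)
  qed
  have "((\<lambda>z. laplace k (exp z) * exp (a * z)) has_field_derivative 0) (at z within S)" if "z \<in> S" for z
  proof -
    have X: "Re (exp z) > 0" using that strip_exp_Re_pos by (simp add: S_def)
    have D1: "((\<lambda>z. laplace k (exp z)) has_field_derivative laplace (\<lambda>r. - of_real r * k r) (exp z) * exp z) (at z)"
      by (rule DERIV_chain2[OF laplace_has_derivative[OF k X] DERIV_exp])
    have D2: "((\<lambda>z. exp (a * z)) has_field_derivative exp (a * z) * a) (at z)"
      by (auto intro!: derivative_eq_intros)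
    have "laplace (\<lambda>r. - of_real r * k r) (exp z) * exp z * exp (a * z) + exp (a * z) * a * laplace k (exp z) = 0"
      using parts[OF X] by (simp add: algebra_simps)
    then show ?thesis
      using has_field_derivative_at_within[OF DERIV_mult[OF D1 D2], of S] by simp
  qed
  then obtain K where K: "\<And>z. z \<in> S \<Longrightarrow> laplace k (exp z) * exp (a * z) = K"
    using has_field_derivative_zero_constant[OF \<open>convex S\<close>, of "\<lambda>z. laplace k (exp z) * exp (a * z)"] by blast
  have "laplace k 1 = Gamma a"
  proof -
    have "((\<lambda>r. exp (- 1 * of_real r) * k r) has_integral laplace k 1) UNIV"
      unfolding laplace_def
      by (rule has_integral_integral_lborel[OF laplace_integrable[OF k]]) simp
    moreover have "(\<lambda>r. exp (- 1 * of_real r) * k r) =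
       (\<lambda>r. if r \<in> {0..} then complex_of_real r powr (a - 1) / of_real (exp r) else 0)"
      by (auto simp: fun_eq_iff k_def euler_kernel_def powr_def Ln_of_real exp_minus field_simps exp_of_real)
    ultimately have "((\<lambda>r. complex_of_real r powr (a - 1) / of_real (exp r)) has_integral laplace k 1) {0..}"
      by (simp only: has_integral_restrict_UNIV)
    moreover have "((\<lambda>r. complex_of_real r powr (a - 1) / of_real (exp r)) has_integral Gamma a) {0..}"
      using a by (intro Gamma_integral_complex) auto
    ultimately show ?thesis by (rule has_integral_unique)
  qed
  then have "K = Gamma a"
    using K[of 0] by (simp add: S_def)
  then have "laplace k (exp z) * exp (a * z) = Gamma a"
    using K[of z] z by (simp add: S_def)
  then show ?thesis
    by (simp add: k_def exp_minus field_simps)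
qed

lemma laplace_watson:
  assumes a: "Re a \<ge> 1" and k: "exp_order 0 k" and "C \<ge> 0"
    and kC: "\<And>r. r > 0 \<Longrightarrow> norm (k r - euler_kernel a 1 1 \<infinity> r) \<le> C * exp r * exp (Re a * ln r)"
    and z: "\<bar>Im z\<bar> < pi / 2" and X: "Re (exp z) > 1"
  shows "norm (laplace k (exp z) - Gamma a * exp (- a * z)) \<le>
    C * norm (Gamma (of_real (Re a + 1) :: complex)) * exp (- (Re a + 1) * ln (Re (exp z) - 1))"
proof -
  define s where "s = Re (exp z) - 1"
  have s: "s > 0" using X by (simp add: s_def)
  define k0 where "k0 = euler_kernel a 1 1 \<infinity>"
  define m where "m = euler_kernel (of_real (Re a + 1)) 1 1 \<infinity>"
  have k0: "exp_order 0 k0" unfolding k0_def by (rule exp_order_euler_kernel_ray) (use a in auto)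
  have m: "exp_order 0 m" unfolding m_def by (rule exp_order_euler_kernel_ray) (use a in auto)
  have m_eq: "exp (- of_real s * of_real r) * m r = of_real (exp (- s * r) * (if r > 0 then exp (Re a * ln r) else 0))" for r
    by (simp add: m_def euler_kernel_def exp_of_real[symmetric])
  have X0: "Re (exp z) > 0" using X by simp
  note i = laplace_integrable[OF k X0] laplace_integrable[OF k0 X0]
  have im: "integrable lborel (\<lambda>r. exp (- of_real s * of_real r) * m r)"
    using laplace_integrable[OF m, of "of_real s"] s by simp
  then have im': "integrable lborel (\<lambda>r. exp (- s * r) * (if r > 0 then exp (Re a * ln r) else 0))"
    unfolding m_eq by (simp only: complex_of_real_integrable_eq)
  have eq: "laplace k (exp z) - Gamma a * exp (- a * z) = (LBINT r. exp (- exp z * of_real r) * k r - exp (- exp z * of_real r) * k0 r)"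
    using laplace_power[OF a z] Bochner_Integration.integral_diff[OF i]
    unfolding laplace_def k0_def[symmetric] by simp
  have "norm (LBINT r. exp (- exp z * of_real r) * k r - exp (- exp z * of_real r) * k0 r) \<le>
     (LBINT r. C * (exp (- s * r) * (if r > 0 then exp (Re a * ln r) else 0)))"
  proof (rule Bochner_Integration.integral_norm_bound_integral)
    show "integrable lborel (\<lambda>r. exp (- exp z * of_real r) * k r - exp (- exp z * of_real r) * k0 r)"
      by (rule Bochner_Integration.integrable_diff[OF i])
    show "integrable lborel (\<lambda>r. C * (exp (- s * r) * (if r > 0 then exp (Re a * ln r) else 0)))"
      by (rule integrable_mult_right[OF im'])
    fix r :: real
    show "norm (exp (- exp z * of_real r) * k r - exp (- exp z * of_real r) * k0 r) \<le>
       C * (exp (- s * r) * (if r > 0 then exp (Re a * ln r) else 0))"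
    proof (cases "r > 0")
      case True
      have "norm (exp (- exp z * of_real r) * k r - exp (- exp z * of_real r) * k0 r) =
        exp (- Re (exp z) * r) * norm (k r - k0 r)"
        by (simp add: right_diff_distrib[symmetric] norm_mult)
      also have "\<dots> \<le> exp (- Re (exp z) * r) * (C * exp r * exp (Re a * ln r))"
        unfolding k0_def by (intro mult_left_mono kC True) auto
      also have "\<dots> = C * ((exp (- Re (exp z) * r) * exp r) * exp (Re a * ln r))"
        by simp
      also have "\<dots> = C * (exp (- s * r) * exp (Re a * ln r))"
        unfolding exp_add[symmetric] by (simp add: s_def algebra_simps)
      finally show ?thesis using True by simp
    next
      case False
      then show ?thesis using k k0 by (simp add: exp_order_def)
    qed
  qed
  also have "\<dots> = C * (LBINT r. exp (- s * r) * (if r > 0 then exp (Re a * ln r) else 0))"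
    by (rule integral_mult_right_zero)
  also have "(LBINT r. exp (- s * r) * (if r > 0 then exp (Re a * ln r) else 0)) =
     Re (laplace m (of_real s))"
    unfolding laplace_def m_eq integral_complex_of_real by simp
  also have "laplace m (of_real s) = laplace m (exp (of_real (ln s)))"
    using s by (simp add: exp_of_real)
  also have "\<dots> = Gamma (of_real (Re a + 1)) * exp (- of_real (Re a + 1) * of_real (ln s))"
    unfolding m_def by (rule laplace_power) (use a in auto)
  also have "C * Re (Gamma (of_real (Re a + 1)) * exp (- of_real (Re a + 1) * of_real (ln s))) \<le>
      C * norm (Gamma (of_real (Re a + 1)) * exp (- of_real (Re a + 1) * complex_of_real (ln s)))"
    using \<open>C \<ge> 0\<close> by (intro mult_left_mono complex_Re_le_cmod)
  also have "\<dots> = C * norm (Gamma (of_real (Re a + 1) :: complex)) * exp (- (Re a + 1) * ln s)"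
    by (simp add: norm_mult)
  finally show ?thesis unfolding eq s_def .
qed

text \<open>In the closed subsector Re X \<ge> |X| sin \<delta>. Once |X| sin \<delta> \<ge> 2, the
  shift by 1 costs at most half of this lower bound, so the error is of order |X|^(-Re a - 1), one
  power below the main term.\<close>

lemma laplace_watson_sector:
  assumes a: "Re a \<ge> 1" and k: "exp_order 0 k" and "C \<ge> 0"
    and kC: "\<And>r. r > 0 \<Longrightarrow> norm (k r - euler_kernel a 1 1 \<infinity> r) \<le> C * exp r * exp (Re a * ln r)"
    and \<delta>: "\<delta> > 0"
  shows "\<exists>K R. \<forall>z. Re z \<ge> R \<longrightarrow> \<bar>Im z\<bar> \<le> pi / 2 - \<delta> \<longrightarrow>
     norm (exp (a * z) * laplace k (exp z) / Gamma a - 1) \<le> K * exp (- Re z)"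
proof (cases "\<delta> \<le> pi / 2")
  \<comment> \<open>For \<delta> > pi / 2 the sector is empty.\<close>
  case False
  then show ?thesis by (intro exI[of _ 0]) auto
next
  case \<delta>2: True
  define e where "e = sin \<delta>"
  have e: "e > 0" unfolding e_def using \<delta> \<delta>2 by (intro sin_gt_zero) auto
  define G where "G = norm (Gamma (of_real (Re a + 1) :: complex))"
  have Ga: "Gamma a \<noteq> 0" using a by (auto simp: Gamma_eq_zero_iff elim!: nonpos_Ints_cases)
  define p where "p = Re a + 1"
  define K where "K = exp (\<bar>Im a\<bar> * (pi / 2)) * (C * G * exp (- p * ln (e / 2))) / norm (Gamma a)"
  have "norm (exp (a * z) * laplace k (exp z) / Gamma a - 1) \<le> K * exp (- Re z)"
    if z: "Re z \<ge> ln (2 / e)" "\<bar>Im z\<bar> \<le> pi / 2 - \<delta>" for z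
  proof -
    have z2: "\<bar>Im z\<bar> < pi / 2" using z \<delta> by linarith
    have c: "e \<le> cos (Im z)"
    proof -
      have "e = cos (pi / 2 - \<delta>)" unfolding e_def by (simp add: cos_diff)
      also have "\<dots> \<le> cos \<bar>Im z\<bar>" using z \<delta> by (intro cos_monotone_0_pi_le) auto
      finally show ?thesis by simp
    qed
    have X1: "Re (exp z) \<ge> exp (Re z) * e"
      unfolding Re_exp using c by (intro mult_left_mono) auto
    have "exp (ln (2 / e)) \<le> exp (Re z)" using z by simp
    then have X2: "exp (Re z) * e \<ge> 2" using e by (simp add: field_simps)
    have X3: "Re (exp z) - 1 \<ge> exp (Re z) * (e / 2)" using X1 X2 by simp
    have X: "Re (exp z) > 1" using X1 X2 by linarith
    have "ln (exp (Re z) * (e / 2)) \<le> ln (Re (exp z) - 1)"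
      using X3 X e by (subst ln_le_cancel_iff) auto
    moreover have "ln (exp (Re z) * (e / 2)) = Re z + ln (e / 2)"
      using e by (subst ln_mult) auto
    ultimately have l: "Re z + ln (e / 2) \<le> ln (Re (exp z) - 1)" by simp
    have W: "norm (laplace k (exp z) - Gamma a * exp (- a * z)) \<le> C * G * exp (- p * ln (Re (exp z) - 1))"
      unfolding G_def p_def by (rule laplace_watson[OF a k \<open>C \<ge> 0\<close> kC z2 X])
    also have "\<dots> \<le> C * G * exp (- p * (Re z + ln (e / 2)))"
      using \<open>C \<ge> 0\<close> l a by (intro mult_left_mono) (auto simp: G_def p_def)
    finally have W: "norm (laplace k (exp z) - Gamma a * exp (- a * z)) \<le> C * G * exp (- p * (Re z + ln (e / 2)))" .
    have n: "norm (exp (a * z)) \<le> exp (Re a * Re z) * exp (\<bar>Im a\<bar> * (pi / 2))"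
    proof -
      have "\<bar>Im a * Im z\<bar> \<le> \<bar>Im a\<bar> * (pi / 2)" unfolding abs_mult using z2 by (intro mult_left_mono) auto
      then have "- (Im a * Im z) \<le> \<bar>Im a\<bar> * (pi / 2)" by linarith
      then show ?thesis by (simp flip: exp_add)
    qed
    have "exp (a * z) * exp (- a * z) = 1" by (simp flip: exp_add)
    then have "exp (a * z) * laplace k (exp z) / Gamma a - 1 =
      exp (a * z) * (laplace k (exp z) - Gamma a * exp (- a * z)) / Gamma a"
      using Ga by (simp add: field_simps)
    then have "norm (exp (a * z) * laplace k (exp z) / Gamma a - 1) =
       norm (exp (a * z)) * norm (laplace k (exp z) - Gamma a * exp (- a * z)) / norm (Gamma a)"
      by (simp only: norm_divide norm_mult)
    also have "\<dots> \<le> (exp (Re a * Re z) * exp (\<bar>Im a\<bar> * (pi / 2))) * (C * G * exp (- p * (Re z + ln (e / 2)))) / norm (Gamma a)"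
      by (intro divide_right_mono mult_mono n W) auto
    also have "exp (- p * (Re z + ln (e / 2))) = exp (- p * Re z) * exp (- p * ln (e / 2))"
      by (simp only: distrib_left exp_add)
    also have "exp (Re a * Re z) * exp (\<bar>Im a\<bar> * (pi / 2)) * (C * G * (exp (- p * Re z) * exp (- p * ln (e / 2)))) / norm (Gamma a)
        = K * (exp (Re a * Re z) * exp (- p * Re z))"
      by (simp add: K_def)
    also have "exp (Re a * Re z) * exp (- p * Re z) = exp (- Re z)"
      unfolding exp_add[symmetric] by (simp add: p_def algebra_simps)
    finally show ?thesis .
  qed
  then show ?thesis by blast
qed

section \<open>Existence of the second solution and contiguous relations\<close>

text \<open>Mean value inequality on the segment from 0 to r: the derivative of (1 + \<omega>
  t)^(b-1) is (b - 1) \<omega> (1 + \<omega> t)^(b-2).\<close>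

lemma unit_ray_power_minus_1:
  fixes b \<omega> :: complex
  assumes "norm \<omega> = 1" "r > 0"
    and slit: "\<And>t. 0 \<le> t \<Longrightarrow> t \<le> r \<Longrightarrow> 1 + \<omega> * of_real t \<notin> \<real>\<^sub>\<le>\<^sub>0"
    and bound: "\<And>t. 0 \<le> t \<Longrightarrow> t \<le> r \<Longrightarrow> norm (exp ((b - 2) * Ln (1 + \<omega> * of_real t))) \<le> M"
  shows "norm (exp ((b - 1) * Ln (1 + \<omega> * of_real r)) - 1) \<le> norm (b - 1) * M * r"
proof -
  define f where "f = (\<lambda>t. exp ((b - 1) * Ln (1 + \<omega> * t)))"
  have "norm (f (of_real r) - f (of_real 0)) \<le> norm (b - 1) * M * norm (of_real r - of_real 0 :: complex)"
  proof (rule field_differentiable_bound[of "of_real ` {0..r}" f "\<lambda>t. (b - 1) * \<omega> * exp ((b - 2) * Ln (1 + \<omega> * t))"])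
    show "convex (complex_of_real ` {0..r})"
      by (intro convex_linear_image bounded_linear.linear bounded_linear_of_real) auto
  next
    fix z :: complex assume "z \<in> of_real ` {0..r}"
    then obtain t where t: "z = of_real t" "0 \<le> t" "t \<le> r" by auto
    have s: "1 + \<omega> * z \<notin> \<real>\<^sub>\<le>\<^sub>0" unfolding t(1) by (rule slit[OF t(2,3)])
    then have nz: "1 + \<omega> * z \<noteq> 0" by auto
    have "(b - 1) * Ln (1 + \<omega> * z) = Ln (1 + \<omega> * z) + (b - 2) * Ln (1 + \<omega> * z)"
      by (simp add: algebra_simps)
    then have e: "exp ((b - 1) * Ln (1 + \<omega> * z)) = (1 + \<omega> * z) * exp ((b - 2) * Ln (1 + \<omega> * z))"
      using nz by (simp add: exp_add)
    have D: "((\<lambda>z. 1 + \<omega> * z) has_field_derivative \<omega>) (at z)"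
      by (auto intro!: derivative_eq_intros)
    have "(f has_field_derivative exp ((b - 1) * Ln (1 + \<omega> * z)) * ((b - 1) * (inverse (1 + \<omega> * z) * \<omega>))) (at z)"
      unfolding f_def by (rule DERIV_fun_exp[OF DERIV_cmult[OF DERIV_chain2[OF has_field_derivative_Ln[OF s] D]]])
    also have "exp ((b - 1) * Ln (1 + \<omega> * z)) * ((b - 1) * (inverse (1 + \<omega> * z) * \<omega>)) =
        (b - 1) * \<omega> * exp ((b - 2) * Ln (1 + \<omega> * z))"
      unfolding e using nz by (simp add: field_simps)
    finally show "(f has_field_derivative (b - 1) * \<omega> * exp ((b - 2) * Ln (1 + \<omega> * z))) (at z within of_real ` {0..r})"
      by (rule has_field_derivative_at_within)
    show "norm ((b - 1) * \<omega> * exp ((b - 2) * Ln (1 + \<omega> * z))) \<le> norm (b - 1) * M"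
      unfolding norm_mult t(1) assms(1) using bound[OF t(2,3)] by (simp add: mult_left_mono)
  qed (use \<open>r > 0\<close> in auto)
  then show ?thesis using \<open>r > 0\<close> by (simp add: f_def)
qed

text \<open>The factor r from the mean value inequality raises r^(a-1) to r^a; the remaining power
  of 1 + \<omega> t is subexponential and is absorbed by e^r.\<close>

lemma unit_ray_kernel_watson:
  fixes a b \<omega> :: complex
  assumes \<omega>: "norm \<omega> = 1" "\<omega> \<noteq> - 1"
  obtains C where "C \<ge> 0"
    "\<And>r. r > 0 \<Longrightarrow> norm (euler_kernel a b \<omega> \<infinity> r - euler_kernel a 1 1 \<infinity> r) \<le> C * exp r * exp (Re a * ln r)"
proof -
  obtain M where M: "M \<ge> 0" "\<And>r. r \<ge> 0 \<Longrightarrow> norm (exp ((b - 2) * Ln (1 + \<omega> * of_real r))) \<le> M * exp (1 * r)"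
    using unit_ray_power_subexponential[OF \<omega>, of 1 "b - 2"] by auto
  show ?thesis
  proof (rule that[of "norm (b - 1) * M"])
    show "norm (b - 1) * M \<ge> 0" using M by simp
    fix r :: real assume r: "r > 0"
    define f where "f = exp ((b - 1) * Ln (1 + \<omega> * of_real r))"
    have f: "norm (f - 1) \<le> norm (b - 1) * (M * exp r) * r"
      unfolding f_def
    proof (rule unit_ray_power_minus_1[OF \<omega>(1) r unit_ray_avoids_slit[OF \<omega>]])
      fix t assume t: "0 \<le> t" "t \<le> r"
      have "norm (exp ((b - 2) * Ln (1 + \<omega> * of_real t))) \<le> M * exp (1 * t)" by (rule M(2)[OF t(1)])
      also have "\<dots> \<le> M * exp r" using t M(1) by (intro mult_left_mono) auto
      finally show "norm (exp ((b - 2) * Ln (1 + \<omega> * of_real t))) \<le> M * exp r" .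
    qed
    have "euler_kernel a b \<omega> \<infinity> r - euler_kernel a 1 1 \<infinity> r = exp ((a - 1) * of_real (ln r)) * (f - 1)"
      using r by (simp add: euler_kernel_def f_def algebra_simps)
    then have "norm (euler_kernel a b \<omega> \<infinity> r - euler_kernel a 1 1 \<infinity> r) = exp ((Re a - 1) * ln r) * norm (f - 1)"
      by (simp add: norm_mult)
    also have "\<dots> \<le> exp ((Re a - 1) * ln r) * (norm (b - 1) * (M * exp r) * r)"
      by (intro mult_left_mono f) auto
    also have "\<dots> = norm (b - 1) * M * exp r * exp (Re a * ln r)"
      using r by (simp add: left_diff_distrib exp_diff)
    finally show "norm (euler_kernel a b \<omega> \<infinity> r - euler_kernel a 1 1 \<infinity> r) \<le> norm (b - 1) * M * exp r * exp (Re a * ln r)" .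
  qed
qed

text \<open>
  The Laplace integral along the ray of angle \<open>\<phi>\<close> converges for \<open>arg x\<close> in a half plane
  around \<open>- \<phi>\<close>. That half plane meets the right half plane, where the growth of the Wronskian
  identifies it with the integral for \<open>\<phi> = 0\<close>. No rotation of the contour is needed.
\<close>

lemma kummer_ray_solution:
  assumes a: "Re a \<ge> 1" and \<phi>: "\<bar>\<phi>\<bar> < pi"
  obtains h where "kummer_solution a c h"
    "\<And>\<delta>. \<delta> > 0 \<Longrightarrow> \<exists>K R. \<forall>w. Re w \<ge> R \<longrightarrow> \<bar>Im w + \<phi>\<bar> \<le> pi / 2 - \<delta> \<longrightarrow>
       norm (exp (a * w) * h w - 1) \<le> K * exp (- Re w)"
proof -
  define b where "b = c - a"
  define \<omega> where "\<omega> = cis \<phi>"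
  have \<omega>: "norm \<omega> = 1" "\<omega> \<noteq> - 1"
  proof -
    show "norm \<omega> = 1" by (simp add: \<omega>_def)
    show "\<omega> \<noteq> - 1"
    proof
      assume "\<omega> = - 1"
      then have "cos \<phi> = - 1" by (simp add: \<omega>_def complex_eq_iff)
      then have "cos \<bar>\<phi>\<bar> = cos pi" by simp
      then have "\<bar>\<phi>\<bar> = pi" by (rule cos_inj_pi[rotated 4]) (use \<phi> in simp_all)
      then show False using \<phi> by simp
    qed
  qed
  define k where "k = euler_kernel a b \<omega> \<infinity>"
  have k: "exp_order 0 k" unfolding k_def by (rule exp_order_euler_kernel_ray[OF \<omega> a])
  define S where "S = {w. Im w < pi / 2 - \<phi>} \<inter> {w. Im w > - (pi / 2) - \<phi>}"
  have S: "open S" "connected S"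
    unfolding S_def
    by (intro open_Int open_Collect_less continuous_intros)
       (intro convex_connected convex_Int convex_halfspace_Im_gt convex_halfspace_Im_lt)
  have shift: "exp (w + \<i> * of_real \<phi>) = \<omega> * exp w" for w
    by (simp add: exp_add \<omega>_def cis_conv_exp mult.commute)
  have "kummer_on a (a + b) S (\<lambda>w. laplace k (\<omega> * exp w))"
    unfolding k_def
  proof (rule kummer_on_laplace_ray[OF \<omega> a S(1)])
    fix w assume w: "w \<in> S"
    have "Im w < pi / 2 - \<phi>" "- (pi / 2) - \<phi> < Im w" using w by (auto simp: S_def)
    then have "\<bar>Im w + \<phi>\<bar> < pi / 2" unfolding abs_less_iff by argo
    then have "\<bar>Im (w + \<i> * of_real \<phi>)\<bar> < pi / 2" by simp
    then show "Re (\<omega> * exp w) > 0" unfolding shift[symmetric] by (rule strip_exp_Re_pos)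
  qed
  then have "kummer_on a c S (\<lambda>w. laplace k (\<omega> * exp w))" by (simp add: b_def)
  \<comment> \<open>With this factor, e^(a w) h(w) equals e^(a z) / Gamma(a) times the transform at
    e^z, where z = w + i \<phi>; Watson's lemma then yields the leading coefficient 1 for every
    \<phi>.\<close>
  then have "kummer_on a c S (\<lambda>w. (exp (a * (\<i> * of_real \<phi>)) / Gamma a) * laplace k (\<omega> * exp w))"
    by (rule kummer_on_scale[OF S(1)])
  then obtain h where h: "kummer_solution a c h"
    "\<And>w. w \<in> S \<Longrightarrow> h w = (exp (a * (\<i> * of_real \<phi>)) / Gamma a) * laplace k (\<omega> * exp w)"
    using kummer_extend[OF S] by blast
  show ?thesis
  proof (rule that[OF h(1)])
    fix \<delta> :: real assume \<delta>: "\<delta> > 0"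
    obtain C where C: "C \<ge> 0" "\<And>r. r > 0 \<Longrightarrow> norm (k r - euler_kernel a 1 1 \<infinity> r) \<le> C * exp r * exp (Re a * ln r)"
      using unit_ray_kernel_watson[OF \<omega>, of a b] unfolding k_def by blast
    obtain K R where K: "\<And>z. Re z \<ge> R \<Longrightarrow> \<bar>Im z\<bar> \<le> pi / 2 - \<delta> \<Longrightarrow>
       norm (exp (a * z) * laplace k (exp z) / Gamma a - 1) \<le> K * exp (- Re z)"
      using laplace_watson_sector[OF a k C \<delta>] by blast
    have "norm (exp (a * w) * h w - 1) \<le> K * exp (- Re w)"
      if w: "Re w \<ge> R" "\<bar>Im w + \<phi>\<bar> \<le> pi / 2 - \<delta>" for w
    proof -
      have "w \<in> S" using w \<delta> by (auto simp: S_def abs_le_iff)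
      have "exp (a * w) * h w = exp (a * (w + \<i> * of_real \<phi>)) * laplace k (exp (w + \<i> * of_real \<phi>)) / Gamma a"
        unfolding h(2)[OF \<open>w \<in> S\<close>] shift by (simp add: distrib_left exp_add)
      then show ?thesis using K[of "w + \<i> * of_real \<phi>"] w by simp
    qed
    then show "\<exists>K R. \<forall>w. Re w \<ge> R \<longrightarrow> \<bar>Im w + \<phi>\<bar> \<le> pi / 2 - \<delta> \<longrightarrow>
       norm (exp (a * w) * h w - 1) \<le> K * exp (- Re w)" by blast
  qed
qed

text \<open>All ray solutions coincide with the one for \<phi> = 0, so this single function has the
  required asymptotics in the half plane around each direction - \<phi> with |\<phi>| < pi. Together
  these half planes cover |arg x| < 3 pi / 2.\<close>

lemma conf_hyp_U_exists_Re_ge_1: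
  assumes a: "Re a \<ge> 1"
  shows "\<exists>h. kummer_solution a c h \<and> kummer_asymp a 1 h"
proof -
  obtain h where h: "kummer_solution a c h" and
    h_asymp: "\<And>\<delta>. \<delta> > 0 \<Longrightarrow> \<exists>K R. \<forall>w. Re w \<ge> R \<longrightarrow> \<bar>Im w + 0\<bar> \<le> pi / 2 - \<delta> \<longrightarrow>
       norm (exp (a * w) * h w - 1) \<le> K * exp (- Re w)"
    using kummer_ray_solution[OF a, of 0 c] by auto
  have ray: "\<exists>K R. \<forall>w. Re w \<ge> R \<longrightarrow> \<bar>Im w + \<phi>\<bar> \<le> pi / 2 - \<delta> \<longrightarrow>
       norm (exp (a * w) * h w - 1) \<le> K * exp (- Re w)" if \<phi>: "\<bar>\<phi>\<bar> < pi" and \<delta>: "\<delta> > 0" for \<phi> \<delta>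
  proof -
    obtain g where g: "kummer_solution a c g" and
      g_asymp: "\<And>\<delta>. \<delta> > 0 \<Longrightarrow> \<exists>K R. \<forall>w. Re w \<ge> R \<longrightarrow> \<bar>Im w + \<phi>\<bar> \<le> pi / 2 - \<delta> \<longrightarrow>
         norm (exp (a * w) * g w - 1) \<le> K * exp (- Re w)"
      using kummer_ray_solution[OF a \<phi>, of c] by auto
    \<comment> \<open>The comparison takes place around arg x = - \<phi> / 2, midway between the
      axes of the two half planes. The strip of half-width \<rho> about this direction lies in both
      with margin \<rho>, since \<rho> + |\<phi>| / 2 = pi / 2 - \<rho>.\<close>
    define \<rho> where "\<rho> = (pi - \<bar>\<phi>\<bar>) / 4"
    have \<rho>: "\<rho> > 0" using \<phi> by (simp add: \<rho>_def)
    obtain K R where K: "\<And>w. Re w \<ge> R \<Longrightarrow> \<bar>Im w + 0\<bar> \<le> pi / 2 - \<rho> \<Longrightarrow>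
       norm (exp (a * w) * h w - 1) \<le> K * exp (- Re w)"
      using h_asymp[OF \<rho>] by blast
    obtain K' R' where K': "\<And>w. Re w \<ge> R' \<Longrightarrow> \<bar>Im w + \<phi>\<bar> \<le> pi / 2 - \<rho> \<Longrightarrow>
       norm (exp (a * w) * g w - 1) \<le> K' * exp (- Re w)"
      using g_asymp[OF \<rho>] by blast
    have m: "K * exp (- Re w) \<le> max K K' * exp (- Re w)" "K' * exp (- Re w) \<le> max K K' * exp (- Re w)" for w
      by (auto intro: mult_right_mono)
    have "h w = 1 * g w" for w
    proof (rule kummer_strip_unique[OF h g, of "- \<phi> / 2" \<rho> "max R R'" 1 "max K K'"])
      fix w assume w: "Re w \<ge> max R R'" "\<bar>Im w - (- \<phi> / 2)\<bar> \<le> \<rho>"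
      have "\<bar>Im w\<bar> \<le> \<rho> + \<bar>\<phi>\<bar> / 2" "\<bar>Im w + \<phi>\<bar> \<le> \<rho> + \<bar>\<phi>\<bar> / 2"
        using w(2) by (auto simp: abs_if split: if_splits)
      then have "\<bar>Im w + 0\<bar> \<le> pi / 2 - \<rho>" "\<bar>Im w + \<phi>\<bar> \<le> pi / 2 - \<rho>"
        by (simp_all add: \<rho>_def field_simps)
      then show "norm (exp (a * w) * h w - 1) \<le> max K K' * exp (- Re w)"
        "norm (exp (a * w) * g w - 1) \<le> max K K' * exp (- Re w)"
        using order_trans[OF K m(1), of w] order_trans[OF K' m(2), of w] w(1) by auto
    qed (use \<phi> \<rho> in auto)
    then show ?thesis using g_asymp[OF \<delta>] by simp
  qed
  have "kummer_asymp a 1 h"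
  proof (rule kummer_asympI)
    fix \<delta>' :: real assume \<delta>': "\<delta>' > 0"
    define \<delta> where "\<delta> = min \<delta>' (pi / 2)"
    have \<delta>: "\<delta> > 0" "\<delta> \<le> pi / 2" "\<delta> \<le> \<delta>'" using \<delta>' by (auto simp: \<delta>_def)
    have "\<forall>\<phi>. \<exists>K R. \<bar>\<phi>\<bar> < pi \<longrightarrow> (\<forall>w. Re w \<ge> R \<longrightarrow> \<bar>Im w + \<phi>\<bar> \<le> pi / 2 - \<delta> / 2 \<longrightarrow>
       norm (exp (a * w) * h w - 1) \<le> K * exp (- Re w))"
    proof
      fix \<phi> :: real
      show "\<exists>K R. \<bar>\<phi>\<bar> < pi \<longrightarrow> (\<forall>w. Re w \<ge> R \<longrightarrow> \<bar>Im w + \<phi>\<bar> \<le> pi / 2 - \<delta> / 2 \<longrightarrow>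
         norm (exp (a * w) * h w - 1) \<le> K * exp (- Re w))"
        using ray[of \<phi> "\<delta> / 2"] \<delta>(1) by (cases "\<bar>\<phi>\<bar> < pi") simp_all
    qed
    then obtain K R where K: "\<And>\<phi> w. \<bar>\<phi>\<bar> < pi \<Longrightarrow> Re w \<ge> R \<phi> \<Longrightarrow> \<bar>Im w + \<phi>\<bar> \<le> pi / 2 - \<delta> / 2 \<Longrightarrow>
       norm (exp (a * w) * h w - 1) \<le> K \<phi> * exp (- Re w)"
      by metis
    \<comment> \<open>Finitely many angles, so that the constants have a maximum. Each covers a
      half-width pi / 2 - \<delta> / 2, and the extreme angles of modulus pi - \<delta> / 2 reach
      exactly to 3 pi / 2 - \<delta>.\<close>
    define F where "F = {0, pi / 2, - (pi / 2), pi - \<delta> / 2, - (pi - \<delta> / 2)}"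
    have F: "finite F" "F \<noteq> {}" by (auto simp: F_def)
    have "norm (exp (a * w) * h w - 1) \<le> Max (K ` F) * exp (- Re w)"
      if w: "Re w \<ge> Max (R ` F)" "\<bar>Im w\<bar> \<le> 3 * pi / 2 - \<delta>'" for w
    proof -
      have w': "\<bar>Im w\<bar> \<le> 3 * pi / 2 - \<delta>" using w \<delta> by simp
      have "\<exists>\<phi>\<in>F. \<bar>\<phi>\<bar> < pi \<and> \<bar>Im w + \<phi>\<bar> \<le> pi / 2 - \<delta> / 2"
      proof -
        consider "\<bar>Im w\<bar> \<le> pi / 2 - \<delta> / 2" | "Im w \<ge> pi / 2 - \<delta> / 2" "Im w \<le> pi / 2"
          | "Im w \<le> - (pi / 2 - \<delta> / 2)" "Im w \<ge> - (pi / 2)" | "Im w \<ge> pi / 2" | "Im w \<le> - (pi / 2)"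
          unfolding abs_le_iff by argo
        then show ?thesis
        proof cases
          case 1
          then have "\<bar>Im w + 0\<bar> \<le> pi / 2 - \<delta> / 2"
            using \<delta>(1,2) w' by (simp add: abs_le_iff)
          moreover have "\<bar>0\<bar> < pi"
            using \<delta>(1,2) pi_gt_zero by (simp add: abs_less_iff)
          moreover have "0 \<in> F" by (simp add: F_def)
          ultimately show ?thesis by blast
        next
          case 2
          then have "\<bar>Im w + (- (pi / 2))\<bar> \<le> pi / 2 - \<delta> / 2"
            using \<delta>(1,2) w' by (simp add: abs_le_iff)
          moreover have "\<bar>(- (pi / 2))\<bar> < pi"
            using \<delta>(1,2) pi_gt_zero by (simp add: abs_less_iff)
          moreover have "(- (pi / 2)) \<in> F" by (simp add: F_def)
          ultimately show ?thesis by blast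
        next
          case 3
          then have "\<bar>Im w + (pi / 2)\<bar> \<le> pi / 2 - \<delta> / 2"
            using \<delta>(1,2) w' by (simp add: abs_le_iff)
          moreover have "\<bar>(pi / 2)\<bar> < pi"
            using \<delta>(1,2) pi_gt_zero by (simp add: abs_less_iff)
          moreover have "(pi / 2) \<in> F" by (simp add: F_def)
          ultimately show ?thesis by blast
        next
          case 4
          then have "\<bar>Im w + (- (pi - \<delta> / 2))\<bar> \<le> pi / 2 - \<delta> / 2"
            using \<delta>(1,2) w' by (simp add: abs_le_iff)
          moreover have "\<bar>(- (pi - \<delta> / 2))\<bar> < pi"
            using \<delta>(1,2) pi_gt_zero by (simp add: abs_less_iff)
          moreover have "(- (pi - \<delta> / 2)) \<in> F" by (simp add: F_def)
          ultimately show ?thesis by blast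
        next
          case 5
          then have "\<bar>Im w + (pi - \<delta> / 2)\<bar> \<le> pi / 2 - \<delta> / 2"
            using \<delta>(1,2) w' by (simp add: abs_le_iff)
          moreover have "\<bar>(pi - \<delta> / 2)\<bar> < pi"
            using \<delta>(1,2) pi_gt_zero by (simp add: abs_less_iff)
          moreover have "(pi - \<delta> / 2) \<in> F" by (simp add: F_def)
          ultimately show ?thesis by blast
        qed
      qed
      then obtain \<phi> where \<phi>: "\<phi> \<in> F" "\<bar>\<phi>\<bar> < pi" "\<bar>Im w + \<phi>\<bar> \<le> pi / 2 - \<delta> / 2" by blast
      have "R \<phi> \<le> Max (R ` F)" using F \<phi>(1) by (intro Max_ge) auto
      then have "norm (exp (a * w) * h w - 1) \<le> K \<phi> * exp (- Re w)"
        using w by (intro K \<phi>) auto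
      also have "\<dots> \<le> Max (K ` F) * exp (- Re w)"
        using F \<phi>(1) by (intro mult_right_mono Max_ge) auto
      finally show ?thesis .
    qed
    then show "\<exists>C R. \<forall>w. Re w \<ge> R \<longrightarrow> \<bar>Im w\<bar> \<le> 3 * pi / 2 - \<delta>' \<longrightarrow>
       norm (exp (a * w) * h w - 1) \<le> C * exp (- Re w)" by blast
  qed
  then show ?thesis using h by blast
qed

text \<open>Lowering (a + 1, c + 1) to (a, c) preserves the leading coefficient 1, so existence
  descends from Re a \<ge> 1 to all a. The parameter c moves along, so the induction is over all c
  at once.\<close>

lemma conf_hyp_U_exists: "\<exists>h. kummer_solution a c h \<and> kummer_asymp a 1 h"
proof -
  have "\<exists>h. kummer_solution a c h \<and> kummer_asymp a 1 h" if "Re a \<ge> 1 - real n" for n a c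
    using that
  proof (induction n arbitrary: a c)
    case 0
    then show ?case by (intro conf_hyp_U_exists_Re_ge_1) auto
  next
    case (Suc n)
    then obtain h where h: "kummer_solution (a + 1) (c + 1) h" "kummer_asymp (a + 1) 1 h"
    proof -
      have "Re (a + 1) \<ge> 1 - real n" using Suc.prems by simp
      from Suc.IH[OF this, of "c + 1"] show ?thesis using that by blast
    qed
    then have "kummer_solution a c (\<lambda>w. (exp w - c) * h w - deriv h w)"
      unfolding kummer_solution_iff by (intro kummer_on_lower_a_c) auto
    moreover have "kummer_asymp a 1 (\<lambda>w. (exp w - c) * h w - deriv h w)"
      using h by (intro kummer_asymp_lower_a_c) (auto simp: kummer_solution_def)
    ultimately show ?case by blast
  qed
  moreover obtain n where "1 - Re a \<le> real n" using real_arch_simple by blast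
  ultimately show ?thesis by (metis diff_le_eq add.commute)
qed

lemma
  shows kummer_solution_conf_hyp_U: "kummer_solution a c (conf_hyp_U a c)"
    and kummer_asymp_conf_hyp_U: "kummer_asymp a 1 (conf_hyp_U a c)"
proof -
  obtain h where h: "kummer_solution a c h" "kummer_asymp a 1 h"
    using conf_hyp_U_exists by blast
  show "kummer_solution a c (conf_hyp_U a c)" "kummer_asymp a 1 (conf_hyp_U a c)"
    using h by (simp_all add: conf_hyp_U_eqI[OF h])
qed

section \<open>Contiguous relations and Kummer's transformation for psi\<close>

lemma conf_hyp_U_holomorphic: "conf_hyp_U a c holomorphic_on UNIV"
  using kummer_solution_conf_hyp_U[of a c] by (simp add: kummer_solution_def)

lemma conf_hyp_U_lower_a_c:
  "conf_hyp_U a c w = (exp w - c) * conf_hyp_U (a + 1) (c + 1) w - deriv (conf_hyp_U (a + 1) (c + 1)) w"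
proof -
  let ?g = "\<lambda>w. (exp w - c) * conf_hyp_U (a + 1) (c + 1) w - deriv (conf_hyp_U (a + 1) (c + 1)) w"
  have "kummer_solution a c ?g"
    using kummer_solution_conf_hyp_U[of "a + 1" "c + 1"]
    unfolding kummer_solution_iff by (intro kummer_on_lower_a_c) auto
  moreover have "kummer_asymp a 1 ?g"
    by (intro kummer_asymp_lower_a_c conf_hyp_U_holomorphic kummer_asymp_conf_hyp_U)
  ultimately have "conf_hyp_U a c = ?g" by (rule conf_hyp_U_eqI)
  then show ?thesis by (rule fun_cong)
qed

text \<open>The operator multiplies the leading coefficient by c - a. This factor stays on the left,
  so the case c = a is included, where both sides vanish.\<close>

lemma conf_hyp_U_lower_c:
  "(c - a) * conf_hyp_U a c w = c * conf_hyp_U a (c + 1) w + deriv (conf_hyp_U a (c + 1)) w"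
proof -
  let ?g = "\<lambda>w. c * conf_hyp_U a (c + 1) w + deriv (conf_hyp_U a (c + 1)) w"
  have "kummer_solution a c ?g"
    using kummer_solution_conf_hyp_U[of a "c + 1"]
    unfolding kummer_solution_iff by (intro kummer_on_lower_c) auto
  moreover have "kummer_asymp a ((c - a) * 1) ?g"
    by (intro kummer_asymp_lower_c conf_hyp_U_holomorphic kummer_asymp_conf_hyp_U)
  ultimately show ?thesis
    using kummer_asymp_unique[OF _ _ kummer_solution_conf_hyp_U kummer_asymp_conf_hyp_U] by simp
qed

text \<open>The factor x^(1-c) carries the equation for (a - c + 1, 2 - c) to the one for (a, c),
  and the normalisations agree because a + (1 - c) = a - c + 1.\<close>

lemma conf_hyp_U_kummer_transform:
  "conf_hyp_U a c w = exp ((1 - c) * w) * conf_hyp_U (a - c + 1) (2 - c) w"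
proof -
  define g where "g = conf_hyp_U (a - c + 1) (2 - c)"
  have g: "kummer_on (a - c + 1) (2 - c) UNIV g"
    unfolding g_def using kummer_solution_conf_hyp_U by (simp add: kummer_solution_iff)
  have "kummer_solution a c (\<lambda>w. exp ((1 - c) * w) * g w)"
    unfolding kummer_solution_iff
  proof (rule kummer_onI[OF open_UNIV])
    fix w :: complex
    note D = kummer_onD[OF g open_UNIV UNIV_I, of w]
    show "((\<lambda>w. exp ((1 - c) * w) * g w) has_field_derivative exp ((1 - c) * w) * ((1 - c) * g w + deriv g w)) (at w)"
      by (rule derivative_eq_intros D refl)+ (simp add: algebra_simps)
    show "((\<lambda>w. exp ((1 - c) * w) * ((1 - c) * g w + deriv g w)) has_field_derivative
       exp ((1 - c) * w) * ((1 - c) * ((1 - c) * g w + deriv g w) + ((1 - c) * deriv g w + deriv (deriv g) w))) (at w)"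
      by (rule derivative_eq_intros D refl)+ (simp add: algebra_simps)
    show "exp ((1 - c) * w) * ((1 - c) * ((1 - c) * g w + deriv g w) + ((1 - c) * deriv g w + deriv (deriv g) w)) =
       (exp w + 1 - c) * (exp ((1 - c) * w) * ((1 - c) * g w + deriv g w)) + a * exp w * (exp ((1 - c) * w) * g w)"
      unfolding D(3) by (simp add: algebra_simps)
  qed
  moreover have "kummer_asymp a 1 (\<lambda>w. exp ((1 - c) * w) * g w)"
  proof -
    have e: "exp (a * w) * (exp ((1 - c) * w) * g w) = exp ((a - c + 1) * w) * g w" for w
      by (simp add: algebra_simps flip: exp_add)
    show ?thesis
      using kummer_asymp_conf_hyp_U[of "a - c + 1" "2 - c", folded g_def] unfolding kummer_asymp_def e .
  qed
  ultimately have "conf_hyp_U a c = (\<lambda>w. exp ((1 - c) * w) * g w)" by (rule conf_hyp_U_eqI)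
  then show ?thesis by (simp add: g_def)
qed

section \<open>Connection formulas\<close>

text \<open>For r < 1 the assumption Re b \<ge> 2 bounds (1 - t)^(b-2) by 1 in the mean value
  inequality. For r \<ge> 1 the truncated kernel is 0, and r^(a-1) is itself no larger than r^a in
  modulus.\<close>

lemma unit_interval_kernel_watson:
  assumes b: "Re b \<ge> 2" and r: "r > 0"
  shows "norm (euler_kernel a b (- 1) 1 r - euler_kernel a 1 1 \<infinity> r) \<le> (norm (b - 1) + 1) * exp r * exp (Re a * ln r)"
proof (cases "r < 1")
  case False
  then have "norm (euler_kernel a b (- 1) 1 r - euler_kernel a 1 1 \<infinity> r) = exp ((Re a - 1) * ln r)"
    by (simp add: euler_kernel_def one_ereal_def)
  also have "\<dots> \<le> 1 * 1 * exp (Re a * ln r)"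
    using False by (simp add: left_diff_distrib)
  also have "\<dots> \<le> (norm (b - 1) + 1) * exp r * exp (Re a * ln r)"
    using r by (intro mult_right_mono mult_mono) auto
  finally show ?thesis .
next
  case True
  define f where "f = exp ((b - 1) * Ln (1 + (- 1) * of_real r))"
  have L: "Ln (1 + (- 1) * of_real t) = of_real (ln (1 - t))" if "t \<le> r" for t
    using Ln_of_real[of "1 - t"] True that by simp
  have f: "norm (f - 1) \<le> norm (b - 1) * 1 * r"
    unfolding f_def
  proof (rule unit_ray_power_minus_1[OF _ r])
    fix t assume t: "0 \<le> t" "t \<le> r"
    show "1 + (- 1) * complex_of_real t \<notin> \<real>\<^sub>\<le>\<^sub>0" using t True by (auto simp: complex_nonpos_Reals_iff)
    show "norm (exp ((b - 2) * Ln (1 + (- 1) * of_real t))) \<le> 1"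
      unfolding L[OF t(2)] using b t True by (auto intro!: mult_nonneg_nonpos)
  qed auto
  have "euler_kernel a b (- 1) 1 r - euler_kernel a 1 1 \<infinity> r = exp ((a - 1) * of_real (ln r)) * (f - 1)"
    using r True by (simp add: euler_kernel_def f_def one_ereal_def algebra_simps)
  then have "norm (euler_kernel a b (- 1) 1 r - euler_kernel a 1 1 \<infinity> r) = exp ((Re a - 1) * ln r) * norm (f - 1)"
    by (simp add: norm_mult)
  also have "\<dots> \<le> exp ((Re a - 1) * ln r) * (norm (b - 1) * 1 * r)"
    by (intro mult_left_mono f) auto
  also have "\<dots> = norm (b - 1) * 1 * exp (Re a * ln r)"
    using r by (simp add: left_diff_distrib exp_diff)
  also have "\<dots> \<le> (norm (b - 1) + 1) * exp r * exp (Re a * ln r)"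
    using r by (intro mult_right_mono mult_mono) auto
  finally show ?thesis .
qed

text \<open>Substitution of 1 - r for r. In terms of M this is Kummer's relation M(a, c, x) = e^x
  M(c - a, c, - x).\<close>

lemma laplace_euler_kernel_reflect:
  "laplace (euler_kernel a b (- 1) 1) (- X) = exp X * laplace (euler_kernel b a (- 1) 1) X"
proof -
  have k: "euler_kernel a b (- 1) 1 (1 + (- 1) * r) = euler_kernel b a (- 1) 1 r" for r
  proof (cases "0 < r \<and> r < 1")
    case True
    have "Ln (of_real r) = of_real (ln r)" "Ln (1 - of_real r) = of_real (ln (1 - r))"
      using Ln_of_real[of "1 - r"] Ln_of_real[of r] True by simp_all
    then show ?thesis using True by (simp add: euler_kernel_def one_ereal_def)
  qed (auto simp: euler_kernel_def one_ereal_def)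
  have "laplace (euler_kernel a b (- 1) 1) (- X) =
     (LBINT r. exp (X * of_real (1 + (- 1) * r)) * euler_kernel a b (- 1) 1 (1 + (- 1) * r))"
    unfolding laplace_def
    using lborel_integral_real_affine[of "- 1" "\<lambda>r. exp (X * of_real r) * euler_kernel a b (- 1) 1 r" 1] by simp
  also have "\<dots> = (LBINT r. exp X * (exp (- X * of_real r) * euler_kernel b a (- 1) 1 r))"
    unfolding k by (intro Bochner_Integration.integral_cong) (auto simp: algebra_simps exp_add exp_diff exp_minus divide_inverse)
  also have "\<dots> = exp X * laplace (euler_kernel b a (- 1) 1) X"
    unfolding laplace_def by (rule integral_mult_right_zero)
  finally show ?thesis .
qed

lemma laplace_unit_interval_tendsto:
  assumes "Re a \<ge> 1" "Re b \<ge> 2"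
  shows "((\<lambda>t. exp (a * of_real t) * laplace (euler_kernel a b (- 1) 1) (exp (of_real t))) \<longlongrightarrow> Gamma a) at_top"
proof -
  have Ga: "Gamma a \<noteq> 0" using assms by (auto simp: Gamma_eq_zero_iff elim!: nonpos_Ints_cases)
  have k: "exp_order 0 (euler_kernel a b (- 1) 1)"
    using assms by (intro exp_order_euler_kernel_unit_interval) auto
  have "pi / 4 > 0" by simp
  obtain K R where K: "\<And>z. Re z \<ge> R \<Longrightarrow> \<bar>Im z\<bar> \<le> pi / 2 - pi / 4 \<Longrightarrow>
       norm (exp (a * z) * laplace (euler_kernel a b (- 1) 1) (exp z) / Gamma a - 1) \<le> K * exp (- Re z)"
    using laplace_watson_sector[OF assms(1) k _ unit_interval_kernel_watson[OF assms(2)] \<open>pi / 4 > 0\<close>] by auto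
  have "((\<lambda>t. exp (a * of_real t) * laplace (euler_kernel a b (- 1) 1) (exp (of_real t)) / Gamma a) \<longlongrightarrow> 1) at_top"
    by (rule tendsto_of_exp_bound[of R _ _ K]) (use K[of "of_real _"] in simp)
  from tendsto_mult_right[OF this, of "Gamma a"] show ?thesis using Ga by simp
qed

text \<open>If y solves the equation for c - a, then e^x y(- x) solves it for a. On the covering the
  change of sign is the choice of a logarithm s of - 1; both i pi and - i pi are used.\<close>

lemma kummer_solution_exp_shift:
  assumes "kummer_solution (c - a) c g" and s: "exp s = - 1"
  shows "kummer_solution a c (\<lambda>w. exp (exp w) * g (w + s))"
  unfolding kummer_solution_iff
proof (rule kummer_onI[OF open_UNIV])
  fix w :: complex
  have g: "kummer_on (c - a) c UNIV g" using assms(1) by (simp add: kummer_solution_iff)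
  have s': "exp (w + s) = - exp w" by (simp add: exp_add s)
  note D = kummer_onD[OF g open_UNIV UNIV_I]
  have sh: "((\<lambda>w. w + s) has_field_derivative 1) (at w)"
    by (auto intro!: derivative_eq_intros)
  note D0 = DERIV_chain2[OF D(1) sh, simplified] and D1 = DERIV_chain2[OF D(2) sh, simplified]
  show "((\<lambda>w. exp (exp w) * g (w + s)) has_field_derivative
      exp (exp w) * (exp w * g (w + s) + deriv g (w + s))) (at w)"
    by (rule derivative_eq_intros D0 refl)+ (simp add: algebra_simps)
  show "((\<lambda>w. exp (exp w) * (exp w * g (w + s) + deriv g (w + s))) has_field_derivative
      exp (exp w) * (exp w * (exp w * g (w + s) + deriv g (w + s)) + exp w * g (w + s) + exp w * deriv g (w + s) + deriv (deriv g) (w + s))) (at w)"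
    by (rule derivative_eq_intros D0 D1 refl)+ (simp add: algebra_simps)
  show "exp (exp w) * (exp w * (exp w * g (w + s) + deriv g (w + s)) + exp w * g (w + s) + exp w * deriv g (w + s) + deriv (deriv g) (w + s)) =
     (exp w + 1 - c) * (exp (exp w) * (exp w * g (w + s) + deriv g (w + s))) + a * exp w * (exp (exp w) * g (w + s))"
    unfolding D(3)[of "w + s"] s' by (simp add: algebra_simps)
qed

lemma double_exp_decay: "((\<lambda>t. exp (\<kappa> * of_real t) * exp (- exp (complex_of_real t))) \<longlongrightarrow> 0) at_top"
proof (rule tendsto_norm_zero_cancel)
  have "((\<lambda>t. inverse (exp (1 * exp t + (- Re \<kappa>) * t))) \<longlongrightarrow> 0) at_top"
    by (rule tendsto_inverse_0_at_top[OF filterlim_exp_exp]) simp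
  moreover have "norm (exp (\<kappa> * of_real t) * exp (- exp (complex_of_real t))) = inverse (exp (1 * exp t + (- Re \<kappa>) * t))" for t
    by (simp add: norm_mult Re_exp exp_minus[symmetric] flip: exp_add)
  ultimately show "((\<lambda>t. norm (exp (\<kappa> * of_real t) * exp (- exp (complex_of_real t)))) \<longlongrightarrow> 0) at_top"
    by simp
qed

text \<open>On the positive axis the derivative of the factor e^x dominates: with b = c - a, the
  Wronskian multiplied by e^(-x) x^(-1) x^a (x e^s)^b tends to 1, whereas a vanishing constant in
  Abel's formula would make it 0.\<close>

lemma wronskian_conf_hyp_U_nonzero:
  assumes s: "s = \<i> * of_real pi \<or> s = - (\<i> * of_real pi)"
  shows "wronskian (conf_hyp_U a c) (\<lambda>w. exp (exp w) * conf_hyp_U (c - a) c (w + s)) w \<noteq> 0"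
proof -
  define b where "b = c - a"
  define U where "U = conf_hyp_U a c"
  define V where "V = conf_hyp_U b c"
  define E where "E = (\<lambda>w. exp (exp w) * V (w + s))"
  have s1: "exp s = - 1" using s by (auto simp: exp_minus mult.commute[of \<i>])
  have hU: "kummer_on a c UNIV U" unfolding U_def using kummer_solution_conf_hyp_U by (simp add: kummer_solution_iff)
  have hE: "kummer_on a c UNIV E" unfolding E_def V_def b_def
    using kummer_solution_exp_shift[OF kummer_solution_conf_hyp_U s1] by (simp add: kummer_solution_iff)
  have dV: "(V has_field_derivative deriv V w) (at w)" for w
    unfolding V_def using holomorphic_derivI[OF conf_hyp_U_holomorphic open_UNIV] by simp
  have dE: "deriv E w = exp (exp w) * (exp w * V (w + s) + deriv V (w + s))" for w
  proof -
    have "((\<lambda>w. w + s) has_field_derivative 1) (at w)"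
      by (auto intro!: derivative_eq_intros)
    note D0 = DERIV_chain2[OF dV this, simplified]
    show ?thesis unfolding E_def
      by (rule DERIV_imp_deriv) (rule derivative_eq_intros D0 refl | simp add: algebra_simps)+
  qed
  obtain D where "\<And>w. w \<in> UNIV \<Longrightarrow> wronskian U E w = D * exp (exp w - (c - 1) * w)"
    using kummer_wronskian[OF open_UNIV connected_UNIV hU hE] by blast
  note D = this[OF UNIV_I]
  have "D \<noteq> 0"
  proof
    assume "D = 0"
    have y: "\<bar>0\<bar> < 3 * pi / 2" "\<bar>Im s\<bar> < 3 * pi / 2" "s = \<i> * of_real (Im s)"
      using s by auto
    have lim: "((\<lambda>t. exp (a * of_real t) * U (of_real t)) \<longlongrightarrow> 1) at_top"
        "((\<lambda>t. exp (a * of_real t) * deriv U (of_real t)) \<longlongrightarrow> - a * 1) at_top"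
        "((\<lambda>t. exp (b * (of_real t + s)) * V (of_real t + s)) \<longlongrightarrow> 1) at_top"
        "((\<lambda>t. exp (b * (of_real t + s)) * deriv V (of_real t + s)) \<longlongrightarrow> - b * 1) at_top"
      using kummer_asymp_tendsto[OF conf_hyp_U_holomorphic kummer_asymp_conf_hyp_U y(1), of a c]
        kummer_asymp_tendsto[OF conf_hyp_U_holomorphic kummer_asymp_conf_hyp_U y(2), of b c]
      unfolding U_def V_def y(3)[symmetric] by simp_all
    have e: "((\<lambda>t. exp (- of_real t :: complex)) \<longlongrightarrow> 0) at_top"
      by (rule tendsto_of_exp_bound[of 0 _ _ 1]) simp
    let ?A = "\<lambda>t. (exp (a * of_real t) * U (of_real t)) * (exp (b * (of_real t + s)) * V (of_real t + s))
       + exp (- of_real t) * ((exp (a * of_real t) * U (of_real t)) * (exp (b * (of_real t + s)) * deriv V (of_real t + s))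
           - (exp (a * of_real t) * deriv U (of_real t)) * (exp (b * (of_real t + s)) * V (of_real t + s)))"
    have "(?A \<longlongrightarrow> 1 * 1 + 0 * (1 * (- b * 1) - (- a * 1) * 1)) at_top"
      by (rule tendsto_add[OF tendsto_mult[OF lim(1) lim(3)]
            tendsto_mult[OF e tendsto_diff[OF tendsto_mult[OF lim(1) lim(4)] tendsto_mult[OF lim(2) lim(3)]]]])
    moreover have "?A t = 0" for t
    proof -
      have "U (of_real t) * (exp (of_real t) * V (of_real t + s) + deriv V (of_real t + s)) - deriv U (of_real t) * V (of_real t + s) = 0"
      proof -
        have "exp (exp (of_real t)) * (U (of_real t) * (exp (of_real t) * V (of_real t + s) + deriv V (of_real t + s)) - deriv U (of_real t) * V (of_real t + s))
          = wronskian U E (of_real t)"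
          by (simp add: wronskian_def dE) (simp add: E_def algebra_simps)
        also have "\<dots> = 0" by (simp add: D \<open>D = 0\<close>)
        finally show ?thesis by simp
      qed
      moreover have "?A t = exp (- of_real t) * exp (a * of_real t) * exp (b * (of_real t + s)) *
          (U (of_real t) * (exp (of_real t) * V (of_real t + s) + deriv V (of_real t + s)) - deriv U (of_real t) * V (of_real t + s))"
      proof -
        have "exp (- of_real t) * exp (complex_of_real t) = 1" by (simp flip: exp_add)
        then show ?thesis by (simp add: algebra_simps)
      qed
      ultimately show ?thesis by simp
    qed
    ultimately have "((\<lambda>t::real. 0::complex) \<longlongrightarrow> 1) at_top" by simp
    then show False using tendsto_unique[OF trivial_limit_at_top_linorder tendsto_const] by force
  qed
  then show ?thesis using D[of w] by (simp add: U_def E_def V_def b_def)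
qed

text \<open>The function \<open>H\<close> is \<open>M(a, c, x) / \<Gamma>(c)\<close> in terms of Kummer's first solution \<open>M\<close>.\<close>

definition kummer_connection :: "complex \<Rightarrow> complex \<Rightarrow> (complex \<Rightarrow> complex) \<Rightarrow> bool" where
  "kummer_connection a c H \<longleftrightarrow> H holomorphic_on UNIV \<and>
     (\<forall>w. \<forall>s\<in>{\<i> * of_real pi, - (\<i> * of_real pi)}.
        H (exp w) = exp (- (s * a)) * rGamma (c - a) * conf_hyp_U a c w
          + exp (s * (c - a)) * rGamma a * (exp (exp w) * conf_hyp_U (c - a) c (w + s)))"

text \<open>On each real half-axis one of the two basis solutions is negligible against the other.
  Watson's lemma is applied to the Euler integral and to its reflection, which exchanges a and c -
  a; hence the same lower bound on both real parts.\<close>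

lemma kummer_connection_base:
  assumes a: "Re a \<ge> 2" and b: "Re (c - a) \<ge> 2"
  shows "\<exists>H. kummer_connection a c H"
proof -
  define b where "b = c - a"
  have c: "a + b = c" by (simp add: b_def)
  have a1: "Re a \<ge> 1" and b1: "Re b \<ge> 1" using a b by (auto simp: b_def)
  have Gb: "Gamma b \<noteq> 0" "Gamma a \<noteq> 0"
    using a1 b1 by (auto simp: Gamma_eq_zero_iff elim!: nonpos_Ints_cases)
  define H where "H = (\<lambda>x. rGamma a * rGamma b * laplace (euler_kernel a b (- 1) 1) (- x))"
  define F where "F = (\<lambda>w. laplace (euler_kernel a b (- 1) 1) (- exp w))"
  have hF: "kummer_on a c UNIV F"
    using kummer_solution_laplace_unit_interval[OF a1 b1] unfolding F_def c kummer_solution_iff .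
  have hU: "kummer_on a c UNIV (conf_hyp_U a c)"
    using kummer_solution_conf_hyp_U by (simp add: kummer_solution_iff)
  have "H holomorphic_on UNIV"
  proof -
    have "(laplace (euler_kernel a b (- 1) 1) has_field_derivative
        laplace (\<lambda>r. - of_real r * euler_kernel a b (- 1) 1 r) X) (at X)" for X
      by (rule laplace_has_derivative[OF exp_order_euler_kernel_unit_interval[OF a1 b1, of "Re X - 1"]]) simp
    then have "laplace (euler_kernel a b (- 1) 1) holomorphic_on UNIV"
      by (auto simp: holomorphic_on_open)
    then have "laplace (euler_kernel a b (- 1) 1) \<circ> uminus holomorphic_on UNIV"
      by (intro holomorphic_on_compose_gen[of _ _ _ UNIV] holomorphic_intros) auto
    then show ?thesis unfolding H_def o_def by (intro holomorphic_intros)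
  qed
  moreover have "H (exp w) = exp (- (s * a)) * rGamma (c - a) * conf_hyp_U a c w
          + exp (s * (c - a)) * rGamma a * (exp (exp w) * conf_hyp_U (c - a) c (w + s))"
    if "s \<in> {\<i> * of_real pi, - (\<i> * of_real pi)}" for s w
  proof -
    have s: "s = \<i> * of_real pi \<or> s = - (\<i> * of_real pi)" using that by auto
    have s1: "exp s = - 1" using s by (auto simp: exp_minus mult.commute[of \<i>])
    define E where "E = (\<lambda>w. exp (exp w) * conf_hyp_U b c (w + s))"
    have hE: "kummer_on a c UNIV E" unfolding E_def b_def
      using kummer_solution_exp_shift[OF kummer_solution_conf_hyp_U s1] by (simp add: kummer_solution_iff)
    have "wronskian (conf_hyp_U a c) E 0 \<noteq> 0"
      unfolding E_def b_def by (rule wronskian_conf_hyp_U_nonzero[OF s])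
    then obtain p q where "\<And>w. w \<in> UNIV \<Longrightarrow> F w = p * conf_hyp_U a c w + q * E w"
      using kummer_span[OF open_UNIV connected_UNIV hU hE hF UNIV_I] by blast
    note pq = this[OF UNIV_I]
    have y: "\<bar>0\<bar> < 3 * pi / 2" "\<bar>Im s\<bar> < 3 * pi / 2" "\<bar>Im (- s)\<bar> < 3 * pi / 2"
        "\<i> * of_real (Im s) = s" "\<i> * of_real (Im (- s)) = - s"
      using s by auto
    have limU: "((\<lambda>t. exp (a * of_real t) * conf_hyp_U a c (of_real t)) \<longlongrightarrow> 1) at_top"
        "((\<lambda>t. exp (a * (of_real t + - s)) * conf_hyp_U a c (of_real t + - s)) \<longlongrightarrow> 1) at_top"
      using kummer_asymp_tendsto(1)[OF conf_hyp_U_holomorphic kummer_asymp_conf_hyp_U y(1), of a c]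
        kummer_asymp_tendsto(1)[OF conf_hyp_U_holomorphic kummer_asymp_conf_hyp_U y(3), of a c]
      unfolding y by simp_all
    have limV: "((\<lambda>t. exp (b * of_real t) * conf_hyp_U b c (of_real t)) \<longlongrightarrow> 1) at_top"
        "((\<lambda>t. exp (b * (of_real t + s)) * conf_hyp_U b c (of_real t + s)) \<longlongrightarrow> 1) at_top"
      using kummer_asymp_tendsto(1)[OF conf_hyp_U_holomorphic kummer_asymp_conf_hyp_U y(1), of b c]
        kummer_asymp_tendsto(1)[OF conf_hyp_U_holomorphic kummer_asymp_conf_hyp_U y(2), of b c]
      unfolding y by simp_all
    \<comment> \<open>Along the positive axis, after division by e^x, the term with \<open>p\<close>
      dies doubly exponentially, and the reflected integral supplies the limit Gamma(b).\<close>
    have "q * exp (- (s * b)) = Gamma b"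
    proof (rule tendsto_unique[OF trivial_limit_at_top_linorder])
      show "((\<lambda>t. exp (b * of_real t) * laplace (euler_kernel b a (- 1) 1) (exp (of_real t))) \<longlongrightarrow> Gamma b) at_top"
        by (rule laplace_unit_interval_tendsto[OF b1 a])
      have "((\<lambda>t. p * ((exp ((b - a) * of_real t) * exp (- exp (complex_of_real t))) * (exp (a * of_real t) * conf_hyp_U a c (of_real t)))
          + q * exp (- (s * b)) * (exp (b * (of_real t + s)) * conf_hyp_U b c (of_real t + s)))
          \<longlongrightarrow> p * (0 * 1) + q * exp (- (s * b)) * 1) at_top"
        by (rule tendsto_add[OF tendsto_mult[OF tendsto_const tendsto_mult[OF double_exp_decay limU(1)]]
              tendsto_mult[OF tendsto_const limV(2)]])
      moreover have "p * ((exp ((b - a) * of_real t) * exp (- exp (complex_of_real t))) * (exp (a * of_real t) * conf_hyp_U a c (of_real t)))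
          + q * exp (- (s * b)) * (exp (b * (of_real t + s)) * conf_hyp_U b c (of_real t + s)) =
          exp (b * of_real t) * laplace (euler_kernel b a (- 1) 1) (exp (of_real t))" for t
      proof -
        have e1: "exp ((b - a) * of_real t) * exp (a * of_real t) = exp (b * of_real t)"
          "exp (- (s * b)) * exp (b * (of_real t + s)) = exp (b * of_real t)"
          by (simp_all add: algebra_simps flip: exp_add)
        have e2: "exp (- exp (complex_of_real t)) * exp (exp (complex_of_real t)) = 1"
          by (simp flip: exp_add)
        have "laplace (euler_kernel b a (- 1) 1) (exp (of_real t)) = exp (- exp (of_real t)) * F (of_real t)"
          unfolding F_def laplace_euler_kernel_reflect using e2 by (simp flip: mult.assoc)
        also have "\<dots> = exp (- exp (of_real t)) * (p * conf_hyp_U a c (of_real t)) + q * (exp (- exp (complex_of_real t)) * exp (exp (complex_of_real t))) * conf_hyp_U b c (of_real t + s)"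
          unfolding pq E_def by (simp add: algebra_simps)
        finally have "exp (b * of_real t) * laplace (euler_kernel b a (- 1) 1) (exp (of_real t)) =
            p * exp (- exp (of_real t)) * exp (b * of_real t) * conf_hyp_U a c (of_real t) + q * exp (b * of_real t) * conf_hyp_U b c (of_real t + s)"
          unfolding e2 by (simp add: algebra_simps)
        also have "p * exp (- exp (complex_of_real t)) * exp (b * of_real t) * conf_hyp_U a c (of_real t) =
            p * exp (- exp (complex_of_real t)) * (exp ((b - a) * of_real t) * exp (a * of_real t)) * conf_hyp_U a c (of_real t)"
          unfolding e1 ..
        also have "q * exp (b * of_real t) * conf_hyp_U b c (of_real t + s) =
            q * (exp (- (s * b)) * exp (b * (of_real t + s))) * conf_hyp_U b c (of_real t + s)"
          unfolding e1 ..
        finally show ?thesis by (simp add: mult_ac)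
      qed
      ultimately show "((\<lambda>t. exp (b * of_real t) * laplace (euler_kernel b a (- 1) 1) (exp (of_real t))) \<longlongrightarrow> q * exp (- (s * b))) at_top"
        by simp
    qed
    then have q: "q = Gamma b * exp (s * b)"
      by (metis exp_minus_inverse mult.assoc mult.commute mult.right_neutral)
    \<comment> \<open>The point w = t - s lies over x = - e^t. There the factor e^x of
      \<open>E\<close> is negligible, while its psi is evaluated back on the positive axis.\<close>
    have "p * exp (a * s) = Gamma a"
    proof (rule tendsto_unique[OF trivial_limit_at_top_linorder])
      show "((\<lambda>t. exp (a * of_real t) * laplace (euler_kernel a b (- 1) 1) (exp (of_real t))) \<longlongrightarrow> Gamma a) at_top"
        using laplace_unit_interval_tendsto[OF a1] b by (simp add: b_def)
      have "((\<lambda>t. p * exp (a * s) * (exp (a * (of_real t + - s)) * conf_hyp_U a c (of_real t + - s))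
          + q * ((exp ((a - b) * of_real t) * exp (- exp (complex_of_real t))) * (exp (b * of_real t) * conf_hyp_U b c (of_real t))))
          \<longlongrightarrow> p * exp (a * s) * 1 + q * (0 * 1)) at_top"
        by (rule tendsto_add[OF tendsto_mult[OF tendsto_const limU(2)]
              tendsto_mult[OF tendsto_const tendsto_mult[OF double_exp_decay limV(1)]]])
      moreover have "p * exp (a * s) * (exp (a * (of_real t + - s)) * conf_hyp_U a c (of_real t + - s))
          + q * ((exp ((a - b) * of_real t) * exp (- exp (complex_of_real t))) * (exp (b * of_real t) * conf_hyp_U b c (of_real t))) =
          exp (a * of_real t) * laplace (euler_kernel a b (- 1) 1) (exp (of_real t))" for t
      proof -
        have e1: "exp ((a - b) * of_real t) * exp (b * of_real t) = exp (a * of_real t)"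
          "exp (a * s) * exp (a * (of_real t + - s)) = exp (a * of_real t)"
          by (simp_all add: algebra_simps flip: exp_add)
        have e3: "exp (of_real t + - s) = - exp (of_real t)"
          by (simp add: exp_diff s1)
        have "laplace (euler_kernel a b (- 1) 1) (exp (of_real t)) = F (of_real t + - s)"
          unfolding F_def e3 by simp
        also have "\<dots> = p * conf_hyp_U a c (of_real t + - s) + q * (exp (- exp (of_real t)) * conf_hyp_U b c (of_real t))"
          unfolding pq E_def e3 by simp
        finally have "exp (a * of_real t) * laplace (euler_kernel a b (- 1) 1) (exp (of_real t)) =
            p * exp (a * of_real t) * conf_hyp_U a c (of_real t + - s) + q * exp (a * of_real t) * (exp (- exp (of_real t)) * conf_hyp_U b c (of_real t))"
          by (simp add: algebra_simps)
        also have "p * exp (a * of_real t) * conf_hyp_U a c (of_real t + - s) =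
            p * (exp (a * s) * exp (a * (of_real t + - s))) * conf_hyp_U a c (of_real t + - s)"
          unfolding e1 ..
        also have "q * exp (a * of_real t) * (exp (- exp (complex_of_real t)) * conf_hyp_U b c (of_real t)) =
            q * (exp ((a - b) * of_real t) * exp (b * of_real t)) * (exp (- exp (complex_of_real t)) * conf_hyp_U b c (of_real t))"
          unfolding e1 ..
        finally show ?thesis by (simp add: mult_ac)
      qed
      ultimately show "((\<lambda>t. exp (a * of_real t) * laplace (euler_kernel a b (- 1) 1) (exp (of_real t))) \<longlongrightarrow> p * exp (a * s)) at_top"
        by simp
    qed
    then have p: "p = Gamma a * exp (- (s * a))"
      by (metis exp_minus_inverse mult.assoc mult.commute mult.right_neutral)
    have r: "rGamma a * Gamma a = 1" "rGamma b * Gamma b = 1"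
      using Gb by (auto simp: rGamma_inverse_Gamma)
    have "H (exp w) = rGamma a * rGamma b * (p * conf_hyp_U a c w + q * E w)"
      unfolding H_def pq[symmetric] F_def ..
    also have "\<dots> = (rGamma a * Gamma a) * (exp (- (s * a)) * rGamma b * conf_hyp_U a c w)
       + (rGamma b * Gamma b) * (exp (s * b) * rGamma a * E w)"
      unfolding p q by (simp add: algebra_simps)
    finally have "H (exp w) = exp (- (s * a)) * rGamma b * conf_hyp_U a c w + exp (s * b) * rGamma a * E w"
      unfolding r mult_1_left .
    then show ?thesis by (simp only: E_def b_def)
  qed
  ultimately show ?thesis unfolding kummer_connection_def by blast
qed

section \<open>Transport of the connection formulas to all parameters\<close>

lemma deriv_connection:
  fixes p q s :: complex
  assumes h: "H holomorphic_on UNIV" and U: "U holomorphic_on UNIV" and V: "V holomorphic_on UNIV"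
    and eq: "\<And>w. H (exp w) = p * U w + q * (exp (exp w) * V (w + s))"
  shows "exp w * deriv H (exp w) = p * deriv U w + q * (exp (exp w) * (exp w * V (w + s) + deriv V (w + s)))"
proof -
  note d = holomorphic_derivI[OF _ open_UNIV UNIV_I]
  have "((\<lambda>w. w + s) has_field_derivative 1) (at w)"
    by (auto intro!: derivative_eq_intros)
  note V' = DERIV_chain2[OF d[OF V] this, simplified]
  have "((\<lambda>w. H (exp w)) has_field_derivative deriv H (exp w) * exp w) (at w)"
    by (rule DERIV_chain2[OF d[OF h] DERIV_exp])
  moreover have "((\<lambda>w. p * U w + q * (exp (exp w) * V (w + s))) has_field_derivative
       p * deriv U w + q * (exp (exp w) * (exp w * V (w + s) + deriv V (w + s)))) (at w)"
    by (rule derivative_eq_intros d[OF U] V' refl)+ (simp add: algebra_simps)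
  ultimately have "deriv H (exp w) * exp w = p * deriv U w + q * (exp (exp w) * (exp w * V (w + s) + deriv V (w + s)))"
    unfolding eq by (rule DERIV_unique)
  then show ?thesis by (simp only: mult.commute)
qed

text \<open>The operator lowers both parameters of the first solution. The second one keeps its
  first parameter c - a and is lowered only in c, at the price of a factor a that turns 1 / Gamma(a
  + 1) into 1 / Gamma(a). The minus sign in front compensates e^(-s) = - 1.\<close>

lemma kummer_connection_lower_a_c:
  assumes "kummer_connection (a + 1) (c + 1) H"
  shows "kummer_connection a c (\<lambda>x. - ((x - c) * H x - x * deriv H x))"
  unfolding kummer_connection_def
proof (intro conjI allI ballI)
  have h: "H holomorphic_on UNIV" using assms by (simp add: kummer_connection_def)
  show "(\<lambda>x. - ((x - c) * H x - x * deriv H x)) holomorphic_on UNIV"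
    by (intro holomorphic_intros h holomorphic_deriv) auto
  fix w s :: complex assume s: "s \<in> {\<i> * of_real pi, - (\<i> * of_real pi)}"
  then have s1: "exp (- s) = - 1" by (auto simp: exp_minus mult.commute[of \<i>])
  define U where "U = conf_hyp_U (a + 1) (c + 1)"
  define V where "V = conf_hyp_U (c - a) (c + 1)"
  define p where "p = exp (- (s * (a + 1))) * rGamma (c - a)"
  define q where "q = exp (s * (c - a)) * rGamma (a + 1)"
  have c1: "c + 1 - (a + 1) = c - a" by simp
  have eq: "H (exp w) = p * U w + q * (exp (exp w) * V (w + s))" for w
    using assms s unfolding kummer_connection_def U_def V_def p_def q_def c1 by blast
  have d: "exp w * deriv H (exp w) = p * deriv U w + q * (exp (exp w) * (exp w * V (w + s) + deriv V (w + s)))"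
    by (rule deriv_connection[OF h _ _ eq]) (simp_all add: U_def V_def conf_hyp_U_holomorphic)
  have U: "(exp w - c) * U w - deriv U w = conf_hyp_U a c w"
    unfolding U_def by (rule conf_hyp_U_lower_a_c[symmetric])
  have V: "c * V (w + s) + deriv V (w + s) = a * conf_hyp_U (c - a) c (w + s)"
    using conf_hyp_U_lower_c[of c "c - a" "w + s"] by (simp add: V_def)
  have "- ((exp w - c) * H (exp w) - exp w * deriv H (exp w)) =
      - p * ((exp w - c) * U w - deriv U w) + q * (exp (exp w) * (c * V (w + s) + deriv V (w + s)))"
    unfolding d eq by (simp add: algebra_simps)
  also have "\<dots> = - p * conf_hyp_U a c w + q * a * (exp (exp w) * conf_hyp_U (c - a) c (w + s))"
    unfolding U V by simp
  also have "- p = exp (- (s * a)) * rGamma (c - a)"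
    by (simp add: p_def algebra_simps exp_add exp_diff s1) (simp add: exp_minus[symmetric] s1 divide_inverse)
  also have "q * a = exp (s * (c - a)) * rGamma a"
    using rGamma_plus1[of a] by (simp add: q_def mult_ac)
  finally show "- ((exp w - c) * H (exp w) - exp w * deriv H (exp w)) =
      exp (- (s * a)) * rGamma (c - a) * conf_hyp_U a c w
      + exp (s * (c - a)) * rGamma a * (exp (exp w) * conf_hyp_U (c - a) c (w + s))" .
qed

text \<open>The two solutions exchange roles: the first one now yields the factor c - a, absorbed by
  1 / Gamma(c - a + 1), and the second one is lowered in both parameters, at the point w + s where
  e^(w + s) = - e^w.\<close>

lemma kummer_connection_lower_c:
  assumes "kummer_connection a (c + 1) H"
  shows "kummer_connection a c (\<lambda>x. c * H x + x * deriv H x)"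
  unfolding kummer_connection_def
proof (intro conjI allI ballI)
  have h: "H holomorphic_on UNIV" using assms by (simp add: kummer_connection_def)
  show "(\<lambda>x. c * H x + x * deriv H x) holomorphic_on UNIV"
    by (intro holomorphic_intros h holomorphic_deriv) auto
  fix w s :: complex assume s: "s \<in> {\<i> * of_real pi, - (\<i> * of_real pi)}"
  then have s1: "exp s = - 1" by (auto simp: exp_minus mult.commute[of \<i>])
  define U where "U = conf_hyp_U a (c + 1)"
  define V where "V = conf_hyp_U (c - a + 1) (c + 1)"
  define p where "p = exp (- (s * a)) * rGamma (c - a + 1)"
  define q where "q = exp (s * (c - a + 1)) * rGamma a"
  have c1: "c + 1 - a = c - a + 1" by simp
  have eq: "H (exp w) = p * U w + q * (exp (exp w) * V (w + s))" for w
    using assms s unfolding kummer_connection_def U_def V_def p_def q_def c1 by blast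
  have d: "exp w * deriv H (exp w) = p * deriv U w + q * (exp (exp w) * (exp w * V (w + s) + deriv V (w + s)))"
    by (rule deriv_connection[OF h _ _ eq]) (simp_all add: U_def V_def conf_hyp_U_holomorphic)
  have U: "c * U w + deriv U w = (c - a) * conf_hyp_U a c w"
    unfolding U_def by (rule conf_hyp_U_lower_c[symmetric])
  have V: "c * V (w + s) + exp w * V (w + s) + deriv V (w + s) = - conf_hyp_U (c - a) c (w + s)"
  proof -
    have e: "exp (w + s) = - exp w" by (simp add: exp_add s1)
    show ?thesis
      unfolding conf_hyp_U_lower_a_c[of "c - a" c "w + s"] V_def[symmetric] e by (simp add: algebra_simps)
  qed
  have "c * H (exp w) + exp w * deriv H (exp w) =
      p * (c * U w + deriv U w) + q * (exp (exp w) * (c * V (w + s) + exp w * V (w + s) + deriv V (w + s)))"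
    unfolding d eq by (simp add: algebra_simps)
  also have "\<dots> = p * (c - a) * conf_hyp_U a c w + (- q) * (exp (exp w) * conf_hyp_U (c - a) c (w + s))"
    unfolding U V by simp
  also have "p * (c - a) = exp (- (s * a)) * rGamma (c - a)"
    using rGamma_plus1[of "c - a"] by (simp add: p_def mult_ac)
  also have "- q = exp (s * (c - a)) * rGamma a"
    by (simp add: q_def distrib_left exp_add s1)
  finally show "c * H (exp w) + exp w * deriv H (exp w) =
      exp (- (s * a)) * rGamma (c - a) * conf_hyp_U a c w
      + exp (s * (c - a)) * rGamma a * (exp (exp w) * conf_hyp_U (c - a) c (w + s))" .
qed

theorem kummer_connection_exists: "\<exists>H. kummer_connection a c H"
proof -
  have 1: "\<exists>H. kummer_connection a c H" if "Re a \<ge> 2 - real n" "Re (c - a) \<ge> 2" for n a c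
    using that
  proof (induction n arbitrary: a c)
    case 0
    then show ?case by (intro kummer_connection_base) auto
  next
    case (Suc n)
    have "Re (a + 1) \<ge> 2 - real n" "Re (c + 1 - (a + 1)) \<ge> 2" using Suc.prems by auto
    from Suc.IH[OF this] show ?case using kummer_connection_lower_a_c by blast
  qed
  have 2: "\<exists>H. kummer_connection a c H" if "Re (c - a) \<ge> 2 - real n" for n a c
    using that
  proof (induction n arbitrary: a c)
    case 0
    obtain m where "2 - Re a \<le> real m" using real_arch_simple by blast
    then show ?case using 0 by (intro 1[of m]) auto
  next
    case (Suc n)
    have "Re (c + 1 - a) \<ge> 2 - real n" using Suc.prems by auto
    from Suc.IH[OF this] show ?case using kummer_connection_lower_c by blast
  qed
  obtain m where "2 - Re (c - a) \<le> real m" using real_arch_simple by blast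
  then show ?thesis by (intro 2[of m]) auto
qed

section \<open>Behaviour at the origin\<close>

lemma kummer_connection_solution:
  assumes "kummer_connection a c H"
  shows "kummer_solution a c (\<lambda>w. H (exp w))"
proof -
  let ?s = "\<i> * of_real pi"
  have s1: "exp ?s = - 1" by (simp add: mult.commute)
  have "kummer_on a c UNIV (\<lambda>w. (exp (- (?s * a)) * rGamma (c - a)) * conf_hyp_U a c w
      + (exp (?s * (c - a)) * rGamma a) * (exp (exp w) * conf_hyp_U (c - a) c (w + ?s)))"
    using kummer_solution_conf_hyp_U[of a c] kummer_solution_exp_shift[OF kummer_solution_conf_hyp_U s1, of a c]
    unfolding kummer_solution_iff by (rule kummer_on_lincomb[OF open_UNIV])
  then show ?thesis
    using assms unfolding kummer_solution_iff kummer_connection_def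
    by (rule_tac kummer_on_cong[OF open_UNIV]) auto
qed

text \<open>By independence of the two solutions, H could vanish identically only if 1 / Gamma(c -
  a) and 1 / Gamma(a) were both 0. Then c - a and a would be nonpositive integers, and so would
  their sum c.\<close>

lemma kummer_connection_not_zero:
  assumes H: "kummer_connection a c H" and c: "c \<notin> \<int>\<^sub>\<le>\<^sub>0"
  shows "\<exists>w. H (exp w) \<noteq> 0"
proof (rule ccontr)
  assume "\<not> (\<exists>w. H (exp w) \<noteq> 0)"
  then have H0: "H (exp w) = 0" for w by simp
  define s where "s = \<i> * complex_of_real pi"
  define U where "U = conf_hyp_U a c"
  define E where "E = (\<lambda>w. exp (exp w) * conf_hyp_U (c - a) c (w + s))"
  have W: "wronskian U E 0 \<noteq> 0"
    unfolding U_def E_def by (rule wronskian_conf_hyp_U_nonzero) (simp add: s_def)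
  have eq: "exp (- (s * a)) * rGamma (c - a) * U w + exp (s * (c - a)) * rGamma a * E w = 0" for w
    using H H0[of w] unfolding kummer_connection_def U_def E_def s_def by auto
  have scale: "deriv f = (\<lambda>w. k * deriv g w)" if "f = (\<lambda>w. k * g w)" "g holomorphic_on UNIV" for f g :: "complex \<Rightarrow> complex" and k
    unfolding that(1)
    by (rule ext, rule DERIV_imp_deriv, rule DERIV_cmult, rule holomorphic_derivI[OF that(2) open_UNIV UNIV_I])
  have hol: "U holomorphic_on UNIV" "E holomorphic_on UNIV"
    unfolding U_def E_def
    by (auto intro!: holomorphic_intros conf_hyp_U_holomorphic
      holomorphic_on_compose_gen[of "\<lambda>w. w + s" _ "conf_hyp_U (c - a) c" UNIV, unfolded o_def])
  have "rGamma (c - a) = 0"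
  proof (rule ccontr)
    assume nz: "rGamma (c - a) \<noteq> 0"
    have U: "U = (\<lambda>w. (- (exp (s * (c - a)) * rGamma a) / (exp (- (s * a)) * rGamma (c - a))) * E w)"
    proof
      fix w
      have "exp (- (s * a)) * rGamma (c - a) * U w = - (exp (s * (c - a)) * rGamma a * E w)"
        using eq[of w] by (simp only: eq_neg_iff_add_eq_0)
      then show "U w = (- (exp (s * (c - a)) * rGamma a) / (exp (- (s * a)) * rGamma (c - a))) * E w"
        using nz by (simp add: field_simps)
    qed
    have "wronskian U E 0 = 0"
      unfolding wronskian_def scale[OF U hol(2)] by (subst U) simp
    then show False using W by simp
  qed
  moreover have "rGamma a = 0"
  proof (rule ccontr)
    assume nz: "rGamma a \<noteq> 0"
    then have "E = (\<lambda>w. 0 * U w)"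
      using eq \<open>rGamma (c - a) = 0\<close> by auto
    note E = this
    have "wronskian U E 0 = 0"
      unfolding wronskian_def scale[OF E hol(1)] by (subst E) simp
    then show False using W by simp
  qed
  ultimately have "c - a \<in> \<int>\<^sub>\<le>\<^sub>0" "a \<in> \<int>\<^sub>\<le>\<^sub>0" by (simp_all add: rGamma_eq_zero_iff)
  then have "(c - a) + a \<in> \<int>\<^sub>\<le>\<^sub>0" by (rule nonpos_Ints_add)
  then show False using c by simp
qed

text \<open>The Taylor coefficients of H satisfy (m + 1) (m + c) f_(m+1) = (m + a) f_m with m + c
  \<noteq> 0. If f_0 = 0, all of them vanish, although H is not identically 0.\<close>

lemma kummer_connection_at_0:
  assumes H: "kummer_connection a c H" and c: "c \<notin> \<int>\<^sub>\<le>\<^sub>0"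
  shows "H 0 \<noteq> 0"
proof
  assume H0: "H 0 = 0"
  have h: "H holomorphic_on UNIV" using H by (simp add: kummer_connection_def)
  have h1: "deriv H holomorphic_on UNIV" by (rule holomorphic_deriv[OF h open_UNIV])
  note d = holomorphic_derivI[OF h open_UNIV UNIV_I] holomorphic_derivI[OF h1 open_UNIV UNIV_I]
  define F where "F = fps_expansion H 0"
  have F: "H has_fps_expansion F"
    unfolding F_def by (rule analytic_at_imp_has_fps_expansion_0) (use h in \<open>auto simp: analytic_on_open analytic_at\<close>)
  \<comment> \<open>The equation is kept multiplied by x, so that it holds at x = 0 as well and
    passes to the power series; the coefficient of index m + 1 then gives the recursion.\<close>
  have ode: "x * (x * deriv (deriv H) x) + (c - x) * (x * deriv H x) - a * (x * H x) = 0" for x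
  proof (cases "x = 0")
    case False
    define w where "w = Ln x"
    have w: "exp w = x" using False by (simp add: w_def)
    have k: "kummer_on a c UNIV (\<lambda>w. H (exp w))"
      using kummer_connection_solution[OF H] by (simp add: kummer_solution_iff)
    have 1: "deriv (\<lambda>w. H (exp w)) = (\<lambda>w. deriv H (exp w) * exp w)"
      by (rule ext, rule DERIV_imp_deriv, rule DERIV_chain2[OF d(1) DERIV_exp])
    have 2: "deriv (\<lambda>w. deriv H (exp w) * exp w) w = deriv (deriv H) (exp w) * exp w * exp w + exp w * deriv H (exp w)"
      by (rule DERIV_imp_deriv, rule DERIV_mult[OF DERIV_chain2[OF d(2) DERIV_exp] DERIV_exp])
    show ?thesis
      using kummer_onD(3)[OF k open_UNIV UNIV_I, of w] unfolding 1 2 w by (simp add: algebra_simps)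
  qed simp
  define G where "G = fps_X * (fps_X * fps_deriv (fps_deriv F)) + (fps_const c - fps_X) * (fps_X * fps_deriv F) - fps_const a * (fps_X * F)"
  have "(\<lambda>x. x * (x * deriv (deriv H) x) + (c - x) * (x * deriv H x) - a * (x * H x)) has_fps_expansion G"
    unfolding G_def by (intro fps_expansion_intros F)
  then have "(\<lambda>x. 0) has_fps_expansion G" unfolding ode .
  then have G: "G = 0" using has_fps_expansion_0 by (rule fps_expansion_unique_complex)
  have rec: "of_nat (Suc m) * (of_nat m + c) * fps_nth F (Suc m) = (of_nat m + a) * fps_nth F m" for m
  proof -
    have 1: "fps_nth (fps_X * fps_deriv (fps_deriv F)) m = of_nat m * of_nat (Suc m) * fps_nth F (Suc m)"
      by (cases m) auto
    have 2: "fps_nth (fps_X * fps_deriv F) m = of_nat m * fps_nth F m"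
      by (cases m) auto
    have "0 = fps_nth G (Suc m)" by (simp add: G)
    also have "\<dots> = fps_nth (fps_X * fps_deriv (fps_deriv F)) m + c * fps_nth (fps_deriv F) m
       - fps_nth (fps_X * fps_deriv F) m - a * fps_nth F m"
      by (simp add: G_def left_diff_distrib)
    also have "\<dots> = of_nat (Suc m) * (of_nat m + c) * fps_nth F (Suc m) - (of_nat m + a) * fps_nth F m"
      unfolding 1 2 by (simp add: algebra_simps)
    finally show ?thesis by simp
  qed
  have "fps_nth F m = 0" for m
  proof (induction m)
    case 0
    show ?case using H0 by (simp add: F_def fps_expansion_def)
  next
    case (Suc m)
    have "of_nat m + c \<noteq> 0"
    proof
      assume "of_nat m + c = 0"
      then have "c = - of_nat m" by (simp add: eq_neg_iff_add_eq_0 add.commute)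
      then show False using c by (metis minus_of_nat_in_nonpos_Ints)
    qed
    moreover have "of_nat (Suc m) \<noteq> (0::complex)" by (rule of_nat_neq_0)
    ultimately show ?case using rec[of m] Suc by simp
  qed
  then have "F = 0" by (simp add: fps_eq_iff)
  obtain w where w: "H (exp w) \<noteq> 0" using kummer_connection_not_zero[OF H c] by blast
  have "eval_fps F (exp w - 0) = H (exp w)"
    unfolding F_def by (rule eval_fps_expansion[of _ _ \<infinity>]) (use h in auto)
  then show False using w \<open>F = 0\<close> by simp
qed

text \<open>Integration of f' along a horizontal segment up to Re w = R, with \<phi>' as majorant.
  The constant bounds f on the compact right-hand edge of the strip.\<close>

lemma strip_integral_bound:
  fixes f f' :: "complex \<Rightarrow> complex"
  assumes f': "\<And>w. Re w \<le> R \<Longrightarrow> (f has_field_derivative f' w) (at w)"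
    and \<phi>: "\<And>s. (\<phi> has_real_derivative \<phi>' s) (at s)"
    and bound: "\<And>w. Re w \<le> R \<Longrightarrow> \<bar>Im w\<bar> \<le> B \<Longrightarrow> norm (f' w) \<le> \<phi>' (Re w)"
  shows "\<exists>K\<ge>0. \<forall>w. Re w \<le> R \<longrightarrow> \<bar>Im w\<bar> \<le> B \<longrightarrow> norm (f w) \<le> K + (\<phi> R - \<phi> (Re w))"
proof -
  define g where "g = (\<lambda>y. of_real R + \<i> * complex_of_real y)"
  have "compact (g ` {- B..B})"
    unfolding g_def by (intro compact_continuous_image continuous_intros) auto
  moreover have "continuous_on (g ` {- B..B}) f"
    by (intro continuous_at_imp_continuous_on ballI DERIV_isCont[OF f']) (auto simp: g_def)
  ultimately have "bounded (f ` (g ` {- B..B}))"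
    using compact_continuous_image compact_imp_bounded by blast
  then obtain K where K: "\<And>y. y \<in> {- B..B} \<Longrightarrow> norm (f (g y)) \<le> K"
    unfolding bounded_iff by blast
  have "norm (f w) \<le> max K 0 + (\<phi> R - \<phi> (Re w))" if w: "Re w \<le> R" "\<bar>Im w\<bar> \<le> B" for w
  proof -
    define h where "h = (\<lambda>s. of_real s + \<i> * complex_of_real (Im w))"
    have hw: "h (Re w) = w" by (simp add: h_def complex_eq_iff)
    have hR: "h R = g (Im w)" by (simp add: h_def g_def)
    have fh: "((\<lambda>s. f (h s)) has_vector_derivative f' (h s)) (at s)" if "s \<le> R" for s
    proof -
      have "((\<lambda>z. f (z + \<i> * complex_of_real (Im w))) has_field_derivative f' (h s)) (at (of_real s))"
        using f'[of "h s"] that DERIV_shift[of f "f' (h s)" "of_real s" "\<i> * complex_of_real (Im w)"] by (simp add: h_def)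
      then show ?thesis unfolding h_def by (rule has_vector_derivative_real_field)
    qed
    have "norm (f (h R) - f (h (Re w))) \<le> \<phi> R - \<phi> (Re w)"
    proof (cases "Re w = R")
      case False
      then have lt: "Re w < R" using w by simp
      show ?thesis
      proof (rule differentiable_bound_general[OF lt])
        show "continuous_on {Re w..R} (\<lambda>s. f (h s))"
          by (intro continuous_at_imp_continuous_on ballI has_vector_derivative_continuous[OF fh]) auto
        show "continuous_on {Re w..R} \<phi>"
          by (intro continuous_at_imp_continuous_on ballI DERIV_isCont[OF \<phi>])
        show "((\<lambda>s. f (h s)) has_vector_derivative f' (h s)) (at s)" if "s < R" for s
          using that by (intro fh) auto
        show "(\<phi> has_vector_derivative \<phi>' s) (at s)" for s
          using \<phi> by (simp add: has_real_derivative_iff_has_vector_derivative)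
        show "norm (f' (h s)) \<le> \<phi>' s" if "s < R" for s
          using bound[of "h s"] that w by (simp add: h_def)
      qed
    qed simp
    then have "norm (f w) \<le> norm (f (g (Im w))) + (\<phi> R - \<phi> (Re w))"
      unfolding hR hw using norm_triangle_sub[of "f w" "f (g (Im w))"] norm_minus_commute[of "f w" "f (g (Im w))"] by linarith
    moreover have "norm (f (g (Im w))) \<le> max K 0" using K[of "Im w"] w by (auto simp: abs_le_iff)
    ultimately show ?thesis by linarith
  qed
  then show ?thesis by (intro exI[of _ "max K 0"]) auto
qed

text \<open>
  With \<open>F w = H (exp w)\<close>, the derivative of \<open>g / F\<close> is \<open>W / F\<^sup>2\<close>, where \<open>W\<close> is the Wronskian; this is
  \<open>exp ((1 - c) w)\<close> times a function of \<open>x = exp w\<close> that is holomorphic at \<open>0\<close>.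
\<close>

lemma kummer_near_0:
  assumes g: "kummer_solution a c g" and c: "Re c > 0"
  shows "\<exists>K R. R \<le> - 1 \<and> (\<forall>w. Re w \<le> R \<longrightarrow> \<bar>Im w\<bar> \<le> B \<longrightarrow>
      norm (g w) \<le> K * (if c = 1 then - Re w else if Re c > 1 then exp ((1 - Re c) * Re w) else 1))"
proof -
  obtain H where H: "kummer_connection a c H" using kummer_connection_exists by blast
  have cZ: "c \<notin> \<int>\<^sub>\<le>\<^sub>0" using c by (auto elim!: nonpos_Ints_cases)
  have H0: "H 0 \<noteq> 0" by (rule kummer_connection_at_0[OF H cZ])
  have h: "H holomorphic_on UNIV" using H by (simp add: kummer_connection_def)
  define F where "F = (\<lambda>w. H (exp w))"
  have hF: "kummer_on a c UNIV F" using kummer_connection_solution[OF H] by (simp add: kummer_solution_iff F_def)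
  have hg: "kummer_on a c UNIV g" using g by (simp add: kummer_solution_iff)
  obtain D where "\<And>w. w \<in> UNIV \<Longrightarrow> wronskian F g w = D * exp (exp w - (c - 1) * w)"
    using kummer_wronskian[OF open_UNIV connected_UNIV hF hg] by blast
  note D = this[OF UNIV_I]
  have "isCont H 0" using holomorphic_on_imp_continuous_on[OF h] by (simp add: continuous_on_eq_continuous_at)
  then have "\<forall>\<^sub>F x in nhds 0. H x \<noteq> 0"
    using H0 by (simp add: continuous_at t1_space_nhds tendsto_imp_eventually_ne isCont_def tendsto_nhds_iff)
  then obtain r where r: "r > 0" "\<And>x. norm x < r \<Longrightarrow> H x \<noteq> 0"
    by (auto simp: eventually_nhds_metric dist_norm)
  define Q where "Q = (\<lambda>x. D * exp x / (H x)\<^sup>2)"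
  have hQ: "Q holomorphic_on ball 0 r"
    unfolding Q_def by (intro holomorphic_intros holomorphic_on_subset[OF h]) (use r in auto)
  \<comment> \<open>The bound r / 2 keeps the closed disc inside the zero-free disc of
    \<open>H\<close>. The bound e^(-1) gives Re w \<le> - 1, so that - Re w \<ge> 1 absorbs
    constants in the logarithmic case.\<close>
  define \<rho> where "\<rho> = min (r / 2) (exp (- 1))"
  have \<rho>: "\<rho> > 0" "\<rho> < r" "\<rho> \<le> exp (- 1)" using r by (auto simp: \<rho>_def)
  define R where "R = ln \<rho>"
  have "ln \<rho> \<le> ln (exp (- 1))" using \<rho> by (subst ln_le_cancel_iff) auto
  then have R: "R \<le> - 1" by (simp add: R_def)
  have exp_R: "norm (exp w) \<le> \<rho>" if "Re w \<le> R" for w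
  proof -
    have "exp (Re w) \<le> exp R" using that by simp
    then show ?thesis using \<rho> by (simp add: R_def)
  qed
  have nzF: "F w \<noteq> 0" if "Re w \<le> R" for w
    unfolding F_def using r(2) exp_R[OF that] \<rho> by force
  have "compact (cball (0::complex) \<rho>)" by simp
  moreover have cQ: "cball 0 \<rho> \<subseteq> ball (0::complex) r" using \<rho> by auto
  ultimately have "bounded (Q ` cball 0 \<rho>)"
    by (intro compact_imp_bounded compact_continuous_image holomorphic_on_imp_continuous_on
        holomorphic_on_subset[OF hQ])
  then obtain M where "\<forall>y\<in>Q ` cball 0 \<rho>. norm y \<le> M"
    unfolding bounded_iff by blast
  then have M: "norm (Q x) \<le> M" if "norm x \<le> \<rho>" for x
    using that by simp
  have "bounded (deriv Q ` cball 0 \<rho>)"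
    using \<open>compact (cball (0::complex) \<rho>)\<close> cQ
    by (intro compact_imp_bounded compact_continuous_image holomorphic_on_imp_continuous_on
        holomorphic_on_subset[OF holomorphic_deriv[OF hQ open_ball]])
  then obtain M' where "\<forall>y\<in>deriv Q ` cball 0 \<rho>. norm y \<le> M'"
    unfolding bounded_iff by blast
  then have M': "norm (deriv Q x) \<le> M'" if "norm x \<le> \<rho>" for x
    using that by simp
  have Q0: "norm (Q x - Q 0) \<le> M' * norm x" if "norm x \<le> \<rho>" for x
  proof -
    have "norm (Q x - Q 0) \<le> M' * norm (x - 0)"
      using holomorphic_derivI[OF hQ open_ball] cQ M' that \<rho>
      by (intro field_differentiable_bound[of "cball 0 \<rho>" Q "deriv Q"])
         (auto intro!: has_field_derivative_at_within simp: dist_norm)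
    then show ?thesis by simp
  qed
  define f where "f = (\<lambda>w. g w / F w)"
  have df: "(f has_field_derivative exp ((1 - c) * w) * Q (exp w)) (at w)" if w: "Re w \<le> R" for w
  proof -
    note d = kummer_onD(1)[OF hg open_UNIV UNIV_I, of w] kummer_onD(1)[OF hF open_UNIV UNIV_I, of w]
    have "(f has_field_derivative (deriv g w * F w - g w * deriv F w) / (F w * F w)) (at w)"
      unfolding f_def by (rule DERIV_divide[OF d nzF[OF w]])
    also have "(deriv g w * F w - g w * deriv F w) = wronskian F g w"
      by (simp add: wronskian_def algebra_simps)
    also have "wronskian F g w / (F w * F w) = exp ((1 - c) * w) * Q (exp w)"
    proof -
      have "exp (exp w - (c - 1) * w) = exp ((1 - c) * w) * exp (exp w)"
        by (simp add: algebra_simps flip: exp_add)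
      then show ?thesis unfolding D Q_def by (simp add: F_def power2_eq_square)
    qed
    finally show ?thesis .
  qed
  define N where "N = exp (\<bar>Im c\<bar> * B)"
  have powr: "norm (exp ((1 - c) * w)) \<le> exp ((1 - Re c) * Re w) * N" if "\<bar>Im w\<bar> \<le> B" for w
  proof -
    have "\<bar>Im c * Im w\<bar> \<le> \<bar>Im c\<bar> * B" unfolding abs_mult using that by (intro mult_left_mono) auto
    then have "Im c * Im w \<le> \<bar>Im c\<bar> * B" by linarith
    then show ?thesis by (simp add: N_def flip: exp_add)
  qed
  have N: "N > 0" by (simp add: N_def)
  have M0: "M \<ge> 0" using M[of 0] \<rho> by (auto intro: order_trans[OF norm_ge_zero])
  have M'0: "M' \<ge> 0" using M'[of 0] \<rho> by (auto intro: order_trans[OF norm_ge_zero])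
  have bd: "norm (exp ((1 - c) * w) * Q (exp w)) \<le> (N * M) * exp ((1 - Re c) * Re w)"
    if "Re w \<le> R" "\<bar>Im w\<bar> \<le> B" for w
  proof -
    have "norm (exp ((1 - c) * w) * Q (exp w)) \<le> (exp ((1 - Re c) * Re w) * N) * M"
      unfolding norm_mult using N by (intro mult_mono powr M exp_R that) auto
    then show ?thesis by (simp add: mult_ac)
  qed
  have main: "\<exists>K. \<forall>w. Re w \<le> R \<longrightarrow> \<bar>Im w\<bar> \<le> B \<longrightarrow>
      norm (f w) \<le> K * (if c = 1 then - Re w else if Re c > 1 then exp ((1 - Re c) * Re w) else 1)"
  proof (cases "Re c = 1")
    case False
    define \<kappa> where "\<kappa> = 1 - Re c"
    have \<kappa>: "\<kappa> \<noteq> 0" "c \<noteq> 1" using False by (auto simp: \<kappa>_def)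
    obtain K where K: "K \<ge> 0" "\<And>w. Re w \<le> R \<Longrightarrow> \<bar>Im w\<bar> \<le> B \<Longrightarrow>
        norm (f w) \<le> K + ((N * M) / \<kappa> * exp (\<kappa> * R) - (N * M) / \<kappa> * exp (\<kappa> * Re w))"
    proof -
      have "\<exists>K\<ge>0. \<forall>w. Re w \<le> R \<longrightarrow> \<bar>Im w\<bar> \<le> B \<longrightarrow>
        norm (f w) \<le> K + ((N * M) / \<kappa> * exp (\<kappa> * R) - (N * M) / \<kappa> * exp (\<kappa> * Re w))"
        by (rule strip_integral_bound[OF df, where \<phi>' = "\<lambda>s. (N * M) * exp (\<kappa> * s)"])
           (use bd \<kappa> in \<open>auto simp: \<kappa>_def intro!: derivative_eq_intros\<close>)
      then show ?thesis using that by blast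
    qed
    show ?thesis
    proof (cases "\<kappa> > 0")
      case True
      have "norm (f w) \<le> (K + (N * M) / \<kappa> * exp (\<kappa> * R)) * 1" if "Re w \<le> R" "\<bar>Im w\<bar> \<le> B" for w
      proof -
        have "(N * M) / \<kappa> * exp (\<kappa> * Re w) \<ge> 0" using True N M0 by simp
        then show ?thesis using K(2)[OF that] by simp
      qed
      then show ?thesis using True \<kappa> by (auto simp: \<kappa>_def)
    next
      case False
      have "norm (f w) \<le> (K - (N * M) / \<kappa>) * exp (\<kappa> * Re w)" if "Re w \<le> R" "\<bar>Im w\<bar> \<le> B" for w
      proof -
        have "\<kappa> * Re w \<ge> 0" using False that R by (intro mult_nonpos_nonpos) auto
        then have "K * 1 \<le> K * exp (\<kappa> * Re w)" using K(1) by (intro mult_left_mono) auto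
        moreover have "(N * M) / \<kappa> * exp (\<kappa> * R) \<le> 0"
          using False N M0 by (intro mult_nonpos_nonneg divide_nonneg_nonpos) auto
        ultimately show ?thesis using K(2)[OF that] by (simp add: algebra_simps)
      qed
      then show ?thesis using False \<kappa> by (auto simp: \<kappa>_def)
    qed
  next
    case c1: True
    show ?thesis
    proof (cases "c = 1")
      case True
      obtain K where K: "K \<ge> 0" "\<And>w. Re w \<le> R \<Longrightarrow> \<bar>Im w\<bar> \<le> B \<Longrightarrow>
          norm (f w) \<le> K + (N * M * R - N * M * Re w)"
      proof -
        have "\<exists>K\<ge>0. \<forall>w. Re w \<le> R \<longrightarrow> \<bar>Im w\<bar> \<le> B \<longrightarrow>
          norm (f w) \<le> K + (N * M * R - N * M * Re w)"
          by (rule strip_integral_bound[OF df, where \<phi>' = "\<lambda>s. N * M"])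
             (use bd True in \<open>auto intro!: derivative_eq_intros\<close>)
        then show ?thesis using that by blast
      qed
      have "norm (f w) \<le> (K + N * M) * (- Re w)" if "Re w \<le> R" "\<bar>Im w\<bar> \<le> B" for w
      proof -
        have "K * 1 \<le> K * (- Re w)" using K(1) that R by (intro mult_left_mono) auto
        moreover have "N * M * R \<le> 0" using N M0 R by (intro mult_nonneg_nonpos) auto
        ultimately show ?thesis using K(2)[OF that] by (simp add: algebra_simps)
      qed
      then show ?thesis using True by auto
    next
      case False
      \<comment> \<open>For Re c = 1 the modulus of the integrand does not decay, and integrating it
        would produce a logarithm. The oscillating part Q(0) e^((1-c) w) is therefore integrated
        exactly, with a bounded result as c \<noteq> 1; the rest is O(e^w).\<close>
      define f1 where "f1 = (\<lambda>w. f w - Q 0 / (1 - c) * exp ((1 - c) * w))"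
      have d1: "(f1 has_field_derivative exp ((1 - c) * w) * (Q (exp w) - Q 0)) (at w)" if "Re w \<le> R" for w
      proof -
        have "((\<lambda>w. exp ((1 - c) * w)) has_field_derivative exp ((1 - c) * w) * (1 - c)) (at w)"
          by (auto intro!: derivative_eq_intros)
        from DERIV_diff[OF df[OF that] DERIV_cmult[OF this, of "Q 0 / (1 - c)"]]
        have "(f1 has_field_derivative exp ((1 - c) * w) * Q (exp w)
            - Q 0 / (1 - c) * (exp ((1 - c) * w) * (1 - c))) (at w)"
          unfolding f1_def .
        also have "Q 0 / (1 - c) * (exp ((1 - c) * w) * (1 - c)) = exp ((1 - c) * w) * Q 0"
          using False by simp
        finally show ?thesis by (simp only: right_diff_distrib)
      qed
      obtain K where K: "K \<ge> 0" "\<And>w. Re w \<le> R \<Longrightarrow> \<bar>Im w\<bar> \<le> B \<Longrightarrow>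
          norm (f1 w) \<le> K + (N * M' * exp R - N * M' * exp (Re w))"
      proof -
        have "\<exists>K\<ge>0. \<forall>w. Re w \<le> R \<longrightarrow> \<bar>Im w\<bar> \<le> B \<longrightarrow>
          norm (f1 w) \<le> K + (N * M' * exp R - N * M' * exp (Re w))"
        proof (rule strip_integral_bound[OF d1, where \<phi>' = "\<lambda>s. N * M' * exp s"])
          fix w assume w: "Re w \<le> R" "\<bar>Im w\<bar> \<le> B"
          have "norm (exp ((1 - c) * w) * (Q (exp w) - Q 0)) \<le> (exp ((1 - Re c) * Re w) * N) * (M' * norm (exp w))"
            unfolding norm_mult using N by (intro mult_mono powr Q0 exp_R w) auto
          then show "norm (exp ((1 - c) * w) * (Q (exp w) - Q 0)) \<le> N * M' * exp (Re w)"
            using c1 by (simp add: mult_ac)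
        qed (auto intro!: derivative_eq_intros)
        then show ?thesis using that by blast
      qed
      have "norm (f w) \<le> (K + N * M' * exp R + norm (Q 0 / (1 - c)) * N) * 1" if w: "Re w \<le> R" "\<bar>Im w\<bar> \<le> B" for w
      proof -
        have "norm (f w) \<le> norm (f1 w) + norm (Q 0 / (1 - c)) * norm (exp ((1 - c) * w))"
          unfolding f1_def norm_mult[symmetric] using norm_triangle_sub[of "f w" "Q 0 / (1 - c) * exp ((1 - c) * w)"] by simp
        also have "norm (Q 0 / (1 - c)) * norm (exp ((1 - c) * w)) \<le> norm (Q 0 / (1 - c)) * N"
          using powr[OF w(2)] c1 by (intro mult_left_mono) auto
        also have "norm (f1 w) \<le> K + N * M' * exp R"
        proof -
          have "0 \<le> N * M' * exp (Re w)" using N M'0 by simp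
          then show ?thesis using K(2)[OF w] by linarith
        qed
        finally show ?thesis by simp
      qed
      then show ?thesis using False c1 by auto
    qed
  qed
  then obtain K where K: "\<And>w. Re w \<le> R \<Longrightarrow> \<bar>Im w\<bar> \<le> B \<Longrightarrow>
      norm (f w) \<le> K * (if c = 1 then - Re w else if Re c > 1 then exp ((1 - Re c) * Re w) else 1)"
    by blast
  have "bounded (H ` cball 0 \<rho>)"
    by (intro compact_imp_bounded compact_continuous_image holomorphic_on_imp_continuous_on
        holomorphic_on_subset[OF h]) auto
  then obtain L where "\<forall>y\<in>H ` cball 0 \<rho>. norm y \<le> L"
    unfolding bounded_iff by blast
  then have L: "norm (H x) \<le> L" if "norm x \<le> \<rho>" for x
    using that by simp
  have "norm (g w) \<le> (L * K) * (if c = 1 then - Re w else if Re c > 1 then exp ((1 - Re c) * Re w) else 1)"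
    if w: "Re w \<le> R" "\<bar>Im w\<bar> \<le> B" for w
  proof -
    have "g w = F w * f w" using nzF[OF w(1)] by (simp add: f_def)
    then have "norm (g w) = norm (F w) * norm (f w)" by (simp only: norm_mult)
    also have "\<dots> \<le> L * (K * (if c = 1 then - Re w else if Re c > 1 then exp ((1 - Re c) * Re w) else 1))"
      unfolding F_def using L[OF exp_R[OF w(1)]] by (intro mult_mono K w L exp_R) (auto intro: order_trans[OF norm_ge_zero])
    finally show ?thesis by (simp only: mult.assoc)
  qed
  then show ?thesis using R by blast
qed

section \<open>The matrix function and its monodromy\<close>

definition phase :: "complex \<Rightarrow> complex" where
  "phase x = exp (\<i> * of_real pi * x)"

lemma phase_nonzero [simp]: "phase x \<noteq> 0"
  by (simp add: phase_def)

lemma phase_add: "phase (x + y) = phase x * phase y"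
  by (simp add: phase_def distrib_left exp_add)

lemma phase_diff: "phase (x - y) = phase x / phase y"
  by (simp add: phase_def right_diff_distrib exp_diff)

lemma phase_minus: "phase (- x) = inverse (phase x)"
  by (simp add: phase_def exp_minus)

lemma phase_double: "phase (2 * x) = phase x ^ 2"
  by (simp add: phase_def exp_double[symmetric] mult_ac)

lemma phase_triple: "phase (3 * x) = phase x ^ 3"
proof -
  have "phase (x + (x + x)) = phase x ^ 3"
    unfolding phase_add by (simp add: power3_eq_cube)
  moreover have "x + (x + x) = 3 * x" by simp
  ultimately show ?thesis by metis
qed

lemma phase_1: "phase 1 = - 1" and phase_0: "phase 0 = 1"
  by (simp_all add: phase_def mult.commute[of \<i>])

lemmas phase_simps = phase_add phase_diff phase_minus phase_double phase_triple phase_1 phase_0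

lemma mat2_nth [simp]:
  "mat2 a b c d $ 1 $ 1 = a" "mat2 a b c d $ 1 $ 2 = b"
  "mat2 a b c d $ 2 $ 1 = c" "mat2 a b c d $ 2 $ 2 = d"
  by (simp_all add: mat2_def)

lemma matrix_mult_2_nth:
  fixes M N :: "complex^2^2"
  shows "(M ** N) $ i $ j = M $ i $ 1 * N $ 1 $ j + M $ i $ 2 * N $ 2 $ j"
  by (simp add: matrix_matrix_mult_def sum_2)

lemma mat2_mult: "mat2 a b c d ** mat2 a' b' c' d' =
    mat2 (a * a' + b * c') (a * b' + b * d') (c * a' + d * c') (c * b' + d * d')"
  by (simp add: vec_eq_iff forall_2 matrix_mult_2_nth)

lemma mat2_cong: "a = a' \<Longrightarrow> b = b' \<Longrightarrow> c = c' \<Longrightarrow> d = d' \<Longrightarrow> mat2 a b c d = mat2 a' b' c' d'"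
  by simp

lemma mat2_one: "mat 1 = mat2 1 0 0 1"
  by (simp add: vec_eq_iff forall_2 mat_def)

text \<open>\<open>matrix_inv\<close> is defined by choice, so the explicit inverse is identified
  with it through uniqueness of two-sided inverses. All jump matrices have determinant 1.\<close>

lemma matrix_inv_mat2:
  assumes "a * d - b * c = 1"
  shows "matrix_inv (mat2 a b c d) = mat2 d (- b) (- c) a"
proof -
  let ?A = "mat2 a b c d" and ?B = "mat2 d (- b) (- c) a"
  have 1: "?A ** ?B = mat 1" "?B ** ?A = mat 1"
    using assms by (simp_all add: mat2_mult mat2_one algebra_simps)
  then have "?A ** matrix_inv ?A = mat 1 \<and> matrix_inv ?A ** ?A = mat 1"
    unfolding matrix_inv_def by (rule_tac someI[of "\<lambda>X. ?A ** X = mat 1 \<and> X ** ?A = mat 1" ?B]) simp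
  then have "matrix_inv ?A = (?B ** ?A) ** matrix_inv ?A"
    by (simp add: 1 matrix_mul_lid)
  also have "\<dots> = ?B ** (?A ** matrix_inv ?A)" by (simp only: matrix_mul_assoc)
  also have "\<dots> = ?B"
    using \<open>?A ** matrix_inv ?A = mat 1 \<and> _\<close> by (simp add: matrix_mul_rid)
  finally show ?thesis .
qed

text \<open>In A = e^(i pi \<alpha>) and B = e^(i pi \<beta>) the jump matrices become rational, and
  matrix identities reduce to identities of rational functions.\<close>

lemma jump_phase:
  fixes \<alpha> \<beta> :: complex
  defines "A \<equiv> phase \<alpha>" and "B \<equiv> phase \<beta>"
  shows "jump \<alpha> \<beta> 1 = mat2 0 (1 / B) (- B) 0" "jump \<alpha> \<beta> 2 = mat2 1 0 (B / A ^ 2) 1"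
    "jump \<alpha> \<beta> 3 = mat2 A 0 0 (1 / A)" "jump \<alpha> \<beta> 4 = mat2 1 0 (A ^ 2 / B) 1"
    "jump \<alpha> \<beta> 5 = mat2 0 B (- (1 / B)) 0" "jump \<alpha> \<beta> 6 = mat2 1 0 (1 / (B * A ^ 2)) 1"
    "jump \<alpha> \<beta> 7 = mat2 A 0 0 (1 / A)" "jump \<alpha> \<beta> 8 = mat2 1 0 (B * A ^ 2) 1"
  unfolding jump_def Let_def phase_def[symmetric] A_def B_def
  by (simp_all add: phase_simps divide_simps)

lemma jump_inverse_phase:
  fixes \<alpha> \<beta> :: complex
  defines "A \<equiv> phase \<alpha>" and "B \<equiv> phase \<beta>"
  shows "matrix_inv (jump \<alpha> \<beta> 1) = mat2 0 (- (1 / B)) B 0"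
    "matrix_inv (jump \<alpha> \<beta> 4) = mat2 1 0 (- (A ^ 2 / B)) 1"
    "matrix_inv (jump \<alpha> \<beta> 5) = mat2 0 (- B) (1 / B) 0"
    "matrix_inv (jump \<alpha> \<beta> 6) = mat2 1 0 (- (1 / (B * A ^ 2))) 1"
    "matrix_inv (jump \<alpha> \<beta> 8) = mat2 1 0 (- (B * A ^ 2)) 1"
  unfolding jump_phase A_def B_def by (subst matrix_inv_mat2; simp)+

text \<open>In the outer sectors 2, 3, 6 and 7 the first column is a multiple of (1, B / A^2), the
  combination of columns that is single-valued up to the prefactor.\<close>

lemma sector_factor_phase:
  fixes \<alpha> \<beta> :: complex
  defines "A \<equiv> phase \<alpha>" and "B \<equiv> phase \<beta>"
  shows "sector_factor \<alpha> \<beta> 1 = mat2 1 0 0 1"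
    "sector_factor \<alpha> \<beta> 2 = mat2 1 0 (B / A ^ 2) 1"
    "sector_factor \<alpha> \<beta> 3 = mat2 A 0 (B / A) (1 / A)"
    "sector_factor \<alpha> \<beta> 4 = mat2 A 0 (B / A - A / B) (1 / A)"
    "sector_factor \<alpha> \<beta> 5 = mat2 0 (- A * B) (1 / (A * B)) (A - B ^ 2 / A)"
    "sector_factor \<alpha> \<beta> 6 = mat2 (1 / A) (- A * B) (B / A ^ 3) (A - B ^ 2 / A)"
    "sector_factor \<alpha> \<beta> 7 = mat2 (A ^ 2) (- (1 / B)) B 0"
    "sector_factor \<alpha> \<beta> 8 = mat2 0 (- (1 / B)) B 0"
proof -
  have nz: "A \<noteq> 0" "B \<noteq> 0" by (simp_all add: A_def B_def)
  note J = jump_phase[of \<alpha> \<beta>, folded A_def B_def]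
  note J' = jump_inverse_phase[of \<alpha> \<beta>, folded A_def B_def]
  show "sector_factor \<alpha> \<beta> 1 = mat2 1 0 0 1"
    by (simp add: sector_factor_def Let_def mat2_one)
  show "sector_factor \<alpha> \<beta> 2 = mat2 1 0 (B / A ^ 2) 1"
    by (simp add: sector_factor_def Let_def J)
  show 3: "sector_factor \<alpha> \<beta> 3 = mat2 A 0 (B / A) (1 / A)"
    using nz by (simp add: sector_factor_def Let_def J mat2_mult power2_eq_square)
  have "sector_factor \<alpha> \<beta> 4 = sector_factor \<alpha> \<beta> 3 ** matrix_inv (jump \<alpha> \<beta> 4)"
    by (simp add: sector_factor_def Let_def)
  then show 4: "sector_factor \<alpha> \<beta> 4 = mat2 A 0 (B / A - A / B) (1 / A)"
    unfolding 3 J' mat2_mult using nz by (simp add: power2_eq_square)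
  have "sector_factor \<alpha> \<beta> 5 = sector_factor \<alpha> \<beta> 4 ** matrix_inv (jump \<alpha> \<beta> 5)"
    by (simp add: sector_factor_def Let_def)
  then show 5: "sector_factor \<alpha> \<beta> 5 = mat2 0 (- A * B) (1 / (A * B)) (A - B ^ 2 / A)"
    unfolding 4 J' mat2_mult
    by (simp only:, intro mat2_cong) (use nz in \<open>simp_all add: field_simps power2_eq_square\<close>)
  have "sector_factor \<alpha> \<beta> 6 = sector_factor \<alpha> \<beta> 5 ** matrix_inv (jump \<alpha> \<beta> 6)"
    by (simp add: sector_factor_def Let_def)
  also have "\<dots> = mat2 (1 / A) (- A * B) (B / A ^ 3) (A - B ^ 2 / A)"
    unfolding 5 J' mat2_mult
    by (intro mat2_cong) (use nz in \<open>simp_all add: field_simps power2_eq_square power3_eq_cube\<close>)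
  finally show "sector_factor \<alpha> \<beta> 6 = mat2 (1 / A) (- A * B) (B / A ^ 3) (A - B ^ 2 / A)" .
  show 8: "sector_factor \<alpha> \<beta> 8 = mat2 0 (- (1 / B)) B 0"
    by (simp add: sector_factor_def Let_def J' del: One_nat_def)
  have "sector_factor \<alpha> \<beta> 7 = sector_factor \<alpha> \<beta> 8 ** matrix_inv (jump \<alpha> \<beta> 8)"
    by (simp add: sector_factor_def Let_def)
  then show "sector_factor \<alpha> \<beta> 7 = mat2 (A ^ 2) (- (1 / B)) B 0"
    unfolding 8 J' mat2_mult using nz by simp
qed

lemma sector_factor_jump:
  assumes "k \<in> {1..8}" "k \<noteq> 7"
  shows "sector_factor \<alpha> \<beta> (plus_side k) = sector_factor \<alpha> \<beta> (minus_side k) ** jump \<alpha> \<beta> k"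
proof -
  have nz: "phase \<alpha> \<noteq> 0" "phase \<beta> \<noteq> 0" by simp_all
  from assms consider "k = 1" | "k = 2" | "k = 3" | "k = 4" | "k = 5" | "k = 6" | "k = 8" by fastforce
  then show ?thesis
    by cases (simp_all add: plus_side_def minus_side_def del: One_nat_def,
        unfold sector_factor_phase sector_factor_phase(1)[unfolded One_nat_def] jump_phase mat2_mult,
        intro mat2_cong, simp_all add: field_simps power2_eq_square power3_eq_cube,
        simp_all add: minus_divide_left)
qed

text \<open>Undoing the lens jump turns the factor of a lens sector into that of its outer
  neighbour, so the behaviour demanded inside the lenses reduces to the one outside.\<close>

lemma sector_factor_lens:
  "sector_factor \<alpha> \<beta> 1 ** jump \<alpha> \<beta> 2 = sector_factor \<alpha> \<beta> 2"
  "sector_factor \<alpha> \<beta> 4 ** jump \<alpha> \<beta> 4 = sector_factor \<alpha> \<beta> 3"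
  "sector_factor \<alpha> \<beta> 5 ** matrix_inv (jump \<alpha> \<beta> 6) = sector_factor \<alpha> \<beta> 6"
  "sector_factor \<alpha> \<beta> 8 ** matrix_inv (jump \<alpha> \<beta> 8) = sector_factor \<alpha> \<beta> 7"
  using sector_factor_jump[of 2 \<alpha> \<beta>] sector_factor_jump[of 4 \<alpha> \<beta>]
  by (simp_all add: plus_side_def minus_side_def) (simp_all add: sector_factor_def Let_def)

section \<open>Rows of the matrix as pairs of Kummer solutions\<close>

definition conf_hyp_E :: "complex \<Rightarrow> complex \<Rightarrow> complex \<Rightarrow> complex" where
  "conf_hyp_E a c w = exp (exp w) * conf_hyp_U (c - a) c (w - \<i> * of_real pi)"

lemma kummer_solution_conf_hyp_E: "kummer_solution a c (conf_hyp_E a c)"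
proof -
  have "exp (- (\<i> * of_real pi)) = (- 1 :: complex)" by (simp add: exp_minus mult.commute[of \<i>])
  from kummer_solution_exp_shift[OF kummer_solution_conf_hyp_U this, where a = a and c = c]
  show ?thesis by (simp add: conf_hyp_E_def[abs_def])
qed

text \<open>These are the choices s = - i pi and s = i pi. The point w + i pi is (w + 2 pi i) - i
  pi, so the second formula involves \<open>conf_hyp_E\<close> on the next sheet, with the same H
  and the same psi(a, c, x).\<close>

lemma conf_hyp_connection:
  obtains H where "H holomorphic_on UNIV"
    "\<And>w. H (exp w) = phase a * rGamma (c - a) * conf_hyp_U a c w + phase (a - c) * rGamma a * conf_hyp_E a c w"
    "\<And>w. H (exp w) = phase (- a) * rGamma (c - a) * conf_hyp_U a c w
        + phase (c - a) * rGamma a * conf_hyp_E a c (w + 2 * of_real pi * \<i>)"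
proof -
  obtain H where H: "kummer_connection a c H" using kummer_connection_exists by blast
  have ph: "phase a = exp (- (- (\<i> * of_real pi) * a))" "phase (a - c) = exp (- (\<i> * of_real pi) * (c - a))"
    "phase (- a) = exp (- (\<i> * of_real pi * a))" "phase (c - a) = exp (\<i> * of_real pi * (c - a))"
    by (simp_all add: phase_def algebra_simps)
  have E: "conf_hyp_E a c (w + 2 * of_real pi * \<i>) = exp (exp w) * conf_hyp_U (c - a) c (w + \<i> * of_real pi)" for w
  proof -
    have "w + 2 * of_real pi * \<i> - \<i> * of_real pi = w + \<i> * of_real pi" by (simp add: algebra_simps)
    moreover have "exp (w + 2 * of_real pi * \<i>) = exp w" by (simp add: exp_add)
    ultimately show ?thesis unfolding conf_hyp_E_def by (simp only:)
  qed
  have K: "H (exp w) = exp (- (s * a)) * rGamma (c - a) * conf_hyp_U a c w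
      + exp (s * (c - a)) * rGamma a * (exp (exp w) * conf_hyp_U (c - a) c (w + s))"
    if "s \<in> {\<i> * of_real pi, - (\<i> * of_real pi)}" for s w
    using H that unfolding kummer_connection_def by blast
  show ?thesis
  proof (rule that[of H])
    show "H holomorphic_on UNIV" using H by (simp add: kummer_connection_def)
    show "H (exp w) = phase a * rGamma (c - a) * conf_hyp_U a c w + phase (a - c) * rGamma a * conf_hyp_E a c w" for w
      using K[of "- (\<i> * of_real pi)" w] unfolding conf_hyp_E_def ph by simp
    show "H (exp w) = phase (- a) * rGamma (c - a) * conf_hyp_U a c w
        + phase (c - a) * rGamma a * conf_hyp_E a c (w + 2 * of_real pi * \<i>)" for w
      using K[of "\<i> * of_real pi" w] unfolding E ph by simp
  qed
qed

text \<open>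
  Up to the factor \<open>exp (\<alpha> w - \<zeta> / 2)\<close>, both rows of the matrix consist of solutions of Kummer's
  equation with \<open>c = 1 + 2\<alpha>\<close>: those for \<open>a = \<alpha> + \<beta>\<close> in the first row and, after Kummer's
  transformation, those for \<open>a = \<alpha> + \<beta> + 1\<close> in the second row.
\<close>

definition row_a :: "complex \<Rightarrow> complex \<Rightarrow> 2 \<Rightarrow> complex" where
  "row_a \<alpha> \<beta> i = (if i = 1 then \<alpha> + \<beta> else \<alpha> + \<beta> + 1)"

definition row_U :: "complex \<Rightarrow> complex \<Rightarrow> 2 \<Rightarrow> complex \<Rightarrow> complex" where
  "row_U \<alpha> \<beta> i w = (if i = 1 then phase (2 * \<beta> + \<alpha>)
     else - phase (\<beta> - 3 * \<alpha>) * (Gamma (1 + \<alpha> + \<beta>) * rGamma (\<alpha> - \<beta>)))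
     * conf_hyp_U (row_a \<alpha> \<beta> i) (1 + 2 * \<alpha>) w"

text \<open>The constant of the second row is e^(-i pi \<alpha>) from the matrix times e^(-2 i pi
  \<alpha>) from Kummer's transformation at e^(-i pi) x.\<close>

definition row_E :: "complex \<Rightarrow> complex \<Rightarrow> 2 \<Rightarrow> complex \<Rightarrow> complex" where
  "row_E \<alpha> \<beta> i w = (if i = 1 then - phase (\<beta> + \<alpha>) * (Gamma (1 + \<alpha> - \<beta>) * rGamma (\<alpha> + \<beta>))
     else phase (- 3 * \<alpha>)) * conf_hyp_E (row_a \<alpha> \<beta> i) (1 + 2 * \<alpha>) w"

definition prefactor :: "complex \<Rightarrow> complex \<Rightarrow> complex" where
  "prefactor \<alpha> w = exp (\<alpha> * w) * exp (- exp w / 2)"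

definition Phi :: "complex \<Rightarrow> complex \<Rightarrow> complex \<Rightarrow> complex^2^2" where
  "Phi \<alpha> \<beta> w = mat2 (prefactor \<alpha> w * row_U \<alpha> \<beta> 1 w) (prefactor \<alpha> w * row_E \<alpha> \<beta> 1 w)
     (prefactor \<alpha> w * row_U \<alpha> \<beta> 2 w) (prefactor \<alpha> w * row_E \<alpha> \<beta> 2 w)"

lemma Phi_nth: "Phi \<alpha> \<beta> w $ i $ 1 = prefactor \<alpha> w * row_U \<alpha> \<beta> i w"
  "Phi \<alpha> \<beta> w $ i $ 2 = prefactor \<alpha> w * row_E \<alpha> \<beta> i w"
  using exhaust_2[of i] by (auto simp: Phi_def)

lemma kummer_solution_scale: "kummer_solution a c g \<Longrightarrow> kummer_solution a c (\<lambda>w. p * g w)"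
  unfolding kummer_solution_iff by (rule kummer_on_scale[OF open_UNIV])

lemma kummer_solution_row:
  "kummer_solution (row_a \<alpha> \<beta> i) (1 + 2 * \<alpha>) (row_U \<alpha> \<beta> i)"
  "kummer_solution (row_a \<alpha> \<beta> i) (1 + 2 * \<alpha>) (row_E \<alpha> \<beta> i)"
  unfolding row_U_def[abs_def] row_E_def[abs_def]
  by (intro kummer_solution_scale kummer_solution_conf_hyp_U kummer_solution_conf_hyp_E)+

text \<open>The row constants are those of the connection formulas up to a common factor. The
  excluded values of \<alpha> + \<beta> and \<alpha> - \<beta> are the poles of Gamma(1 + \<alpha> +
  \<beta>) and Gamma(1 + \<alpha> - \<beta>), so these Gamma values cancel against
  \<open>rGamma\<close>.\<close>

lemma row_connection:
  assumes "\<And>n::nat. n \<ge> 1 \<Longrightarrow> \<alpha> + \<beta> \<noteq> - of_nat n \<and> \<alpha> - \<beta> \<noteq> - of_nat n"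
  obtains H where "H holomorphic_on UNIV"
    "\<And>w. row_U \<alpha> \<beta> i w + phase (\<beta> - 2 * \<alpha>) * row_E \<alpha> \<beta> i w = H (exp w)"
    "\<And>w. row_U \<alpha> \<beta> i w = phase (2 * \<beta> + 2 * \<alpha>) * H (exp w)
        - phase (\<beta> + 2 * \<alpha>) * row_E \<alpha> \<beta> i (w + 2 * of_real pi * \<i>)"
proof -
  define c where "c = 1 + 2 * \<alpha>"
  have G: "rGamma (1 + x) * Gamma (1 + x) = 1" if "\<And>n::nat. n \<ge> 1 \<Longrightarrow> x \<noteq> - of_nat n" for x :: complex
  proof -
    have "1 + x \<notin> \<int>\<^sub>\<le>\<^sub>0"
    proof
      assume "1 + x \<in> \<int>\<^sub>\<le>\<^sub>0"
      then obtain n where "1 + x = - of_nat n" by (auto elim: nonpos_Ints_cases')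
      then have "x = - of_nat n - 1" by (metis add_diff_cancel_left')
      then have "x = - of_nat (Suc n)" by simp
      then show False using that[of "Suc n"] by simp
    qed
    then show ?thesis by (simp add: rGamma_inverse_Gamma Gamma_eq_zero_iff)
  qed
  have G1: "rGamma (1 + \<alpha> - \<beta>) * Gamma (1 + \<alpha> - \<beta>) = 1" and G2: "rGamma (1 + \<alpha> + \<beta>) * Gamma (1 + \<alpha> + \<beta>) = 1"
    unfolding add_diff_eq[symmetric] add.assoc
    using G[of "\<alpha> - \<beta>"] G[of "\<alpha> + \<beta>"] assms by blast+
  obtain H where H: "H holomorphic_on UNIV"
    "\<And>w. H (exp w) = phase (row_a \<alpha> \<beta> i) * rGamma (c - row_a \<alpha> \<beta> i) * conf_hyp_U (row_a \<alpha> \<beta> i) c w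
       + phase (row_a \<alpha> \<beta> i - c) * rGamma (row_a \<alpha> \<beta> i) * conf_hyp_E (row_a \<alpha> \<beta> i) c w"
    "\<And>w. H (exp w) = phase (- row_a \<alpha> \<beta> i) * rGamma (c - row_a \<alpha> \<beta> i) * conf_hyp_U (row_a \<alpha> \<beta> i) c w
        + phase (c - row_a \<alpha> \<beta> i) * rGamma (row_a \<alpha> \<beta> i) * conf_hyp_E (row_a \<alpha> \<beta> i) c (w + 2 * of_real pi * \<i>)"
    using conf_hyp_connection[of "row_a \<alpha> \<beta> i" c] by blast
  show ?thesis
  proof (cases "i = 1")
    case True
    \<comment> \<open>Chosen to match the coefficient of psi: k e^(i pi (\<alpha> + \<beta>)) /
      Gamma(1 + \<alpha> - \<beta>) = e^(i pi (2 \<beta> + \<alpha>)).\<close>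
    define k where "k = Gamma (1 + \<alpha> - \<beta>) * phase \<beta>"
    have ra: "row_a \<alpha> \<beta> i = \<alpha> + \<beta>" "c - (\<alpha> + \<beta>) = 1 + \<alpha> - \<beta>" "\<alpha> + \<beta> - c = \<beta> - \<alpha> - 1"
      using True by (simp_all add: row_a_def c_def)
    have row: "row_U \<alpha> \<beta> i w = phase (2 * \<beta> + \<alpha>) * conf_hyp_U (\<alpha> + \<beta>) c w"
      "row_E \<alpha> \<beta> i w = - phase (\<beta> + \<alpha>) * (Gamma (1 + \<alpha> - \<beta>) * rGamma (\<alpha> + \<beta>)) * conf_hyp_E (\<alpha> + \<beta>) c w" for w
      using True by (simp_all add: row_U_def row_E_def c_def row_a_def)
    show ?thesis
    proof (rule that[of "\<lambda>x. k * H x"])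
      show "(\<lambda>x. k * H x) holomorphic_on UNIV" by (intro holomorphic_intros H(1))
      fix w
      define u where "u = conf_hyp_U (\<alpha> + \<beta>) c w"
      define v where "v = conf_hyp_E (\<alpha> + \<beta>) c w"
      define v' where "v' = conf_hyp_E (\<alpha> + \<beta>) c (w + 2 * of_real pi * \<i>)"
      define g where "g = Gamma (1 + \<alpha> - \<beta>)"
      define r where "r = rGamma (\<alpha> + \<beta>)"
      have 1: "k * H (exp w) = phase \<beta> * (phase (\<alpha> + \<beta>) * (rGamma (1 + \<alpha> - \<beta>) * g) * u + phase (\<beta> - \<alpha> - 1) * g * r * v)"
        unfolding H(2) ra k_def g_def u_def v_def r_def by (simp add: algebra_simps)
      have 2: "k * H (exp w) = phase \<beta> * (phase (- (\<alpha> + \<beta>)) * (rGamma (1 + \<alpha> - \<beta>) * g) * u + phase (1 + \<alpha> - \<beta>) * g * r * v')"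
        unfolding H(3) ra k_def g_def u_def v'_def r_def by (simp add: algebra_simps)
      show "row_U \<alpha> \<beta> i w + phase (\<beta> - 2 * \<alpha>) * row_E \<alpha> \<beta> i w = k * H (exp w)"
        unfolding 1 row u_def[symmetric] v_def[symmetric] r_def[symmetric] g_def[symmetric] G1[folded g_def]
        by (simp only: phase_simps) (simp add: field_simps power2_eq_square)
      show "row_U \<alpha> \<beta> i w = phase (2 * \<beta> + 2 * \<alpha>) * (k * H (exp w))
        - phase (\<beta> + 2 * \<alpha>) * row_E \<alpha> \<beta> i (w + 2 * of_real pi * \<i>)"
        unfolding 2 row u_def[symmetric] v'_def[symmetric] r_def[symmetric] g_def[symmetric] G1[folded g_def]
        by (simp only: phase_simps) (simp add: field_simps power2_eq_square)
    qed
  next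
    case False
    \<comment> \<open>Chosen to match the coefficient of \<open>conf_hyp_E\<close>: k e^(i pi
      (\<beta> - \<alpha>)) / Gamma(1 + \<alpha> + \<beta>) = e^(i pi (\<beta> - 5
      \<alpha>)).\<close>
    define k where "k = Gamma (1 + \<alpha> + \<beta>) * phase (- 4 * \<alpha>)"
    have ra: "row_a \<alpha> \<beta> i = 1 + \<alpha> + \<beta>" "c - (1 + \<alpha> + \<beta>) = \<alpha> - \<beta>" "1 + \<alpha> + \<beta> - c = \<beta> - \<alpha>"
      using False by (simp_all add: row_a_def c_def)
    have row: "row_U \<alpha> \<beta> i w = - phase (\<beta> - 3 * \<alpha>) * (Gamma (1 + \<alpha> + \<beta>) * rGamma (\<alpha> - \<beta>)) * conf_hyp_U (1 + \<alpha> + \<beta>) c w"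
      "row_E \<alpha> \<beta> i w = phase (- 3 * \<alpha>) * conf_hyp_E (1 + \<alpha> + \<beta>) c w" for w
      using False by (simp_all add: row_U_def row_E_def c_def ra)
    have p4: "phase (- 4 * \<alpha>) = inverse (phase \<alpha> ^ 4)" "phase (- 3 * \<alpha>) = inverse (phase \<alpha> ^ 3)"
    proof -
      have "phase (- 4 * \<alpha>) = phase (- (2 * (2 * \<alpha>)))" by simp
      also have "\<dots> = inverse (phase \<alpha> ^ 4)" by (simp only: phase_minus phase_double) (simp flip: power_mult)
      finally show "phase (- 4 * \<alpha>) = inverse (phase \<alpha> ^ 4)" .
      have "phase (- 3 * \<alpha>) = phase (- (3 * \<alpha>))" by simp
      then show "phase (- 3 * \<alpha>) = inverse (phase \<alpha> ^ 3)" by (simp only: phase_minus phase_triple)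
    qed
    show ?thesis
    proof (rule that[of "\<lambda>x. k * H x"])
      show "(\<lambda>x. k * H x) holomorphic_on UNIV" by (intro holomorphic_intros H(1))
      fix w
      define u where "u = conf_hyp_U (1 + \<alpha> + \<beta>) c w"
      define v where "v = conf_hyp_E (1 + \<alpha> + \<beta>) c w"
      define v' where "v' = conf_hyp_E (1 + \<alpha> + \<beta>) c (w + 2 * of_real pi * \<i>)"
      define g where "g = Gamma (1 + \<alpha> + \<beta>)"
      define r where "r = rGamma (\<alpha> - \<beta>)"
      have 1: "k * H (exp w) = phase (- 4 * \<alpha>) * (phase (1 + \<alpha> + \<beta>) * g * r * u + phase (\<beta> - \<alpha>) * (rGamma (1 + \<alpha> + \<beta>) * g) * v)"
        unfolding H(2) ra k_def g_def u_def v_def r_def by (simp add: algebra_simps)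
      have 2: "k * H (exp w) = phase (- 4 * \<alpha>) * (phase (- (1 + \<alpha> + \<beta>)) * g * r * u + phase (\<alpha> - \<beta>) * (rGamma (1 + \<alpha> + \<beta>) * g) * v')"
        unfolding H(3) ra k_def g_def u_def v'_def r_def by (simp add: algebra_simps)
      show "row_U \<alpha> \<beta> i w + phase (\<beta> - 2 * \<alpha>) * row_E \<alpha> \<beta> i w = k * H (exp w)"
        unfolding 1 row u_def[symmetric] v_def[symmetric] r_def[symmetric] g_def[symmetric] G2[folded g_def] p4
        by (simp only: phase_simps) (simp add: field_simps power2_eq_square power3_eq_cube power4_eq_xxxx)
      show "row_U \<alpha> \<beta> i w = phase (2 * \<beta> + 2 * \<alpha>) * (k * H (exp w))
        - phase (\<beta> + 2 * \<alpha>) * row_E \<alpha> \<beta> i (w + 2 * of_real pi * \<i>)"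
        unfolding 2 row u_def[symmetric] v'_def[symmetric] r_def[symmetric] g_def[symmetric] G2[folded g_def] p4
        by (simp only: phase_simps) (simp add: field_simps power2_eq_square power3_eq_cube power4_eq_xxxx)
    qed
  qed
qed

lemma prefactor_shift: "prefactor \<alpha> (w + 2 * of_real pi * \<i>) = phase \<alpha> ^ 2 * prefactor \<alpha> w"
proof -
  have "exp (\<alpha> * (w + 2 * of_real pi * \<i>)) = phase (2 * \<alpha>) * exp (\<alpha> * w)"
    by (simp add: phase_def algebra_simps exp_add)
  then show ?thesis by (simp add: prefactor_def exp_add phase_double)
qed

text \<open>This is the jump on the positive ray, whose two sides see the same point on sheets that
  differ by 2 pi i. The relations with the single-valued H express all four row values through
  H(e^w) and \<open>row_E\<close> on the upper sheet; the prefactor contributes A^2.\<close>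

lemma Phi_monodromy:
  assumes "\<And>n::nat. n \<ge> 1 \<Longrightarrow> \<alpha> + \<beta> \<noteq> - of_nat n \<and> \<alpha> - \<beta> \<noteq> - of_nat n"
  shows "Phi \<alpha> \<beta> w ** sector_factor \<alpha> \<beta> 7 =
    (Phi \<alpha> \<beta> (w + 2 * of_real pi * \<i>) ** sector_factor \<alpha> \<beta> 6) ** jump \<alpha> \<beta> 7"
proof -
  define A where "A = phase \<alpha>"
  define B where "B = phase \<beta>"
  have nz: "A \<noteq> 0" "B \<noteq> 0" by (simp_all add: A_def B_def)
  have "(Phi \<alpha> \<beta> w ** sector_factor \<alpha> \<beta> 7) $ i $ j =
    (Phi \<alpha> \<beta> (w + 2 * of_real pi * \<i>) ** (sector_factor \<alpha> \<beta> 6 ** jump \<alpha> \<beta> 7)) $ i $ j" for i j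
  proof -
    obtain H where "H holomorphic_on UNIV" and
      H: "\<And>w. row_U \<alpha> \<beta> i w + phase (\<beta> - 2 * \<alpha>) * row_E \<alpha> \<beta> i w = H (exp w)"
      "\<And>w. row_U \<alpha> \<beta> i w = phase (2 * \<beta> + 2 * \<alpha>) * H (exp w)
        - phase (\<beta> + 2 * \<alpha>) * row_E \<alpha> \<beta> i (w + 2 * of_real pi * \<i>)"
      by (rule row_connection[OF assms, of i]) (rule that | assumption)+
    let ?w = "w + 2 * of_real pi * \<i>"
    have ew: "exp ?w = exp w" by (simp add: exp_add)
    define h where "h = H (exp w)"
    define u where "u = row_U \<alpha> \<beta> i w"
    define v where "v = row_E \<alpha> \<beta> i w"
    define u' where "u' = row_U \<alpha> \<beta> i ?w"
    define v' where "v' = row_E \<alpha> \<beta> i ?w"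
    define g where "g = prefactor \<alpha> w"
    have 1: "u + B / A ^ 2 * v = h" "u' + B / A ^ 2 * v' = h" "u = B ^ 2 * A ^ 2 * h - B * A ^ 2 * v'"
      using H(1)[of w] H(1)[of ?w] H(2)[of w] unfolding ew
      by (simp_all add: u_def v_def u'_def v'_def h_def A_def B_def phase_simps)
    have u': "u' = h - B / A ^ 2 * v'" using 1(2) by (simp add: algebra_simps)
    have v: "B * v = A ^ 2 * (h - u)" using 1(1) nz by (simp add: field_simps)
    have F: "sector_factor \<alpha> \<beta> 6 ** jump \<alpha> \<beta> 7 = mat2 1 (- B) (B / A ^ 2) (1 - B ^ 2 / A ^ 2)"
      unfolding sector_factor_phase jump_phase A_def[symmetric] B_def[symmetric] mat2_mult
      using nz by (simp add: field_simps power2_eq_square power3_eq_cube)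
    have p: "Phi \<alpha> \<beta> ?w $ i $ 1 = A ^ 2 * g * u'" "Phi \<alpha> \<beta> ?w $ i $ 2 = A ^ 2 * g * v'"
      "Phi \<alpha> \<beta> w $ i $ 1 = g * u" "Phi \<alpha> \<beta> w $ i $ 2 = g * v"
      by (simp_all add: Phi_nth prefactor_shift g_def u_def v_def u'_def v'_def A_def)
    have c1: "g * u * A ^ 2 + g * v * B = A ^ 2 * g * u' * 1 + A ^ 2 * g * v' * (B / A ^ 2)"
    proof -
      have "g * u * A ^ 2 + g * v * B = g * (u * A ^ 2 + B * v)" by (simp add: algebra_simps)
      also have "\<dots> = A ^ 2 * g * h" unfolding v by (simp add: algebra_simps)
      also have "\<dots> = A ^ 2 * g * u' * 1 + A ^ 2 * g * v' * (B / A ^ 2)"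
        unfolding u' by (simp add: algebra_simps)
      finally show ?thesis .
    qed
    have c2: "g * u * (- (1 / B)) + g * v * 0 = A ^ 2 * g * u' * (- B) + A ^ 2 * g * v' * (1 - B ^ 2 / A ^ 2)"
      unfolding u' 1(3) using nz by (simp add: field_simps power2_eq_square)
    show ?thesis
      unfolding F unfolding sector_factor_phase A_def[symmetric] B_def[symmetric]
      using exhaust_2[of j] c1 c2 by (auto simp: matrix_mult_2_nth p)
  qed
  then show ?thesis unfolding vec_eq_iff matrix_mul_assoc by blast
qed

section \<open>Contour and sectors\<close>

lemma exp_lift:
  assumes "\<zeta> \<noteq> 0"
  shows "exp (lift \<zeta>) = \<zeta>"
proof -
  have "exp (lift \<zeta>) = of_real (norm \<zeta>) * exp (\<i> * of_real (Arg2pi \<zeta>))"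
    using assms by (simp add: lift_def complex_eq_iff Re_exp Im_exp)
  also have "\<dots> = \<zeta>" using Arg2pi_eq[of \<zeta>] by simp
  finally show ?thesis .
qed

lemma lift_exp:
  assumes "0 \<le> Im w" "Im w < 2 * pi"
  shows "lift (exp w) = w"
  using assms by (simp add: lift_def Arg2pi_exp complex_eq_iff)

text \<open>The sign moves the cut of \<open>Ln\<close> to the positive axis, so holomorphy and
  continuity of the branch are inherited from \<open>Ln\<close>.\<close>

lemma lift_eq_Ln:
  assumes "\<zeta> \<notin> \<real>\<^sub>\<ge>\<^sub>0"
  shows "lift \<zeta> = Ln (- \<zeta>) + \<i> * of_real pi"
proof -
  have "\<zeta> \<noteq> 0" using assms by auto
  have "Arg2pi \<zeta> \<noteq> 0" using assms by (auto simp: Arg2pi_eq_0 complex_nonneg_Reals_iff complex_is_Real_iff)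
  then have "0 < Arg2pi \<zeta>" using Arg2pi_ge_0[of \<zeta>] by linarith
  then have "Arg2pi \<zeta> = Im (Ln (- \<zeta>)) + pi" by (rule Arg2pi_Ln)
  then show ?thesis using \<open>\<zeta> \<noteq> 0\<close> by (auto simp: lift_def complex_eq_iff)
qed

lemma lift_holomorphic: "lift holomorphic_on - \<real>\<^sub>\<ge>\<^sub>0"
proof -
  have "(\<lambda>\<zeta>. Ln (- \<zeta>) + \<i> * of_real pi) holomorphic_on - \<real>\<^sub>\<ge>\<^sub>0"
    by (intro holomorphic_intros) (auto simp: complex_nonneg_Reals_iff complex_nonpos_Reals_iff)
  then show ?thesis
    by (rule holomorphic_transform) (simp add: lift_eq_Ln)
qed

lemma isCont_lift: "s \<notin> \<real>\<^sub>\<ge>\<^sub>0 \<Longrightarrow> isCont lift s"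
  using holomorphic_on_imp_continuous_on[OF lift_holomorphic]
  by (auto simp: continuous_on_eq_continuous_at open_Compl closed_nonneg_Reals_complex)

text \<open>Kummer's transformation brings the second row from second parameter 1 - 2 \<alpha> to 1
  + 2 \<alpha>, which replaces its prefactor \<zeta>^(-\<alpha>) by \<zeta>^\<alpha>. In the second
  column e^(\<zeta>/2) is split as e^(-\<zeta>/2) e^\<zeta>.\<close>

lemma Psi_I_eq_Phi:
  assumes "\<zeta> \<noteq> 0"
  shows "Psi_I \<alpha> \<beta> \<zeta> = Phi \<alpha> \<beta> (lift \<zeta>)"
proof -
  define w where "w = lift \<zeta>"
  define w' where "w' = w - \<i> * of_real pi"
  have x: "\<zeta> = exp w" using exp_lift[OF assms] by (simp add: w_def)
  have half: "exp (- exp w / 2) * exp (exp w) = exp (exp w / 2)"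
    by (simp flip: exp_add)
  have c: "1 + 2 * \<alpha> - (\<alpha> + \<beta>) = 1 + \<alpha> - \<beta>" "1 + 2 * \<alpha> - (\<alpha> + \<beta> + 1) = \<alpha> - \<beta>" by simp_all
  have U2: "conf_hyp_U (\<alpha> + \<beta> + 1) (1 + 2 * \<alpha>) w = exp (- 2 * \<alpha> * w) * conf_hyp_U (1 - \<alpha> + \<beta>) (1 - 2 * \<alpha>) w"
  proof -
    have "\<alpha> + \<beta> + 1 - (1 + 2 * \<alpha>) + 1 = 1 - \<alpha> + \<beta>" "2 - (1 + 2 * \<alpha>) = 1 - 2 * \<alpha>" "(1 - (1 + 2 * \<alpha>)) * w = - 2 * \<alpha> * w"
      by (simp_all add: algebra_simps)
    then show ?thesis using conf_hyp_U_kummer_transform[of "\<alpha> + \<beta> + 1" "1 + 2 * \<alpha>" w] by (simp only:)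
  qed
  have V2: "conf_hyp_U (\<alpha> - \<beta>) (1 + 2 * \<alpha>) w' = exp (- 2 * \<alpha> * w) * phase (2 * \<alpha>) * conf_hyp_U (- \<alpha> - \<beta>) (1 - 2 * \<alpha>) w'"
  proof -
    have "\<alpha> - \<beta> - (1 + 2 * \<alpha>) + 1 = - \<alpha> - \<beta>" "2 - (1 + 2 * \<alpha>) = 1 - 2 * \<alpha>"
      by (simp_all add: algebra_simps)
    moreover have "exp ((1 - (1 + 2 * \<alpha>)) * w') = exp (- 2 * \<alpha> * w) * phase (2 * \<alpha>)"
      by (simp add: phase_def w'_def algebra_simps flip: exp_add)
    ultimately show ?thesis using conf_hyp_U_kummer_transform[of "\<alpha> - \<beta>" "1 + 2 * \<alpha>" w'] by (simp only:)
  qed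
  have m: "exp (\<alpha> * w) * exp (- 2 * \<alpha> * w) = exp (- \<alpha> * w)"
    by (simp add: algebra_simps flip: exp_add)
  have p3: "phase (- 3 * \<alpha>) * phase (2 * \<alpha>) = phase (- \<alpha>)"
    by (simp add: algebra_simps flip: phase_add)
  have 1: "Psi_I \<alpha> \<beta> \<zeta> = mat2
     (exp (\<alpha> * w) * conf_hyp_U (\<alpha> + \<beta>) (1 + 2 * \<alpha>) w * phase (2 * \<beta> + \<alpha>) * exp (- exp w / 2))
       (- exp (\<alpha> * w) * conf_hyp_U (1 + \<alpha> - \<beta>) (1 + 2 * \<alpha>) w' * phase (\<beta> + \<alpha>) * exp (exp w / 2)
          * (Gamma (1 + \<alpha> - \<beta>) * rGamma (\<alpha> + \<beta>)))
       (- exp (- \<alpha> * w) * conf_hyp_U (1 - \<alpha> + \<beta>) (1 - 2 * \<alpha>) w * phase (\<beta> - 3 * \<alpha>)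
          * exp (- exp w / 2) * (Gamma (1 + \<alpha> + \<beta>) * rGamma (\<alpha> - \<beta>)))
       (exp (- \<alpha> * w) * conf_hyp_U (- \<alpha> - \<beta>) (1 - 2 * \<alpha>) w' * phase (- \<alpha>) * exp (exp w / 2))"
    unfolding Psi_I_def Let_def branch_powr_def w_def[symmetric] w'_def[symmetric] phase_def[symmetric]
    unfolding x ..
  have 2: "prefactor \<alpha> w * row_U \<alpha> \<beta> 1 w = exp (\<alpha> * w) * conf_hyp_U (\<alpha> + \<beta>) (1 + 2 * \<alpha>) w * phase (2 * \<beta> + \<alpha>) * exp (- exp w / 2)"
    by (simp add: prefactor_def row_U_def row_a_def)
  have 3: "prefactor \<alpha> w * row_E \<alpha> \<beta> 1 w = - exp (\<alpha> * w) * conf_hyp_U (1 + \<alpha> - \<beta>) (1 + 2 * \<alpha>) w' * phase (\<beta> + \<alpha>) * exp (exp w / 2)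
          * (Gamma (1 + \<alpha> - \<beta>) * rGamma (\<alpha> + \<beta>))"
    unfolding half[symmetric] by (simp add: prefactor_def row_E_def row_a_def conf_hyp_E_def c w'_def)
  have 4: "prefactor \<alpha> w * row_U \<alpha> \<beta> 2 w = - exp (- \<alpha> * w) * conf_hyp_U (1 - \<alpha> + \<beta>) (1 - 2 * \<alpha>) w * phase (\<beta> - 3 * \<alpha>)
          * exp (- exp w / 2) * (Gamma (1 + \<alpha> + \<beta>) * rGamma (\<alpha> - \<beta>))"
    unfolding m[symmetric] by (simp add: prefactor_def row_U_def row_a_def U2)
  have 5: "prefactor \<alpha> w * row_E \<alpha> \<beta> 2 w = exp (- \<alpha> * w) * conf_hyp_U (- \<alpha> - \<beta>) (1 - 2 * \<alpha>) w' * phase (- \<alpha>) * exp (exp w / 2)"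
    unfolding m[symmetric] half[symmetric] p3[symmetric]
    using V2 by (simp add: prefactor_def row_E_def row_a_def conf_hyp_E_def c w'_def)
  show ?thesis unfolding 1 Phi_def w_def[symmetric] 2 3 4 5 ..
qed

lemma Phi_mult_holomorphic:
  fixes F :: "complex^2^2"
  shows "(\<lambda>w. (Phi \<alpha> \<beta> w ** F) $ i $ j) holomorphic_on UNIV"
proof -
  have "row_U \<alpha> \<beta> i holomorphic_on UNIV" "row_E \<alpha> \<beta> i holomorphic_on UNIV"
    using kummer_solution_row[of \<alpha> \<beta> i] by (auto simp: kummer_solution_def)
  then show ?thesis
    unfolding matrix_mult_2_nth Phi_nth prefactor_def by (intro holomorphic_intros) auto
qed

lemma tendsto_Phi_mult:
  fixes F :: "complex^2^2"
  assumes "(h \<longlongrightarrow> w) net"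
  shows "((\<lambda>x. Phi \<alpha> \<beta> (h x) ** F) \<longlongrightarrow> Phi \<alpha> \<beta> w ** F) net"
proof (intro vec_tendstoI)
  fix i j
  have "isCont (\<lambda>w. (Phi \<alpha> \<beta> w ** F) $ i $ j) w"
    using holomorphic_on_imp_continuous_on[OF Phi_mult_holomorphic] by (simp add: continuous_on_eq_continuous_at)
  from isCont_tendsto_compose[OF this assms]
  show "((\<lambda>x. (Phi \<alpha> \<beta> (h x) ** F) $ i $ j) \<longlongrightarrow> (Phi \<alpha> \<beta> w ** F) $ i $ j) net" .
qed

text \<open>The window from pi / 2 to 5 pi / 2 is the full turn between \<theta> 1 and \<theta> 9,
  so two arguments in it cannot differ by a nonzero multiple of 2 pi.\<close>

lemma angle_unique:
  assumes "exp w = exp w'" "pi / 2 \<le> Im w" "Im w < 5 * pi / 2" "pi / 2 \<le> Im w'" "Im w' < 5 * pi / 2"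
  shows "Im w = Im w'"
proof -
  obtain n :: int where n: "w = w' + (of_int (2 * n) * pi) * \<i>" using assms(1) unfolding exp_eq by blast
  then have im: "Im w = Im w' + 2 * of_int n * pi" by simp
  then have "\<bar>of_int n * pi\<bar> < 1 * pi" using assms(2-5) unfolding abs_less_iff by linarith
  then have "\<bar>of_int n\<bar> < (1 :: real)" by (simp add: abs_mult)
  then have "n = 0" by linarith
  then show ?thesis using im by simp
qed

lemma rcis_exp: "r > 0 \<Longrightarrow> rcis r t = exp (Complex (ln r) t)"
  by (simp add: complex_eq_iff Re_exp Im_exp)

lemma sector_eq: "sector \<theta> k = exp ` {w. \<theta> k < Im w \<and> Im w < \<theta> (k + 1)}"
proof (intro equalityI subsetI)
  fix z assume "z \<in> sector \<theta> k"
  then obtain r t where "r > 0" "\<theta> k < t" "t < \<theta> (k + 1)" "z = rcis r t" by (auto simp: sector_def)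
  then show "z \<in> exp ` {w. \<theta> k < Im w \<and> Im w < \<theta> (k + 1)}"
    by (auto simp: rcis_exp intro!: image_eqI[of _ _ "Complex (ln r) t"])
next
  fix z assume "z \<in> exp ` {w. \<theta> k < Im w \<and> Im w < \<theta> (k + 1)}"
  then obtain w where w: "z = exp w" "\<theta> k < Im w" "Im w < \<theta> (k + 1)" by auto
  have "z = rcis (exp (Re w)) (Im w)" by (simp add: w rcis_exp)
  then show "z \<in> sector \<theta> k" using w(2,3) unfolding sector_def by (intro CollectI exI conjI) auto
qed

lemma sector_obtain:
  assumes "z \<in> sector \<theta> k"
  obtains w where "z = exp w" "\<theta> k < Im w" "Im w < \<theta> (k + 1)"
  using assms unfolding sector_eq by auto

lemma sector_nonzero: "z \<in> sector \<theta> k \<Longrightarrow> z \<noteq> 0"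
  by (auto elim!: sector_obtain)

lemma open_sector: "open (sector \<theta> k)"
  unfolding sector_eq
proof (rule open_mapping_thm[of exp UNIV])
  show "open {w. \<theta> k < Im w \<and> Im w < \<theta> (k + 1)}"
    by (intro open_Collect_conj open_Collect_less continuous_intros)
  show "\<not> exp constant_on (UNIV :: complex set)"
  proof
    assume "exp constant_on (UNIV :: complex set)"
    then obtain y :: complex where "\<And>x. exp x = y" unfolding constant_on_def by blast
    then have "exp 0 = exp (\<i> * complex_of_real pi)" by metis
    then show False by (simp add: mult.commute)
  qed
qed (auto intro: holomorphic_intros)

lemma polar_not_nonneg_Real:
  assumes "pi / 2 \<le> Im w" "Im w < 5 * pi / 2" "Im w \<noteq> 2 * pi"
  shows "exp w \<notin> \<real>\<^sub>\<ge>\<^sub>0"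
proof
  assume "exp w \<in> \<real>\<^sub>\<ge>\<^sub>0"
  then obtain x where x: "exp w = complex_of_real x" "x \<ge> 0" by (auto elim: nonneg_Reals_cases)
  then have "x \<noteq> 0" by (metis exp_not_eq_zero of_real_0)
  then have "exp w = exp (Complex (ln x) (2 * pi))"
    using x by (simp add: complex_eq_iff Re_exp Im_exp)
  then have "Im w = Im (Complex (ln x) (2 * pi))"
    using assms pi_gt_zero by (intro angle_unique) auto
  then show False using assms(3) by simp
qed

section \<open>Sectors, analyticity and jump relations\<close>

context
  fixes \<theta> :: "nat \<Rightarrow> real"
  assumes angles: "contour_angles \<theta>"
begin

lemma angles_mono:
  assumes "1 \<le> j" "j < k" "k \<le> 9"
  shows "\<theta> j < \<theta> k"
proof -
  have step: "\<theta> n < \<theta> (Suc n)" if "1 \<le> n" "n \<le> 8" for n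
  proof -
    from that consider "n = 1" | "n = 2" | "n = 3" | "n = 4" | "n = 5" | "n = 6" | "n = 7" | "n = 8" by linarith
    then show ?thesis using angles unfolding contour_angles_def by cases (simp_all add: eval_nat_numeral)
  qed
  show ?thesis using \<open>j < k\<close> \<open>k \<le> 9\<close>
  proof (induction k)
    case (Suc k)
    show ?case
    proof (cases "j = k")
      case True
      then show ?thesis using step[of k] assms(1) Suc.prems by simp
    next
      case False
      then have "\<theta> j < \<theta> k" using Suc by simp
      also have "\<theta> k < \<theta> (Suc k)" using step[of k] assms(1) Suc.prems by simp
      finally show ?thesis .
    qed
  qed simp
qed

lemma angles_range:
  assumes "k \<in> {1..8}"
  shows "pi / 2 \<le> \<theta> k" "\<theta> (k + 1) \<le> 5 * pi / 2" "\<theta> k < \<theta> (k + 1)"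
proof -
  have e: "\<theta> 1 = pi / 2" "\<theta> 9 = 5 * pi / 2" using angles by (simp_all add: contour_angles_def)
  show "pi / 2 \<le> \<theta> k" using assms angles_mono[of 1 k] e by (cases "k = 1") auto
  show "\<theta> (k + 1) \<le> 5 * pi / 2" using assms angles_mono[of "k + 1" 9] e by (cases "k = 8") auto
  show "\<theta> k < \<theta> (k + 1)" using assms by (intro angles_mono) auto
qed

lemma sector_unique:
  assumes "j \<in> {1..8}" "k \<in> {1..8}" "z \<in> sector \<theta> j" "z \<in> sector \<theta> k"
  shows "j = k"
proof -
  obtain w where w: "z = exp w" "\<theta> j < Im w" "Im w < \<theta> (j + 1)" using assms(3) by (rule sector_obtain)
  obtain v where v: "z = exp v" "\<theta> k < Im v" "Im v < \<theta> (k + 1)" using assms(4) by (rule sector_obtain)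
  have "Im w = Im v"
    using w v angles_range[OF assms(1)] angles_range[OF assms(2)] by (intro angle_unique) auto
  show ?thesis
  proof (rule linorder_cases[of j k])
    assume "j < k"
    then have "\<theta> (j + 1) \<le> \<theta> k" using angles_mono[of "j + 1" k] assms by (cases "j + 1 = k") auto
    then show ?thesis using w v \<open>Im w = Im v\<close> by simp
  next
    assume "k < j"
    then have "\<theta> (k + 1) \<le> \<theta> j" using angles_mono[of "k + 1" j] assms by (cases "k + 1 = j") auto
    then show ?thesis using w v \<open>Im w = Im v\<close> by simp
  qed simp
qed

lemma sector_not_nonneg_Real:
  assumes "k \<in> {1..8}" "z \<in> sector \<theta> k"
  shows "z \<notin> \<real>\<^sub>\<ge>\<^sub>0"
proof -
  obtain w where w: "z = exp w" "\<theta> k < Im w" "Im w < \<theta> (k + 1)" using assms(2) by (rule sector_obtain)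
  have 7: "\<theta> 7 = 2 * pi" using angles by (simp add: contour_angles_def)
  have "Im w \<noteq> 2 * pi"
  proof (cases "k < 7")
    case True
    then have "\<theta> (k + 1) \<le> \<theta> 7" using angles_mono[of "k + 1" 7] by (cases "k + 1 = 7") auto
    then show ?thesis using w 7 by simp
  next
    case False
    then have "\<theta> 7 \<le> \<theta> k" using angles_mono[of 7 k] assms by (cases "k = 7") auto
    then show ?thesis using w 7 by simp
  qed
  then show ?thesis unfolding w(1) using w angles_range[OF assms(1)]
    by (intro polar_not_nonneg_Real) auto
qed

lemma sectors_cover:
  assumes "z \<notin> contour \<theta>"
  obtains k where "k \<in> {1..8}" "z \<in> sector \<theta> k"
proof -
  have e: "\<theta> 1 = pi / 2" "\<theta> 9 = 5 * pi / 2" using angles by (simp_all add: contour_angles_def)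
  have "rcis 0 (\<theta> 1) \<in> ray \<theta> 1" unfolding ray_def by blast
  then have "0 \<in> contour \<theta>" unfolding contour_def by (auto simp del: One_nat_def)
  then have "z \<noteq> 0" using assms by auto
  \<comment> \<open>\<open>lift\<close> has its argument in [0, 2 pi); an argument below pi / 2 is
    raised by a full turn to fall into the window that starts at the first ray.\<close>
  define w where "w = (if Arg2pi z < pi / 2 then lift z + 2 * of_real pi * \<i> else lift z)"
  have z: "exp w = z" using exp_lift[OF \<open>z \<noteq> 0\<close>] by (simp add: w_def exp_add)
  have im: "pi / 2 \<le> Im w" "Im w < 5 * pi / 2"
    using Arg2pi_ge_0[of z] Arg2pi_lt_2pi[of z] by (auto simp: w_def lift_def)
  have "\<exists>k\<in>{1..8}. \<theta> k \<le> Im w \<and> Im w < \<theta> (k + 1)"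
  proof (rule ccontr)
    assume "\<not> ?thesis"
    then have *: "\<theta> (k + 1) \<le> Im w" if "1 \<le> k" "k \<le> 8" "\<theta> k \<le> Im w" for k
      using that by force
    have "\<theta> (Suc n) \<le> Im w" if "n \<le> 8" for n using that
    proof (induction n)
      case 0
      then show ?case using im e by simp
    next
      case (Suc n)
      then show ?case using *[of "Suc n"] by simp
    qed
    from this[of 8] show False using im e by simp
  qed
  then obtain k where k: "k \<in> {1..8}" "\<theta> k \<le> Im w" "Im w < \<theta> (k + 1)" by blast
  have "\<theta> k \<noteq> Im w"
  proof
    assume "\<theta> k = Im w"
    then have "z = rcis (exp (Re w)) (\<theta> k)" using z by (simp add: rcis_exp)
    then have "z \<in> ray \<theta> k" unfolding ray_def by (intro CollectI exI[of _ "exp (Re w)"]) auto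
    then show False using assms k(1) unfolding contour_def by blast
  qed
  then have "z \<in> sector \<theta> k" using k z unfolding sector_eq by (auto intro!: image_eqI[of _ _ w])
  then show ?thesis using that k(1) by blast
qed

lemma Psi_sector:
  assumes "k \<in> {1..8}" "z \<in> sector \<theta> k"
  shows "Psi \<theta> \<alpha> \<beta> z = Psi_I \<alpha> \<beta> z ** sector_factor \<alpha> \<beta> k"
    and "Psi \<theta> \<alpha> \<beta> z = Phi \<alpha> \<beta> (lift z) ** sector_factor \<alpha> \<beta> k"
proof -
  have "(THE k. k \<in> {1..8} \<and> z \<in> sector \<theta> k) = k"
  proof (rule the_equality)
    show "k \<in> {1..8} \<and> z \<in> sector \<theta> k" using assms by blast
    show "j = k" if "j \<in> {1..8} \<and> z \<in> sector \<theta> j" for j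
      using sector_unique[OF _ assms(1) _ assms(2)] that by blast
  qed
  then show "Psi \<theta> \<alpha> \<beta> z = Psi_I \<alpha> \<beta> z ** sector_factor \<alpha> \<beta> k" by (simp add: Psi_def)
  then show "Psi \<theta> \<alpha> \<beta> z = Phi \<alpha> \<beta> (lift z) ** sector_factor \<alpha> \<beta> k"
    using Psi_I_eq_Phi[OF sector_nonzero[OF assms(2)]] by simp
qed

lemma rhp_analytic_Psi: "rhp_analytic \<theta> (Psi \<theta> \<alpha> \<beta>)"
  unfolding rhp_analytic_def
proof (intro allI)
  fix i j
  show "(\<lambda>z. Psi \<theta> \<alpha> \<beta> z $ i $ j) analytic_on - contour \<theta>"
    unfolding analytic_on_analytic_at[of _ "- contour \<theta>"]
  proof
    fix z assume "z \<in> - contour \<theta>"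
    then obtain k where k: "k \<in> {1..8}" "z \<in> sector \<theta> k" using sectors_cover by blast
    have "(\<lambda>z. (Phi \<alpha> \<beta> (lift z) ** sector_factor \<alpha> \<beta> k) $ i $ j) holomorphic_on sector \<theta> k"
    proof -
      have "lift holomorphic_on sector \<theta> k"
        by (rule holomorphic_on_subset[OF lift_holomorphic]) (use sector_not_nonneg_Real[OF k(1)] in auto)
      from holomorphic_on_compose_gen[OF this Phi_mult_holomorphic[of \<alpha> \<beta> "sector_factor \<alpha> \<beta> k" i j]]
      show ?thesis by (simp add: o_def)
    qed
    then have "(\<lambda>z. Psi \<theta> \<alpha> \<beta> z $ i $ j) holomorphic_on sector \<theta> k"
      by (rule holomorphic_transform) (simp add: Psi_sector(2)[OF k(1)])
    then show "(\<lambda>z. Psi \<theta> \<alpha> \<beta> z $ i $ j) analytic_on {z}"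
      using open_sector k(2) unfolding analytic_at by blast
  qed
qed

lemma Psi_tendsto:
  assumes "k \<in> {1..8}" "(lift \<longlongrightarrow> w) (at s within sector \<theta> k)"
  shows "(Psi \<theta> \<alpha> \<beta> \<longlongrightarrow> Phi \<alpha> \<beta> w ** sector_factor \<alpha> \<beta> k) (at s within sector \<theta> k)"
proof (rule Lim_transform_eventually[OF tendsto_Phi_mult[OF assms(2)]])
  show "\<forall>\<^sub>F z in at s within sector \<theta> k. Phi \<alpha> \<beta> (lift z) ** sector_factor \<alpha> \<beta> k = Psi \<theta> \<alpha> \<beta> z"
    unfolding eventually_at_filter by (rule always_eventually) (simp add: Psi_sector(2)[OF assms(1)])
qed

lemma rhp_jumps_Psi:
  assumes nz: "\<And>n::nat. n \<ge> 1 \<Longrightarrow> \<alpha> + \<beta> \<noteq> - of_nat n \<and> \<alpha> - \<beta> \<noteq> - of_nat n"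
  shows "rhp_jumps \<theta> \<alpha> \<beta> (Psi \<theta> \<alpha> \<beta>)"
  unfolding rhp_jumps_def
proof
  fix k :: nat assume k: "k \<in> {1..8}"
  have sides: "plus_side k \<in> {1..8}" "minus_side k \<in> {1..8}"
    using k by (auto simp: plus_side_def minus_side_def)
  have t7: "\<theta> 7 = 2 * pi" "\<theta> 5 = 3 * pi / 2" "\<theta> 9 = 5 * pi / 2" using angles by (simp_all add: contour_angles_def)
  have ray: "\<exists>w. s = exp w \<and> Im w = \<theta> k" if s: "s \<in> ray \<theta> k - {0}" for s
  proof -
    obtain r where r: "s = rcis r (\<theta> k)" "r \<ge> 0" using s by (auto simp: ray_def)
    moreover have "s \<noteq> 0" using s by simp
    ultimately have "r > 0" by (cases "r = 0") auto
    then show ?thesis using r(1) by (intro exI[of _ "Complex (ln r) (\<theta> k)"]) (simp add: rcis_exp)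
  qed
  show "\<exists>\<Psi>p \<Psi>m. continuous_on (ray \<theta> k - {0}) \<Psi>p \<and> continuous_on (ray \<theta> k - {0}) \<Psi>m \<and>
        (\<forall>s\<in>ray \<theta> k - {0}.
           (Psi \<theta> \<alpha> \<beta> \<longlongrightarrow> \<Psi>p s) (at s within sector \<theta> (plus_side k)) \<and>
           (Psi \<theta> \<alpha> \<beta> \<longlongrightarrow> \<Psi>m s) (at s within sector \<theta> (minus_side k)) \<and>
           \<Psi>p s = \<Psi>m s ** jump \<alpha> \<beta> k)"
  proof (cases "k = 7")
    case False
    have notin: "s \<notin> \<real>\<^sub>\<ge>\<^sub>0" if s: "s \<in> ray \<theta> k - {0}" for s
    proof -
      obtain w where w: "s = exp w" "Im w = \<theta> k" using ray[OF s] by blast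
      have "\<theta> k \<noteq> \<theta> 7" using angles_mono[of k 7] angles_mono[of 7 k] False k
        by (cases "k < 7") auto
      then show ?thesis unfolding w(1) using w(2) angles_range[OF k] t7
        by (intro polar_not_nonneg_Real) auto
    qed
    \<comment> \<open>Off the seventh ray \<open>lift\<close> is continuous, so both boundary values
      are the same matrix \<open>Phi\<close> times the factors of the adjacent sectors.\<close>
    have lim: "(lift \<longlongrightarrow> lift s) (at s within T)" if "s \<in> ray \<theta> k - {0}" for s T
      using isCont_lift[OF notin[OF that]] unfolding isCont_def by (rule tendsto_within_subset) auto
    have cont: "continuous_on (ray \<theta> k - {0}) (\<lambda>s. Phi \<alpha> \<beta> (lift s) ** F)" for F :: "complex^2^2"
      unfolding continuous_on_def by (intro ballI tendsto_Phi_mult lim)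
    show ?thesis
    proof (intro exI conjI ballI)
      show "continuous_on (ray \<theta> k - {0}) (\<lambda>s. Phi \<alpha> \<beta> (lift s) ** sector_factor \<alpha> \<beta> (plus_side k))" by (rule cont)
      show "continuous_on (ray \<theta> k - {0}) (\<lambda>s. Phi \<alpha> \<beta> (lift s) ** sector_factor \<alpha> \<beta> (minus_side k))" by (rule cont)
      fix s assume s: "s \<in> ray \<theta> k - {0}"
      show "(Psi \<theta> \<alpha> \<beta> \<longlongrightarrow> Phi \<alpha> \<beta> (lift s) ** sector_factor \<alpha> \<beta> (plus_side k)) (at s within sector \<theta> (plus_side k))"
        by (rule Psi_tendsto[OF sides(1) lim[OF s]])
      show "(Psi \<theta> \<alpha> \<beta> \<longlongrightarrow> Phi \<alpha> \<beta> (lift s) ** sector_factor \<alpha> \<beta> (minus_side k)) (at s within sector \<theta> (minus_side k))"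
        by (rule Psi_tendsto[OF sides(2) lim[OF s]])
      show "Phi \<alpha> \<beta> (lift s) ** sector_factor \<alpha> \<beta> (plus_side k) = Phi \<alpha> \<beta> (lift s) ** sector_factor \<alpha> \<beta> (minus_side k) ** jump \<alpha> \<beta> k"
        unfolding sector_factor_jump[OF k False] matrix_mul_assoc ..
    qed
  next
    case True
    have pos: "s \<notin> \<real>\<^sub>\<le>\<^sub>0" if s: "s \<in> ray \<theta> k - {0}" for s
    proof -
      obtain w where w: "s = exp w" "Im w = \<theta> k" using ray[OF s] by blast
      then have "s = of_real (exp (Re w))" using t7 True by (simp add: complex_eq_iff Re_exp Im_exp)
      then show ?thesis by (simp add: complex_nonpos_Reals_iff)
    qed
    have Ln: "(Ln \<longlongrightarrow> Ln s) (at s within T)" if "s \<in> ray \<theta> k - {0}" for s T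
      using continuous_at_Ln[OF pos[OF that]] unfolding isCont_def by (rule tendsto_within_subset) auto
    \<comment> \<open>Sector 7 lies just above the positive axis: although \<theta> 7 = 2 pi, the
      branch of the argument starts again at 0 there, and \<open>lift\<close> tends to
      \<open>Ln s\<close>. From sector 6, just below the axis, the limit is larger by 2 pi
      i.\<close>
    have lim7: "(lift \<longlongrightarrow> Ln s) (at s within sector \<theta> 7)" if "s \<in> ray \<theta> k - {0}" for s
    proof (rule Lim_transform_eventually[OF Ln[OF that]])
      have "Ln z = lift z" if z: "z \<in> sector \<theta> 7" for z
      proof -
        obtain w where w: "z = exp w" "\<theta> 7 < Im w" "Im w < \<theta> (7 + 1)" using z by (rule sector_obtain)
        define v where "v = w - 2 * of_real pi * \<i>"
        have "\<theta> 8 < \<theta> 9" by (rule angles_mono) auto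
        then have v: "z = exp v" "0 < Im v" "Im v < pi / 2"
          using w t7 by (auto simp: v_def exp_diff)
        show ?thesis unfolding v(1) using v(2,3) by (subst lift_exp; simp)
      qed
      then show "\<forall>\<^sub>F z in at s within sector \<theta> 7. Ln z = lift z"
        unfolding eventually_at_filter by (intro always_eventually) simp
    qed
    have lim6: "(lift \<longlongrightarrow> Ln s + 2 * of_real pi * \<i>) (at s within sector \<theta> 6)" if "s \<in> ray \<theta> k - {0}" for s
    proof (rule Lim_transform_eventually[OF tendsto_add[OF Ln[OF that] tendsto_const]])
      have "Ln z + 2 * of_real pi * \<i> = lift z" if z: "z \<in> sector \<theta> 6" for z
      proof -
        obtain w where w: "z = exp w" "\<theta> 6 < Im w" "Im w < \<theta> (6 + 1)" using z by (rule sector_obtain)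
        define v where "v = w - 2 * of_real pi * \<i>"
        have "\<theta> 5 < \<theta> 6" by (rule angles_mono) auto
        then have v: "z = exp v" "- (pi / 2) < Im v" "Im v < 0" "v + 2 * of_real pi * \<i> = w"
          using w t7 by (auto simp: v_def exp_diff)
        have "Ln z = v" unfolding v(1) using v(2,3) by simp
        moreover have "lift z = w" unfolding w(1) using v pi_gt_zero by (intro lift_exp) (auto simp: v_def)
        ultimately show ?thesis using v(4) by simp
      qed
      then show "\<forall>\<^sub>F z in at s within sector \<theta> 6. Ln z + 2 * of_real pi * \<i> = lift z"
        unfolding eventually_at_filter by (intro always_eventually) simp
    qed
    have c7: "continuous_on (ray \<theta> k - {0}) (\<lambda>s. Phi \<alpha> \<beta> (Ln s) ** F)"
      and c6: "continuous_on (ray \<theta> k - {0}) (\<lambda>s. Phi \<alpha> \<beta> (Ln s + 2 * of_real pi * \<i>) ** F)" for F :: "complex^2^2"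
      unfolding continuous_on_def by (intro ballI tendsto_Phi_mult tendsto_add tendsto_const Ln; assumption)+
    have side7: "plus_side k = 7" "minus_side k = 6" using True by (simp_all add: plus_side_def minus_side_def)
    have 76: "(7::nat) \<in> {1..8}" "(6::nat) \<in> {1..8}" by auto
    show ?thesis
      unfolding side7
    proof (intro exI conjI ballI)
      show "continuous_on (ray \<theta> k - {0}) (\<lambda>s. Phi \<alpha> \<beta> (Ln s) ** sector_factor \<alpha> \<beta> 7)" by (rule c7)
      show "continuous_on (ray \<theta> k - {0}) (\<lambda>s. Phi \<alpha> \<beta> (Ln s + 2 * of_real pi * \<i>) ** sector_factor \<alpha> \<beta> 6)" by (rule c6)
      fix s assume s: "s \<in> ray \<theta> k - {0}"
      show "(Psi \<theta> \<alpha> \<beta> \<longlongrightarrow> Phi \<alpha> \<beta> (Ln s) ** sector_factor \<alpha> \<beta> 7) (at s within sector \<theta> 7)"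
        by (rule Psi_tendsto[OF 76(1) lim7[OF s]])
      show "(Psi \<theta> \<alpha> \<beta> \<longlongrightarrow> Phi \<alpha> \<beta> (Ln s + 2 * of_real pi * \<i>) ** sector_factor \<alpha> \<beta> 6) (at s within sector \<theta> 6)"
        by (rule Psi_tendsto[OF 76(2) lim6[OF s]])
      show "Phi \<alpha> \<beta> (Ln s) ** sector_factor \<alpha> \<beta> 7 = Phi \<alpha> \<beta> (Ln s + 2 * of_real pi * \<i>) ** sector_factor \<alpha> \<beta> 6 ** jump \<alpha> \<beta> k"
        unfolding True by (rule Phi_monodromy[OF nz])
    qed
  qed
qed

end

section \<open>Growth at the origin and the assembled solution\<close>

definition second_column_order :: "complex \<Rightarrow> real \<Rightarrow> real" where
  "second_column_order \<alpha> s =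
     (if \<alpha> = 0 then - s else if Re \<alpha> > 0 then exp (- 2 * Re \<alpha> * s) else 1)"

text \<open>The weight is the general bound for Kummer solutions at c = 1 + 2 \<alpha>. Multiplied
  by the modulus of \<zeta>^\<alpha>, it has the order of ln|\<zeta>|, |\<zeta>|^(-Re \<alpha>) or
  |\<zeta>|^(Re \<alpha>) in the three cases. The strip |Im w| \<le> 2 pi contains the range of
  \<open>lift\<close>.\<close>

lemma row_near_0:
  assumes "Re \<alpha> > - 1 / 2"
  obtains K R where "K \<ge> 0" "R \<le> - 1"
    "\<And>w i. Re w \<le> R \<Longrightarrow> \<bar>Im w\<bar> \<le> 2 * pi \<Longrightarrow> norm (row_U \<alpha> \<beta> i w) \<le> K * second_column_order \<alpha> (Re w)"
    "\<And>w i. Re w \<le> R \<Longrightarrow> \<bar>Im w\<bar> \<le> 2 * pi \<Longrightarrow> norm (row_E \<alpha> \<beta> i w) \<le> K * second_column_order \<alpha> (Re w)"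
proof -
  have c: "Re (1 + 2 * \<alpha>) > 0" using assms by simp
  have order: "(if 1 + 2 * \<alpha> = 1 then - s else if Re (1 + 2 * \<alpha>) > 1 then exp ((1 - Re (1 + 2 * \<alpha>)) * s) else 1)
      = second_column_order \<alpha> s" for s
    by (simp add: second_column_order_def)
  have near: "\<exists>K R. R \<le> - 1 \<and> (\<forall>w. Re w \<le> R \<longrightarrow> \<bar>Im w\<bar> \<le> 2 * pi \<longrightarrow> norm (g w) \<le> K * second_column_order \<alpha> (Re w))"
    if "kummer_solution a (1 + 2 * \<alpha>) g" for a g
    using kummer_near_0[OF that c, of "2 * pi"] unfolding order .
  obtain K1 R1 where 1: "\<And>i. R1 i \<le> - 1" "\<And>w i. Re w \<le> R1 i \<Longrightarrow> \<bar>Im w\<bar> \<le> 2 * pi \<Longrightarrow>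
      norm (row_U \<alpha> \<beta> i w) \<le> K1 i * second_column_order \<alpha> (Re w)"
    using near[OF kummer_solution_row(1)[of \<alpha> \<beta>]] by metis
  obtain K2 R2 where 2: "\<And>i. R2 i \<le> - 1" "\<And>w i. Re w \<le> R2 i \<Longrightarrow> \<bar>Im w\<bar> \<le> 2 * pi \<Longrightarrow>
      norm (row_E \<alpha> \<beta> i w) \<le> K2 i * second_column_order \<alpha> (Re w)"
    using near[OF kummer_solution_row(2)[of \<alpha> \<beta>]] by metis
  define R where "R = Min (range R1 \<union> range R2)"
  define K where "K = Max (insert 0 (range K1 \<union> range K2))"
  have R: "R \<le> R1 i" "R \<le> R2 i" for i unfolding R_def by (auto intro!: Min_le)
  have K: "K1 i \<le> K" "K2 i \<le> K" "0 \<le> K" for i unfolding K_def by (rule Max_ge; simp)+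
  have pos: "0 \<le> second_column_order \<alpha> s" if "s \<le> - 1" for s
    using that by (simp add: second_column_order_def)
  show ?thesis
  proof (rule that[of K R])
    show "R \<le> - 1" using R(1)[of 1] 1(1)[of 1] by linarith
    fix w i assume w: "Re w \<le> R" "\<bar>Im w\<bar> \<le> 2 * pi"
    have "Re w \<le> - 1" using w(1) R(1)[of i] 1(1)[of i] by linarith
    note m = mult_right_mono[OF K(1) pos[OF this], of i] mult_right_mono[OF K(2) pos[OF this], of i]
    show "norm (row_U \<alpha> \<beta> i w) \<le> K * second_column_order \<alpha> (Re w)"
      by (rule order_trans[OF 1(2) m(1)]) (use w R(1)[of i] in auto)
    show "norm (row_E \<alpha> \<beta> i w) \<le> K * second_column_order \<alpha> (Re w)"
      by (rule order_trans[OF 2(2) m(2)]) (use w R(2)[of i] in auto)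
  qed (rule K(3))
qed

lemma norm_prefactor_le:
  assumes "Re w \<le> - 1"
  shows "norm (prefactor \<alpha> w) \<le> exp 1 * norm (exp (\<alpha> * w))"
proof -
  have "norm (- exp w / 2) = exp (Re w) / 2" by (simp add: norm_divide)
  also have "\<dots> \<le> 1" using assms by (simp add: order_trans[of _ 1])
  finally have "exp (norm (- exp w / 2)) \<le> exp 1" by simp
  then have "norm (exp (- exp w / 2)) \<le> exp 1" using norm_exp[of "- exp w / 2"] by linarith
  then show ?thesis unfolding prefactor_def norm_mult by (simp add: mult.commute mult_left_mono)
qed

text \<open>In the outer sectors the first column is a constant times the prefactor times H(e^w),
  and the entire function H is bounded on the unit disc.\<close>

lemma outer_first_column:
  assumes nz: "\<And>n::nat. n \<ge> 1 \<Longrightarrow> \<alpha> + \<beta> \<noteq> - of_nat n \<and> \<alpha> - \<beta> \<noteq> - of_nat n"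
  obtains K where "\<And>w k i. Re w \<le> - 1 \<Longrightarrow> k \<in> {2, 3, 6, 7} \<Longrightarrow>
    norm ((Phi \<alpha> \<beta> w ** sector_factor \<alpha> \<beta> k) $ i $ 1) \<le> K * norm (exp (\<alpha> * w))"
proof -
  define A where "A = phase \<alpha>"
  define B where "B = phase \<beta>"
  have AB: "A \<noteq> 0" "B \<noteq> 0" by (simp_all add: A_def B_def)
  have "\<exists>L. \<forall>w. Re w \<le> - 1 \<longrightarrow> norm (row_U \<alpha> \<beta> i w + B / A ^ 2 * row_E \<alpha> \<beta> i w) \<le> L" for i
  proof (rule row_connection[OF nz, of i])
    fix H assume H: "H holomorphic_on UNIV" "\<And>w. row_U \<alpha> \<beta> i w + phase (\<beta> - 2 * \<alpha>) * row_E \<alpha> \<beta> i w = H (exp w)"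
    have "bounded (H ` cball 0 1)"
      by (intro compact_imp_bounded compact_continuous_image holomorphic_on_imp_continuous_on
          holomorphic_on_subset[OF H(1)]) auto
    then obtain L where L: "\<forall>y\<in>H ` cball 0 1. norm y \<le> L" unfolding bounded_iff by blast
    have "norm (row_U \<alpha> \<beta> i w + B / A ^ 2 * row_E \<alpha> \<beta> i w) \<le> L" if "Re w \<le> - 1" for w
    proof -
      have "norm (exp w) \<le> 1" using that by simp
      then have "norm (H (exp w)) \<le> L" using L by simp
      then show ?thesis unfolding H(2)[symmetric] by (simp add: A_def B_def phase_simps)
    qed
    then show ?thesis by blast
  qed
  then obtain L where L: "\<And>i w. Re w \<le> - 1 \<Longrightarrow> norm (row_U \<alpha> \<beta> i w + B / A ^ 2 * row_E \<alpha> \<beta> i w) \<le> L i"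
    by metis
  \<comment> \<open>The first column of the sector factor is \<open>d k\<close> times (1, B / A^2);
    the last branch is meant for k = 7.\<close>
  define d where "d = (\<lambda>k::nat. if k = 2 then 1 else if k = 3 then A else if k = 6 then 1 / A else A ^ 2)"
  have col: "(Phi \<alpha> \<beta> w ** sector_factor \<alpha> \<beta> k) $ i $ 1 =
      d k * prefactor \<alpha> w * (row_U \<alpha> \<beta> i w + B / A ^ 2 * row_E \<alpha> \<beta> i w)" if "k \<in> {2, 3, 6, 7}" for w k i
  proof -
    from that consider "k = 2" | "k = 3" | "k = 6" | "k = 7" by auto
    then show ?thesis
      using AB by cases (simp_all add: matrix_mult_2_nth Phi_nth sector_factor_phase d_def
        A_def[symmetric] B_def[symmetric] field_simps power2_eq_square power3_eq_cube)
  qed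
  define K where "K = Max (norm ` d ` {2, 3, 6, 7}) * exp 1 * Max (range L)"
  show ?thesis
  proof (rule that[of K])
    fix w i and k :: nat assume w: "Re w \<le> - 1" and k: "k \<in> {2, 3, 6, 7}"
    have "norm (row_U \<alpha> \<beta> i w + B / A ^ 2 * row_E \<alpha> \<beta> i w) \<le> Max (range L)"
      by (rule order_trans[OF L[OF w]]) (auto intro: Max_ge)
    moreover have "norm (d k) \<le> Max (norm ` d ` {2, 3, 6, 7})" using k by (intro Max_ge) auto
    ultimately have "norm ((Phi \<alpha> \<beta> w ** sector_factor \<alpha> \<beta> k) $ i $ 1) \<le>
        (Max (norm ` d ` {2, 3, 6, 7}) * (exp 1 * norm (exp (\<alpha> * w)))) * Max (range L)"
      unfolding col[OF k] norm_mult using norm_prefactor_le[OF w, of \<alpha>]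
      by (intro mult_mono) (auto intro: mult_nonneg_nonneg order_trans[OF norm_ge_zero])
    then show "norm ((Phi \<alpha> \<beta> w ** sector_factor \<alpha> \<beta> k) $ i $ 1) \<le> K * norm (exp (\<alpha> * w))"
      by (simp add: K_def mult_ac)
  qed
qed

text \<open>No cancellation is involved here: the bound at the origin, valid for every Kummer
  solution, is applied to each of the two terms, and the sector factors contribute finitely many
  constants.\<close>

lemma outer_second_column:
  assumes "Re \<alpha> > - 1 / 2"
  obtains K R where "R \<le> - 1" "K \<ge> 0" "\<And>w k i. Re w \<le> R \<Longrightarrow> \<bar>Im w\<bar> \<le> 2 * pi \<Longrightarrow> k \<in> {2, 3, 6, 7} \<Longrightarrow>
    norm ((Phi \<alpha> \<beta> w ** sector_factor \<alpha> \<beta> k) $ i $ 2) \<le> K * norm (exp (\<alpha> * w)) * second_column_order \<alpha> (Re w)"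
proof -
  obtain K R where K: "K \<ge> 0" "R \<le> - 1"
    "\<And>w i. Re w \<le> R \<Longrightarrow> \<bar>Im w\<bar> \<le> 2 * pi \<Longrightarrow> norm (row_U \<alpha> \<beta> i w) \<le> K * second_column_order \<alpha> (Re w)"
    "\<And>w i. Re w \<le> R \<Longrightarrow> \<bar>Im w\<bar> \<le> 2 * pi \<Longrightarrow> norm (row_E \<alpha> \<beta> i w) \<le> K * second_column_order \<alpha> (Re w)"
    by (rule row_near_0[OF assms, of \<beta>]) (rule that, assumption+)
  define f where "f = (\<lambda>k. norm (sector_factor \<alpha> \<beta> k $ 1 $ 2) + norm (sector_factor \<alpha> \<beta> k $ 2 $ 2))"
  define D where "D = Max (f ` {2, 3, 6, 7})"
  have f: "f k \<le> D" if "k \<in> {2, 3, 6, 7}" for k using that unfolding D_def by (intro Max_ge) auto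
  have f0: "0 \<le> f k" for k by (simp add: f_def)
  have D0: "D \<ge> 0" using f0[of 2] f[of 2] by simp
  show ?thesis
  proof (rule that[of R "exp 1 * K * D"])
    show "R \<le> - 1" by (rule K(2))
    show "exp 1 * K * D \<ge> 0" using K(1) D0 by simp
    fix w i and k :: nat assume w: "Re w \<le> R" "\<bar>Im w\<bar> \<le> 2 * pi" and k: "k \<in> {2, 3, 6, 7}"
    define m where "m = second_column_order \<alpha> (Re w)"
    have w1: "Re w \<le> - 1" using w K(2) by simp
    have m: "m \<ge> 0" using w1 by (simp add: m_def second_column_order_def)
    have "(Phi \<alpha> \<beta> w ** sector_factor \<alpha> \<beta> k) $ i $ 2 =
        prefactor \<alpha> w * (row_U \<alpha> \<beta> i w * sector_factor \<alpha> \<beta> k $ 1 $ 2 + row_E \<alpha> \<beta> i w * sector_factor \<alpha> \<beta> k $ 2 $ 2)"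
      by (simp add: matrix_mult_2_nth Phi_nth algebra_simps)
    moreover have "norm (row_U \<alpha> \<beta> i w * sector_factor \<alpha> \<beta> k $ 1 $ 2 + row_E \<alpha> \<beta> i w * sector_factor \<alpha> \<beta> k $ 2 $ 2)
        \<le> K * m * D"
    proof -
      have "norm (row_U \<alpha> \<beta> i w * sector_factor \<alpha> \<beta> k $ 1 $ 2 + row_E \<alpha> \<beta> i w * sector_factor \<alpha> \<beta> k $ 2 $ 2)
          \<le> K * m * norm (sector_factor \<alpha> \<beta> k $ 1 $ 2) + K * m * norm (sector_factor \<alpha> \<beta> k $ 2 $ 2)"
        by (rule order_trans[OF norm_triangle_ineq], unfold norm_mult m_def,
            intro add_mono mult_right_mono K w norm_ge_zero)
      also have "\<dots> = K * m * f k" by (simp add: f_def distrib_left)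
      also have "\<dots> \<le> K * m * D" using K(1) m f[OF k] by (intro mult_left_mono) auto
      finally show ?thesis .
    qed
    ultimately have "norm ((Phi \<alpha> \<beta> w ** sector_factor \<alpha> \<beta> k) $ i $ 2) \<le> (exp 1 * norm (exp (\<alpha> * w))) * (K * m * D)"
      unfolding norm_mult[of "prefactor \<alpha> w"] by (simp only: norm_mult) (intro mult_mono norm_prefactor_le w1, auto)
    then show "norm ((Phi \<alpha> \<beta> w ** sector_factor \<alpha> \<beta> k) $ i $ 2) \<le> exp 1 * K * D * norm (exp (\<alpha> * w)) * second_column_order \<alpha> (Re w)"
      by (simp add: m_def mult_ac)
  qed
qed

text \<open>The function \<Phi> is kept abstract so that the outer sectors and the lens sectors with
  their jump undone are covered by one statement.\<close>

lemma outer_behaviour_Phi: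
  assumes \<alpha>: "Re \<alpha> > - 1 / 2"
    and nz: "\<And>n::nat. n \<ge> 1 \<Longrightarrow> \<alpha> + \<beta> \<noteq> - of_nat n \<and> \<alpha> - \<beta> \<noteq> - of_nat n"
    and \<Phi>: "\<And>z. z \<in> S \<Longrightarrow> \<exists>k\<in>{2, 3, 6, 7}. \<Phi> z = Phi \<alpha> \<beta> (lift z) ** sector_factor \<alpha> \<beta> k"
  shows "outer_behaviour \<alpha> S \<Phi>"
proof -
  obtain K1 where K1: "\<And>w k i. Re w \<le> - 1 \<Longrightarrow> k \<in> {2, 3, 6, 7} \<Longrightarrow>
    norm ((Phi \<alpha> \<beta> w ** sector_factor \<alpha> \<beta> k) $ i $ 1) \<le> K1 * norm (exp (\<alpha> * w))"
    by (rule outer_first_column[OF nz]) (rule that | assumption)+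
  obtain K2 R where K2: "R \<le> - 1" "K2 \<ge> 0" "\<And>w k i. Re w \<le> R \<Longrightarrow> \<bar>Im w\<bar> \<le> 2 * pi \<Longrightarrow> k \<in> {2, 3, 6, 7} \<Longrightarrow>
    norm ((Phi \<alpha> \<beta> w ** sector_factor \<alpha> \<beta> k) $ i $ 2) \<le> K2 * norm (exp (\<alpha> * w)) * second_column_order \<alpha> (Re w)"
    by (rule outer_second_column[OF \<alpha>, of \<beta>]) (rule that, assumption+)
  have near: "\<forall>\<^sub>F z in at 0 within S. z \<in> S \<and> Re (lift z) \<le> R"
    unfolding eventually_at
  proof (intro exI conjI ballI impI)
    show "exp R > 0" by simp
    fix z assume z: "z \<in> S" "z \<noteq> 0 \<and> dist z 0 < exp R"
    then have "ln (norm z) \<le> ln (exp R)" by (subst ln_le_cancel_iff) auto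
    then show "Re (lift z) \<le> R" by (simp add: lift_def)
  qed
  have im: "0 \<le> Im (lift z)" "Im (lift z) \<le> 2 * pi" for z
    using Arg2pi_ge_0[of z] Arg2pi_lt_2pi[of z] by (simp_all add: lift_def)
  have col1: "\<forall>\<^sub>F z in at 0 within S. norm (\<Phi> z $ i $ 1) \<le> K1 * norm (branch_powr z \<alpha>)" for i
    using near
  proof eventually_elim
    case (elim z)
    obtain k where k: "k \<in> {2, 3, 6, 7}" "\<Phi> z = Phi \<alpha> \<beta> (lift z) ** sector_factor \<alpha> \<beta> k" using \<Phi> elim by blast
    show ?case unfolding k(2) branch_powr_def using elim K2(1) by (intro K1 k) auto
  qed
  have col2: "\<forall>\<^sub>F z in at 0 within S. norm (\<Phi> z $ i $ 2) \<le> K2 * norm (branch_powr z \<alpha>) * second_column_order \<alpha> (ln (norm z))" for i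
    using near
  proof eventually_elim
    case (elim z)
    obtain k where k: "k \<in> {2, 3, 6, 7}" "\<Phi> z = Phi \<alpha> \<beta> (lift z) ** sector_factor \<alpha> \<beta> k" using \<Phi> elim by blast
    have "Re (lift z) = ln (norm z)" by (simp add: lift_def)
    then show ?case unfolding k(2) branch_powr_def using elim im[of z] K2(3)[of "lift z" k i] k(1) by simp
  qed
  show ?thesis
  proof (cases "\<alpha> = 0")
    case True
    have "(\<lambda>z. \<Phi> z $ i $ 1) \<in> O[at 0 within S](\<lambda>z. 1)" for i
      using col1[of i] True by (intro bigoI[where c = K1]) (simp add: branch_powr_def)
    moreover have "(\<lambda>z. \<Phi> z $ i $ 2) \<in> O[at 0 within S](\<lambda>z. of_real (ln (norm z)))" for i
    proof (rule bigoI[where c = K2])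
      show "\<forall>\<^sub>F z in at 0 within S. norm (\<Phi> z $ i $ 2) \<le> K2 * norm (complex_of_real (ln (norm z)))"
        using col2[of i]
      proof eventually_elim
        case (elim z)
        have "norm (\<Phi> z $ i $ 2) \<le> K2 * - ln (norm z)"
          using elim True by (simp add: branch_powr_def second_column_order_def)
        also have "\<dots> \<le> K2 * \<bar>ln (norm z)\<bar>" using K2(2) by (intro mult_left_mono) auto
        finally show ?case by simp
      qed
    qed
    ultimately show ?thesis using True by (simp add: outer_behaviour_def)
  next
    case False
    have 1: "(\<lambda>z. \<Phi> z $ i $ 1) \<in> O[at 0 within S](\<lambda>z. branch_powr z \<alpha>)" for i
      by (rule bigoI[OF col1])
    have 2: "\<exists>f \<in> O[at 0 within S](\<lambda>z. branch_powr z \<alpha>). \<exists>g \<in> O[at 0 within S](\<lambda>z. branch_powr z (- \<alpha>)).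
        \<forall>z\<in>S. \<Phi> z $ i $ 2 = f z + g z" for i
    proof (cases "Re \<alpha> > 0")
      case True
      \<comment> \<open>The moduli of \<zeta>^\<alpha> |\<zeta>|^(-2 Re \<alpha>) and
        \<zeta>^(-\<alpha>) differ by the factor exp(-2 Im \<alpha> arg \<zeta>), which is at most
        exp(4 pi |Im \<alpha>|) because 0 \<le> arg \<zeta> \<le> 2 pi.\<close>
      have "(\<lambda>z. \<Phi> z $ i $ 2) \<in> O[at 0 within S](\<lambda>z. branch_powr z (- \<alpha>))"
      proof (rule bigoI[where c = "K2 * exp (4 * pi * \<bar>Im \<alpha>\<bar>)"])
        show "\<forall>\<^sub>F z in at 0 within S. norm (\<Phi> z $ i $ 2) \<le> K2 * exp (4 * pi * \<bar>Im \<alpha>\<bar>) * norm (branch_powr z (- \<alpha>))"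
          using col2[of i]
        proof eventually_elim
          case (elim z)
          define w where "w = lift z"
          have re: "Re w = ln (norm z)" by (simp add: w_def lift_def)
          have "\<bar>Im \<alpha> * Im w\<bar> \<le> \<bar>Im \<alpha>\<bar> * (2 * pi)"
            unfolding abs_mult using im[of z] by (intro mult_left_mono) (auto simp: w_def)
          then have "- (2 * (Im \<alpha> * Im w)) \<le> 4 * pi * \<bar>Im \<alpha>\<bar>" by (simp add: abs_le_iff mult_ac)
          then have "norm (exp (\<alpha> * w)) * exp (- 2 * Re \<alpha> * Re w) \<le> exp (4 * pi * \<bar>Im \<alpha>\<bar>) * norm (exp (- \<alpha> * w))"
            by (simp add: algebra_simps flip: exp_add)
          from mult_left_mono[OF this K2(2)]
          have "K2 * norm (exp (\<alpha> * w)) * exp (- 2 * Re \<alpha> * Re w) \<le> K2 * exp (4 * pi * \<bar>Im \<alpha>\<bar>) * norm (exp (- \<alpha> * w))"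
            by (simp only: mult.assoc)
          moreover have "norm (\<Phi> z $ i $ 2) \<le> K2 * norm (exp (\<alpha> * w)) * exp (- 2 * Re \<alpha> * Re w)"
            using elim True False unfolding re by (simp add: second_column_order_def branch_powr_def w_def)
          ultimately show ?case unfolding branch_powr_def w_def by (rule order_trans[rotated])
        qed
      qed
      then show ?thesis
        by (intro bexI[of _ "\<lambda>_. 0"] bexI[of _ "\<lambda>z. \<Phi> z $ i $ 2"]) auto
    next
      case neg: False
      \<comment> \<open>For Re \<alpha> \<le> 0 and \<alpha> \<noteq> 0 the Kummer solutions are
        bounded near the origin, so the whole second column has order \<zeta>^\<alpha> and the other
        summand is taken to be 0.\<close>
      have "(\<lambda>z. \<Phi> z $ i $ 2) \<in> O[at 0 within S](\<lambda>z. branch_powr z \<alpha>)"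
        using col2[of i] neg False by (intro bigoI[where c = K2]) (simp add: second_column_order_def)
      then show ?thesis
        by (intro bexI[of _ "\<lambda>z. \<Phi> z $ i $ 2"] bexI[of _ "\<lambda>_. 0"]) auto
    qed
    show ?thesis using False 1 2 by (simp add: outer_behaviour_def)
  qed
qed

lemma rhp_origin_Psi:
  assumes \<theta>: "contour_angles \<theta>" and \<alpha>: "Re \<alpha> > - 1 / 2"
    and nz: "\<And>n::nat. n \<ge> 1 \<Longrightarrow> \<alpha> + \<beta> \<noteq> - of_nat n \<and> \<alpha> - \<beta> \<noteq> - of_nat n"
  shows "rhp_origin \<theta> \<alpha> \<beta> (Psi \<theta> \<alpha> \<beta>)"
proof -
  note P = Psi_sector(2)[OF \<theta>, of _ _ \<alpha> \<beta>]
  have lens: "Psi \<theta> \<alpha> \<beta> z ** M = Phi \<alpha> \<beta> (lift z) ** sector_factor \<alpha> \<beta> l"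
    if "k \<in> {1..8}" "sector_factor \<alpha> \<beta> k ** M = sector_factor \<alpha> \<beta> l" "z \<in> sector \<theta> k" for k l z M
    unfolding P[OF that(1,3)] matrix_mul_assoc[symmetric] that(2) ..
  have k: "(1::nat) \<in> {1..8}" "(4::nat) \<in> {1..8}" "(5::nat) \<in> {1..8}" "(8::nat) \<in> {1..8}" by auto
  show ?thesis
    unfolding rhp_origin_def
  proof (intro conjI outer_behaviour_Phi[OF \<alpha> nz])
    fix z assume "z \<in> (\<Union>k\<in>{2, 3, 6, 7}. sector \<theta> k)"
    then obtain k where "k \<in> {2, 3, 6, 7}" "z \<in> sector \<theta> k" by blast
    then show "\<exists>k\<in>{2, 3, 6, 7}. Psi \<theta> \<alpha> \<beta> z = Phi \<alpha> \<beta> (lift z) ** sector_factor \<alpha> \<beta> k"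
      using P[of k z] by (intro bexI[of _ k]) auto
  next
    fix z assume "z \<in> sector \<theta> 1"
    from lens[OF k(1) sector_factor_lens(1) this]
    show "\<exists>k\<in>{2, 3, 6, 7}. Psi \<theta> \<alpha> \<beta> z ** jump \<alpha> \<beta> 2 = Phi \<alpha> \<beta> (lift z) ** sector_factor \<alpha> \<beta> k"
      by (intro bexI[of _ 2]) auto
  next
    fix z assume "z \<in> sector \<theta> 4"
    from lens[OF k(2) sector_factor_lens(2) this]
    show "\<exists>k\<in>{2, 3, 6, 7}. Psi \<theta> \<alpha> \<beta> z ** jump \<alpha> \<beta> 4 = Phi \<alpha> \<beta> (lift z) ** sector_factor \<alpha> \<beta> k"
      by (intro bexI[of _ 3]) auto
  next
    fix z assume "z \<in> sector \<theta> 5"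
    from lens[OF k(3) sector_factor_lens(3) this]
    show "\<exists>k\<in>{2, 3, 6, 7}. Psi \<theta> \<alpha> \<beta> z ** matrix_inv (jump \<alpha> \<beta> 6) = Phi \<alpha> \<beta> (lift z) ** sector_factor \<alpha> \<beta> k"
      by (intro bexI[of _ 6]) auto
  next
    fix z assume "z \<in> sector \<theta> 8"
    from lens[OF k(4) sector_factor_lens(4) this]
    show "\<exists>k\<in>{2, 3, 6, 7}. Psi \<theta> \<alpha> \<beta> z ** matrix_inv (jump \<alpha> \<beta> 8) = Phi \<alpha> \<beta> (lift z) ** sector_factor \<alpha> \<beta> k"
      by (intro bexI[of _ 7]) auto
  qed
qed

theorem proposition4p1:
  fixes \<alpha> \<beta> :: complex and \<theta> :: "nat \<Rightarrow> real"
  assumes "contour_angles \<theta>"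
    and "\<alpha> \<noteq> 0 \<or> \<beta> \<noteq> 0"
    and "Re \<alpha> > - 1 / 2"
    and "\<And>n::nat. n \<ge> 1 \<Longrightarrow> \<alpha> + \<beta> \<noteq> - of_nat n \<and> \<alpha> - \<beta> \<noteq> - of_nat n"
  shows "rhp_solution \<theta> \<alpha> \<beta> (Psi \<theta> \<alpha> \<beta>) \<and>
    (\<forall>\<zeta>\<in>sector \<theta> 1. Psi \<theta> \<alpha> \<beta> \<zeta> = Psi_I \<alpha> \<beta> \<zeta>) \<and>
    (\<forall>k\<in>{1..8}. \<forall>\<zeta>\<in>sector \<theta> k. Psi \<theta> \<alpha> \<beta> \<zeta> = Psi_I \<alpha> \<beta> \<zeta> ** sector_factor \<alpha> \<beta> k)"
proof (intro conjI ballI)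
  show "rhp_solution \<theta> \<alpha> \<beta> (Psi \<theta> \<alpha> \<beta>)"
    unfolding rhp_solution_def
    using rhp_analytic_Psi[OF assms(1)] rhp_jumps_Psi[OF assms(1,4)] rhp_origin_Psi[OF assms(1,3,4)] by blast
  have "sector_factor \<alpha> \<beta> 1 = mat 1" by (simp add: sector_factor_def Let_def)
  then show "Psi \<theta> \<alpha> \<beta> \<zeta> = Psi_I \<alpha> \<beta> \<zeta>" if "\<zeta> \<in> sector \<theta> 1" for \<zeta>
    using Psi_sector(1)[OF assms(1) _ that, of \<alpha> \<beta>] by (simp add: matrix_mul_rid)
  show "Psi \<theta> \<alpha> \<beta> \<zeta> = Psi_I \<alpha> \<beta> \<zeta> ** sector_factor \<alpha> \<beta> k"
    if "k \<in> {1..8}" "\<zeta> \<in> sector \<theta> k" for k \<zeta>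
    by (rule Psi_sector(1)[OF assms(1) that])
qed

end
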